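(* Let $d\ge1$, let $\kappa=(\kappa_1,\dots,\kappa_d)$ with all $\kappa_i\ge0$, let $\mu\ge0$, and assume $\alpha_{\kappa,\mu}=|\kappa|+\mu+\frac{d-1}{2}\ge\frac12$. Let $1\le p\le\infty$. For $f\in L^p_{\mathbf{u}(\kappa,\mu)}(\mathbb{V}^{d+1})$ and $g\in L^1_{u(2\alpha_{\kappa,\mu})}(\mathbb{R}_+)$, $$\|f*_{\mathbb{V}}g\|_{p,\kappa,\mu}\le\|f\|_{p,\kappa,\mu}\,\|g\|_{1,u(2\alpha_{\kappa,\mu})}.$$
   Context: Notation: $|\kappa|=\kappa_1+\dots+\kappa_d$, $h_\kappa(x)=\prod_{i=1}^d|x_i|^{\kappa_i}$, $\mathbb{R}_+=[0,\infty)$. The solid cone is $\mathbb{V}^{d+1}=\{(x,t)\in\mathbb{R}^d\times\mathbb{R}_+:\|x\|\le t\}$. Put $W_{\kappa,\mu}(x,t)=h_\kappa^2(x)(t^2-\|x\|^2)^{\mu-\frac12}e^{-t}$, $\mathbf{u}(x,t)=h_\kappa^2(x)(t^2-\|x\|^2)^{\mu-\frac12}$, and $\mathbf{b}_{\kappa,\mu}=1/\int_{\mathbb{V}^{d+1}}W_{\kappa,\mu}\,dx\,dt$. Norms: $\|f\|_{p,\kappa,\mu}=\big(\mathbf{b}_{\kappa,\mu}\int_{\mathbb{V}^{d+1}}|f(x,t)e^{-t/2}|^p\,\mathbf{u}(x,t)\,dx\,dt\big)^{1/p}$ for $1\le p<\infty$, $\|f\|_{\infty,\kappa,\mu}=\operatorname{ess\,sup}|f(x,t)|e^{-t/2}$;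 $L^p_{\mathbf{u}(\kappa,\mu)}(\mathbb{V}^{d+1})$ is the space of $f$ with finite norm. On $\mathbb{R}_+$: $\|g\|_{1,u(\alpha)}=\frac{1}{\Gamma(\alpha+1)}\int_0^\infty|g(t)|e^{-t/2}t^\alpha\,dt$, with space $L^1_{u(\alpha)}(\mathbb{R}_+)$. Generalized translation (with $\alpha=\alpha_{\kappa,\mu}>0$): for $(x,t)\in\mathbb{V}^{d+1}$, $$\mathbf{T}_{(x,t)}g(y,s)=C_{\kappa,\mu}\int_{[-1,1]^{d+1}}\int_0^\pi g(t+s+2\boldsymbol\rho\cos\theta)e^{-\boldsymbol\rho\cos\theta}j_{\alpha-1}(\boldsymbol\rho\sin\theta)(\sin\theta)^{2\alpha-1}\,d\theta\,\Phi_\kappa(u')(1-u_{d+1}^2)^{\mu-1}\,du,$$ where $u=(u',u_{d+1})$, $\boldsymbol\rho=\sqrt{\tfrac12\big(ts+\sum_{i=1}^dx_iy_iu_i+\sqrt{t^2-\|x\|^2}\sqrt{s^2-\|y\|^2}\,u_{d+1}\big)}$, $j_\alpha(z)=z^{-\alpha}J_\alpha(z)$ ($J_\alpha$ the Bessel function), $\Phi_\kappa(u')=\prod_{i=1}^d(1+u_i)(1-u_i^2)^{\kappa_i-1}$, $C_{\kappa,\mu}=\frac{2^{\alpha-1}\Gamma(\alpha+\frac12)}{\sqrt\pi}\,c_{\mu-\frac12}\prod_{i=1}^dc_{\kappa_i-\frac12}$, $c_\lambda=\frac{\Gamma(\lambda+1)}{\Gamma(\frac12)\Gamma(\lambda+\frac12)}$.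 If $\kappa_i=0$, $c_{\kappa_i-\frac12}\int_{-1}^1f(u_i)(1+u_i)(1-u_i^2)^{\kappa_i-1}du_i$ is replaced by its limit $f(1)$; if $\mu=0$, $c_{\mu-\frac12}\int_{-1}^1f(u_{d+1})(1-u_{d+1}^2)^{\mu-1}du_{d+1}$ is replaced by its limit $\frac12[f(1)+f(-1)]$. Pseudo convolution: $f*_{\mathbb{V}}g(x,t)=\mathbf{b}_{\kappa,\mu}\int_{\mathbb{V}^{d+1}}f(y,s)\,\mathbf{T}_{(x,t)}g(y,s)\,W_{\kappa,\mu}(y,s)\,dy\,ds$. *)

theory Defs
  imports "HOL-Probability.Probability" "HOL-Probability.Essential_Supremum"
begin

section \<open>Cone, weights and norms\<close>

text \<open>
  A point \<open>(x,t)\<close> of the cone has type \<open>(real ^ 'd) \<times> real\<close>; the dimension \<open>d \<ge> 1\<close> is \<open>CARD('d)\<close>.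
  All functions are real valued and Lebesgue measurable.  The convention \<open>0 powr a = 0\<close> affects
  the weights below only on Lebesgue null sets (\<open>x$i = 0\<close> or \<open>norm x = t\<close> or \<open>t = 0\<close>).
\<close>

definition solid_cone :: "((real ^ 'd) \<times> real) set" where
  "solid_cone = {(x, t). 0 \<le> t \<and> norm x \<le> t}"

definition cone_alpha :: "real ^ 'd \<Rightarrow> real \<Rightarrow> real" where
  "cone_alpha \<kappa> \<mu> = (\<Sum>i\<in>UNIV. \<kappa> $ i) + \<mu> + (real CARD('d) - 1) / 2"

definition dunkl_h :: "real ^ 'd \<Rightarrow> real ^ 'd \<Rightarrow> real" where
  "dunkl_h \<kappa> x = (\<Prod>i\<in>UNIV. \<bar>x $ i\<bar> powr (\<kappa> $ i))"

definition cone_u :: "real ^ 'd \<Rightarrow> real \<Rightarrow> (real ^ 'd) \<times> real \<Rightarrow> real" where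
  "cone_u \<kappa> \<mu> = (\<lambda>(x, t). (dunkl_h \<kappa> x)\<^sup>2 * (t\<^sup>2 - (norm x)\<^sup>2) powr (\<mu> - 1/2))"

definition cone_W :: "real ^ 'd \<Rightarrow> real \<Rightarrow> (real ^ 'd) \<times> real \<Rightarrow> real" where
  "cone_W \<kappa> \<mu> = (\<lambda>(x, t). (dunkl_h \<kappa> x)\<^sup>2 * (t\<^sup>2 - (norm x)\<^sup>2) powr (\<mu> - 1/2) * exp (- t))"

definition cone_b :: "real ^ 'd \<Rightarrow> real \<Rightarrow> real" where
  "cone_b \<kappa> \<mu> = 1 / (LINT z:solid_cone|lebesgue. cone_W \<kappa> \<mu> z)"

text \<open>The power \<open>a\<^sup>r\<close> of an extended nonnegative number, for \<open>r > 0\<close>.\<close>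

definition ennpow :: "ennreal \<Rightarrow> real \<Rightarrow> ennreal" where
  "ennpow a r = (if a = \<infinity> then \<infinity> else ennreal (enn2real a powr r))"

text \<open>The norms are extended valued, so that ``finite norm'' is meaningful for every measurable function.\<close>

definition cone_norm ::
    "real ^ 'd \<Rightarrow> real \<Rightarrow> ennreal \<Rightarrow> ((real ^ 'd) \<times> real \<Rightarrow> real) \<Rightarrow> ennreal" where
  "cone_norm \<kappa> \<mu> p f =
     (if p = \<infinity>
      then esssup (lebesgue_on solid_cone) (\<lambda>(x, t). ennreal (\<bar>f (x, t)\<bar> * exp (- t / 2)))
      else ennpow
             (ennreal (cone_b \<kappa> \<mu>) *
              (\<integral>\<^sup>+ z \<in> solid_cone.
                 ennreal (\<bar>f z * exp (- snd z / 2)\<bar> powr enn2real p * cone_u \<kappa> \<mu> z) \<partial>lebesgue))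
             (1 / enn2real p))"

definition cone_Lp ::
    "real ^ 'd \<Rightarrow> real \<Rightarrow> ennreal \<Rightarrow> ((real ^ 'd) \<times> real \<Rightarrow> real) set" where
  "cone_Lp \<kappa> \<mu> p =
     {f \<in> borel_measurable (lebesgue_on solid_cone). cone_norm \<kappa> \<mu> p f < \<infinity>}"

definition halfline_norm1 :: "real \<Rightarrow> (real \<Rightarrow> real) \<Rightarrow> ennreal" where
  "halfline_norm1 a g =
     ennreal (1 / Gamma (a + 1)) *
     (\<integral>\<^sup>+ t \<in> {0..}. ennreal (\<bar>g t\<bar> * exp (- t / 2) * t powr a) \<partial>lebesgue)"

definition halfline_L1 :: "real \<Rightarrow> (real \<Rightarrow> real) set" where
  "halfline_L1 a = {g \<in> borel_measurable (lebesgue_on {0..}). halfline_norm1 a g < \<infinity>}"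

section \<open>Generalized translation\<close>

definition bessel_J :: "real \<Rightarrow> real \<Rightarrow> real" where
  "bessel_J \<nu> z = (\<Sum>n. (-1) ^ n / fact n * rGamma (real n + \<nu> + 1) * (z / 2) powr (2 * real n + \<nu>))"

text \<open>Used only for \<open>z \<ge> 0\<close>; the value at \<open>z = 0\<close> is the continuous extension of \<open>z\<^sup>-\<^sup>\<nu> J\<^sub>\<nu>(z)\<close>.\<close>

definition bessel_j :: "real \<Rightarrow> real \<Rightarrow> real" where
  "bessel_j \<nu> z = (if z = 0 then rGamma (\<nu> + 1) / 2 powr \<nu> else z powr (- \<nu>) * bessel_J \<nu> z)"

definition c_const :: "real \<Rightarrow> real" where
  "c_const l = Gamma (l + 1) / (Gamma (1/2) * Gamma (l + 1/2))"

text \<open>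
  The functionals \<open>f \<mapsto> c\<^bsub>k-1/2\<^esub> \<integral> f(v) (1+v) (1-v\<^sup>2)\<^bsup>k-1\<^esup> dv\<close> and
  \<open>f \<mapsto> c\<^bsub>m-1/2\<^esub> \<integral> f(v) (1-v\<^sup>2)\<^bsup>m-1\<^esup> dv\<close> over \<open>[-1,1]\<close>, with the constants included and with the
  prescribed limits \<open>f(1)\<close> and \<open>(f(1) + f(-1)) / 2\<close> at exponent \<open>0\<close>, are rendered as measures,
  so that coordinates with and without density can be combined in one product measure.
\<close>

definition kappa_measure :: "real \<Rightarrow> real measure" where
  "kappa_measure k =
     (if k = 0 then return borel 1
      else density lborel (\<lambda>v. ennreal (indicator {-1..1} v *
             (c_const (k - 1/2) * (1 + v) * (1 - v\<^sup>2) powr (k - 1)))))"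

definition mu_measure :: "real \<Rightarrow> real measure" where
  "mu_measure m =
     (if m = 0 then distr (uniform_count_measure {-1, 1}) borel (\<lambda>v. v)
      else density lborel (\<lambda>v. ennreal (indicator {-1..1} v *
             (c_const (m - 1/2) * (1 - v\<^sup>2) powr (m - 1)))))"

lemma c_const_nonneg: "0 < k \<Longrightarrow> 0 \<le> c_const (k - 1/2)"
  by (auto simp: c_const_def intro!: divide_nonneg_nonneg mult_nonneg_nonneg less_imp_le[OF Gamma_real_pos])

lemma integral_kappa_measure_0:
  assumes "f \<in> borel_measurable borel"
  shows "(LINT v|kappa_measure 0. f v) = (f 1 :: real)"
  using assms by (simp add: kappa_measure_def integral_return)

lemma integral_kappa_measure_pos:
  fixes f :: "real \<Rightarrow> real"
  assumes "f \<in> borel_measurable borel" "0 < k"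
  shows "(LINT v|kappa_measure k. f v) =
    c_const (k - 1/2) * (LINT v:{-1..1}|lborel. f v * ((1 + v) * (1 - v\<^sup>2) powr (k - 1)))"
proof -
  have "(LINT v|kappa_measure k. f v) =
     (LINT v|lborel. (indicator {-1..1} v * (c_const (k - 1/2) * (1 + v) * (1 - v\<^sup>2) powr (k - 1))) *\<^sub>R f v)"
    unfolding kappa_measure_def if_not_P[OF less_imp_neq[OF assms(2), THEN not_sym]]
    using assms(1) c_const_nonneg[OF assms(2)]
    by (intro integral_density) (auto simp: indicator_def abs_square_le_1 abs_le_iff)
  also have "\<dots> = (LINT v|lborel. c_const (k - 1/2) *
      (indicator {-1..1} v * (f v * ((1 + v) * (1 - v\<^sup>2) powr (k - 1)))))"
    by (intro Bochner_Integration.integral_cong) (auto simp: algebra_simps)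
  finally show ?thesis by (simp add: set_lebesgue_integral_def)
qed

lemma integral_mu_measure_0:
  fixes f :: "real \<Rightarrow> real"
  assumes "f \<in> borel_measurable borel"
  shows "(LINT v|mu_measure 0. f v) = (f 1 + f (-1)) / 2"
  using assms
  by (simp add: mu_measure_def integral_distr integral_uniform_count_measure add.commute)

lemma integral_mu_measure_pos:
  fixes f :: "real \<Rightarrow> real"
  assumes "f \<in> borel_measurable borel" "0 < m"
  shows "(LINT v|mu_measure m. f v) =
    c_const (m - 1/2) * (LINT v:{-1..1}|lborel. f v * (1 - v\<^sup>2) powr (m - 1))"
proof -
  have "(LINT v|mu_measure m. f v) =
     (LINT v|lborel. (indicator {-1..1} v * (c_const (m - 1/2) * (1 - v\<^sup>2) powr (m - 1))) *\<^sub>R f v)"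
    unfolding mu_measure_def if_not_P[OF less_imp_neq[OF assms(2), THEN not_sym]]
    using assms(1) c_const_nonneg[OF assms(2)]
    by (intro integral_density) (auto simp: indicator_def abs_square_le_1 abs_le_iff)
  also have "\<dots> = (LINT v|lborel. c_const (m - 1/2) *
      (indicator {-1..1} v * (f v * (1 - v\<^sup>2) powr (m - 1))))"
    by (intro Bochner_Integration.integral_cong) (auto simp: algebra_simps)
  finally show ?thesis by (simp add: set_lebesgue_integral_def)
qed

definition cube_measure :: "real ^ 'd \<Rightarrow> real \<Rightarrow> (('d \<Rightarrow> real) \<times> real) measure" where
  "cube_measure \<kappa> \<mu> = (\<Pi>\<^sub>M i\<in>UNIV. kappa_measure (\<kappa> $ i)) \<Otimes>\<^sub>M mu_measure \<mu>"

definition cone_rho ::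
    "(real ^ 'd) \<times> real \<Rightarrow> (real ^ 'd) \<times> real \<Rightarrow> ('d \<Rightarrow> real) \<times> real \<Rightarrow> real" where
  "cone_rho = (\<lambda>(x, t) (y, s) (u, v).
     sqrt ((t * s + (\<Sum>i\<in>UNIV. x $ i * y $ i * u i)
            + sqrt (t\<^sup>2 - (norm x)\<^sup>2) * sqrt (s\<^sup>2 - (norm y)\<^sup>2) * v) / 2))"

definition translation_integrand ::
    "real \<Rightarrow> (real \<Rightarrow> real) \<Rightarrow> real \<Rightarrow> real \<Rightarrow> real \<Rightarrow> real" where
  "translation_integrand \<alpha> g r \<rho> \<theta> =
     g (r + 2 * \<rho> * cos \<theta>) * exp (- \<rho> * cos \<theta>) * bessel_j (\<alpha> - 1) (\<rho> * sin \<theta>)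
       * sin \<theta> powr (2 * \<alpha> - 1)"

text \<open>The remaining factors of \<open>C\<^bsub>\<kappa>,\<mu>\<^esub>\<close>, namely the \<open>c\<^bsub>\<mu>-1/2\<^esub>\<close> and \<open>c\<^bsub>\<kappa>\<^sub>i-1/2\<^esub>\<close>, are part of \<^const>\<open>cube_measure\<close>.\<close>

definition translation ::
    "real ^ 'd \<Rightarrow> real \<Rightarrow> (real ^ 'd) \<times> real \<Rightarrow> (real \<Rightarrow> real) \<Rightarrow> (real ^ 'd) \<times> real \<Rightarrow> real" where
  "translation \<kappa> \<mu> z g w =
     (let \<alpha> = cone_alpha \<kappa> \<mu> in
      2 powr (\<alpha> - 1) * Gamma (\<alpha> + 1/2) / sqrt pi *
      (LINT u|cube_measure \<kappa> \<mu>. (LINT \<theta>:{0..pi}|lebesgue.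
         translation_integrand \<alpha> g (snd z + snd w) (cone_rho z w u) \<theta>)))"

definition translation_exists ::
    "real ^ 'd \<Rightarrow> real \<Rightarrow> (real ^ 'd) \<times> real \<Rightarrow> (real \<Rightarrow> real) \<Rightarrow> (real ^ 'd) \<times> real \<Rightarrow> bool" where
  "translation_exists \<kappa> \<mu> z g w \<longleftrightarrow>
     (let \<alpha> = cone_alpha \<kappa> \<mu>;
          F = (\<lambda>u. translation_integrand \<alpha> g (snd z + snd w) (cone_rho z w u)) in
      (AE u in cube_measure \<kappa> \<mu>. set_integrable lebesgue {0..pi} (F u)) \<and>
      integrable (cube_measure \<kappa> \<mu>) (\<lambda>u. (LINT \<theta>:{0..pi}|lebesgue. F u \<theta>)))"

section \<open>Pseudo convolution\<close>

definition pseudo_conv ::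
    "real ^ 'd \<Rightarrow> real \<Rightarrow> ((real ^ 'd) \<times> real \<Rightarrow> real) \<Rightarrow> (real \<Rightarrow> real) \<Rightarrow> (real ^ 'd) \<times> real \<Rightarrow> real" where
  "pseudo_conv \<kappa> \<mu> f g z =
     cone_b \<kappa> \<mu> * (LINT w:solid_cone|lebesgue. f w * translation \<kappa> \<mu> z g w * cone_W \<kappa> \<mu> w)"

text \<open>
  Divergent Bochner integrals have the value \<open>0\<close>; this predicate states that the integrals defining
  \<open>pseudo_conv \<kappa> \<mu> f g z\<close> converge absolutely.  A translation that fails to exist for \<open>w\<close> in a null
  set is harmless.
\<close>

definition pseudo_conv_exists ::
    "real ^ 'd \<Rightarrow> real \<Rightarrow> ((real ^ 'd) \<times> real \<Rightarrow> real) \<Rightarrow> (real \<Rightarrow> real) \<Rightarrow> (real ^ 'd) \<times> real \<Rightarrow> bool" where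
  "pseudo_conv_exists \<kappa> \<mu> f g z \<longleftrightarrow>
     (AE w in lebesgue_on solid_cone. translation_exists \<kappa> \<mu> z g w) \<and>
     set_integrable lebesgue solid_cone (\<lambda>w. f w * translation \<kappa> \<mu> z g w * cone_W \<kappa> \<mu> w)"

end

theory Submission
  imports Defs "HOL-Complex_Analysis.Conformal_Mappings"
begin

text \<open>The constant has to come out exactly, so every kernel is a mean against a probability
  law: the factor of C left in \<open>translation\<close>, times the Bessel value at 0, is precisely
  the normalization c_{\<alpha>-1/2} of \<beta>_\<alpha>. The Bessel bound is Poisson's integral,
  which presents j/j(0) as the characteristic function of \<beta>_{\<alpha>-1/2}; its parameter must
  be nonnegative. Working with laws instead of densities puts the point masses at parameter 0 and
  the densities at positive parameters under common moment formulas. All these laws live on [-1,1],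
  where moments determine a law, so identities between them become cancellations of Gamma factors.
  The Gaussian radius is brought in because z enters L only through a unit vector of R^{d+1}, and a
  linear form with unit coefficient vector in independent standard normals is again standard normal.
  A separate obstacle is measurability: f and g are Lebesgue measurable only, and g is arbitrary on
  the negative axis, whereas iterated integrals need inner integrals measurable in the outer
  variables. Estimates are therefore made for Borel versions of f and g and carried back.\<close>

abbreviation (input) "gauss \<equiv> std_normal_distribution"

abbreviation (input) "gauss_weight a q \<equiv> ennreal (indicator {0..} q * (q powr a * exp (- q\<^sup>2 / 2)))"

abbreviation (input) "beta_weight m v \<equiv> ennreal (indicator {-1..1} v * (1 - v\<^sup>2) powr (m - 1))"

abbreviation (input) "power_weight a r \<equiv> ennreal (indicator {0..} r * r powr a)"

text \<open>
  Write \<open>\<alpha>\<close> for \<open>cone_alpha \<kappa> \<mu>\<close>.  Since \<open>exp (-\<rho> cos \<theta>)\<close> is \<open>exp ((t + s) / 2)\<close> times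
  \<open>exp (-r / 2)\<close> at \<open>r = t + s + 2 \<rho> cos \<theta>\<close>, and \<open>\<bar>j(z)\<bar> \<le> j(0)\<close> for the Bessel factor (here \<open>\<alpha> \<ge> 1/2\<close>
  enters), the weighted convolution is dominated by an integral operator whose kernel \<open>K(z,w)\<close> is the mean
  of \<open>G(t + s + 2 \<rho> cos \<theta>)\<close> with \<open>G(r) = \<bar>g(r)\<bar> exp (-r / 2)\<close>.  The kernel is symmetric and nonnegative,
  so by Hoelder and Tonelli (Schur's test) it suffices that the integral of \<open>K(z,w)\<close> in \<open>w\<close> equals the
  norm of \<open>g\<close> for every \<open>z\<close>.

  For this identity let \<open>\<beta>\<^sub>m\<close> be the probability law on \<open>[-1,1]\<close> with density proportional to
  \<open>(1 - v\<^sup>2)\<^bsup>m-1\<^esup>\<close>.  Three facts are combined.  (1) For \<open>w = (s \<xi>, s)\<close> one has \<open>2 \<rho>\<^sup>2 = t s (1 + L)\<close> with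
  \<open>L\<close> distributed as \<open>\<beta>\<^bsub>\<alpha>+1/2\<^esub>\<close>, independently of \<open>z\<close>: multiplying by an independent Gaussian radius turns
  the coordinates \<open>\<xi>\<^sub>i u\<^sub>i\<close> into independent standard normal variables, and the radius is then cancelled by
  comparing moments.  (2) If moreover \<open>cos \<theta>\<close> has law \<open>\<beta>\<^sub>\<alpha>\<close>, then \<open>sqrt ((1 + L) / 2) cos \<theta>\<close> has law
  \<open>\<beta>\<^bsub>2\<alpha>+1/2\<^esub>\<close>.  (3) The translation \<open>G(t + s + 2 sqrt (t s) v)\<close> averaged over \<open>\<beta>\<^bsub>2\<alpha>+1/2\<^esub>\<close> preserves
  \<open>s\<^bsup>2\<alpha>\<^esup> ds\<close>.
\<close>

section \<open>Substitutions on the half-line and Beta laws\<close>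

lemma nn_integral_incseq_sets:
  assumes [measurable]: "f \<in> borel_measurable M" "\<And>n. A n \<in> sets M" and "incseq A"
  shows "(\<integral>\<^sup>+x. f x * indicator (\<Union>n. A n) x \<partial>M) = (SUP n. \<integral>\<^sup>+x. f x * indicator (A n) x \<partial>M)"
proof -
  have "(SUP n. f x * indicator (A n) x) = f x * indicator (\<Union>n. A n) x" for x
  proof (cases "x \<in> (\<Union>n. A n)")
    case True
    then obtain k where "x \<in> A k" by auto
    then have "f x \<le> (SUP n. f x * indicator (A n) x)"
      by (intro SUP_upper2[of k]) auto
    moreover have "(SUP n. f x * indicator (A n) x) \<le> f x"
      by (rule SUP_least) (auto split: split_indicator)
    ultimately show ?thesis using True by simp
  qed simp
  then show ?thesis
    using \<open>incseq A\<close>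
    by (subst nn_integral_monotone_convergence_SUP[symmetric])
       (auto intro!: mult_left_mono simp: incseq_def le_fun_def split: split_indicator)
qed

lemma nn_integral_square_subst:
  fixes F :: "real \<Rightarrow> ennreal"
  assumes [measurable]: "F \<in> borel_measurable borel"
  shows "(\<integral>\<^sup>+x. F (x\<^sup>2) * ennreal (2 * x) * indicator {0..} x \<partial>lborel)
       = (\<integral>\<^sup>+x. F x * indicator {0..} x \<partial>lborel)"
proof -
  have 1: "(\<Union>n::nat. {0..real n}) = {0..}"
    by (auto simp: real_arch_simple)
  have 2: "(\<Union>n::nat. {0..(real n)\<^sup>2}) = {0..}"
  proof (auto)
    fix x :: real assume "0 \<le> x"
    obtain n :: nat where "sqrt x \<le> real n" using real_arch_simple by blast
    then have "(sqrt x)\<^sup>2 \<le> (real n)\<^sup>2" by (intro power_mono) (use \<open>0 \<le> x\<close> in auto)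
    then show "\<exists>n::nat. x \<le> (real n)\<^sup>2" using \<open>0 \<le> x\<close> by auto
  qed
  have step: "(\<integral>\<^sup>+x. F x * indicator {0..(real n)\<^sup>2} x \<partial>lborel)
      = (\<integral>\<^sup>+x. F (x\<^sup>2) * ennreal (2 * x) * indicator {0..real n} x \<partial>lborel)" for n :: nat
  \<comment> \<open>The substitution rule is applied on a proper interval; for \<open>n = 0\<close>
    both sides integrate over a null set.\<close>
  proof (cases "n = 0")
    case True
    have "(\<integral>\<^sup>+x. f x * indicator {0} x \<partial>lborel) = 0" for f :: "real \<Rightarrow> ennreal"
      by (rule nn_integral_zero'[where M=lborel], rule AE_mp[OF AE_lborel_singleton[of "0::real"]])
         (auto intro!: AE_I2)
    then show ?thesis using True by simp
  next
    case False
    have "((\<lambda>x. x\<^sup>2) has_real_derivative 2 * x) (at x)" for x :: real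
      by (auto intro!: derivative_eq_intros)
    then show ?thesis
      using nn_integral_substitution_aux[of F 0 "real n" "\<lambda>x. x\<^sup>2" "\<lambda>x. 2 * x"] False
      by (auto intro!: continuous_intros)
  qed
  have "(\<integral>\<^sup>+x. F x * indicator {0..} x \<partial>lborel)
      = (SUP n::nat. \<integral>\<^sup>+x. F x * indicator {0..(real n)\<^sup>2} x \<partial>lborel)"
    unfolding 2[symmetric] by (rule nn_integral_incseq_sets) (auto simp: incseq_def power_mono)
  also have "\<dots> = (SUP n::nat. \<integral>\<^sup>+x. F (x\<^sup>2) * ennreal (2 * x) * indicator {0..real n} x \<partial>lborel)"
    by (simp add: step)
  also have "\<dots> = (\<integral>\<^sup>+x. F (x\<^sup>2) * ennreal (2 * x) * indicator {0..} x \<partial>lborel)"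
    unfolding 1[symmetric] by (rule nn_integral_incseq_sets[symmetric]) (auto simp: incseq_def)
  finally show ?thesis by simp
qed

text \<open>Since \<open>0 powr 0 = 0\<close>, identities between \<open>powr\<close> expressions
  may fail at the origin; as a null set it can be left out.\<close>

lemma nn_integral_cong_nonzero:
  fixes f g :: "real \<Rightarrow> ennreal"
  assumes "\<And>x. x \<noteq> 0 \<Longrightarrow> f x = g x"
  shows "(\<integral>\<^sup>+x. f x \<partial>lborel) = (\<integral>\<^sup>+x. g x \<partial>lborel)"
  by (rule nn_integral_cong_AE, rule AE_mp[OF AE_lborel_singleton[of "0::real"]]) (auto intro!: AE_I2 assms)

lemma nn_integral_fold_reflect:
  fixes F :: "real \<Rightarrow> ennreal"
  assumes [measurable]: "F \<in> borel_measurable borel"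
  shows "(\<integral>\<^sup>+x. F x \<partial>lborel) = (\<integral>\<^sup>+x. (F x + F (- x)) * indicator {0..} x \<partial>lborel)"
proof -
  have "(\<integral>\<^sup>+x. F x \<partial>lborel) = (\<integral>\<^sup>+x. F x * indicator {0..} x + F x * indicator {..<0} x \<partial>lborel)"
    by (rule nn_integral_cong) (auto split: split_indicator)
  also have "\<dots> = (\<integral>\<^sup>+x. F x * indicator {0..} x \<partial>lborel) + (\<integral>\<^sup>+x. F x * indicator {..<0} x \<partial>lborel)"
    by (rule nn_integral_add) auto
  also have "(\<integral>\<^sup>+x. F x * indicator {..<0} x \<partial>lborel) = (\<integral>\<^sup>+x. F (-x) * indicator {0..} x \<partial>lborel)"
  proof -
    have "(\<integral>\<^sup>+x. F x * indicator {..<0} x \<partial>lborel) = (\<integral>\<^sup>+x. F (-x) * indicator {..<0} (-x) \<partial>lborel)"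
      by (subst nn_integral_real_affine[where c="-1" and t=0]) auto
    also have "\<dots> = (\<integral>\<^sup>+x. F (-x) * indicator {0..} x \<partial>lborel)"
      by (rule nn_integral_cong_AE, rule AE_mp[OF AE_lborel_singleton[of "0::real"]])
         (auto intro!: AE_I2 split: split_indicator)
    finally show ?thesis .
  qed
  also have "(\<integral>\<^sup>+x. F x * indicator {0..} x \<partial>lborel) + \<dots> = (\<integral>\<^sup>+x. F x * indicator {0..} x + F (-x) * indicator {0..} x \<partial>lborel)"
    by (rule nn_integral_add[symmetric]) auto
  finally show ?thesis by (simp add: distrib_right)
qed

lemma nn_integral_reflect:
  fixes F :: "real \<Rightarrow> ennreal"
  assumes [measurable]: "F \<in> borel_measurable borel"
  shows "(\<integral>\<^sup>+x. F (- x) \<partial>lborel) = (\<integral>\<^sup>+x. F x \<partial>lborel)"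
  using nn_integral_real_affine[of F "-1" 0] by simp

lemma nn_integral_Beta:
  assumes "0 < a" "0 < b"
  shows "(\<integral>\<^sup>+x. ennreal (indicator {0..1} x * (x powr (a - 1) * (1 - x) powr (b - 1))) \<partial>lborel) = ennreal (Beta a b)"
  using nn_integral_has_integral_lebesgue[OF _ has_integral_Beta_real[OF assms]] by simp

lemma nn_integral_Gamma_scaled:
  assumes "0 < a" "0 < c"
  shows "(\<integral>\<^sup>+x. ennreal (indicator {0..} x * (x powr (a - 1) * exp (- (c * x)))) \<partial>lborel) = ennreal (Gamma a / c powr a)"
proof -
  have "ennreal (Gamma a) = (\<integral>\<^sup>+x. ennreal (indicator {0..} x * x powr (a - 1) / exp x) \<partial>lborel)"
    using Gamma_conv_nn_integral_real[OF assms(1)] .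
  also have "\<dots> = ennreal c * (\<integral>\<^sup>+x. ennreal (indicator {0..} (c * x) * (c * x) powr (a - 1) / exp (c * x)) \<partial>lborel)"
    using assms by (subst nn_integral_real_affine[where c=c and t=0]) auto
  also have "\<dots> = (\<integral>\<^sup>+x. ennreal c * ennreal (indicator {0..} (c * x) * (c * x) powr (a - 1) / exp (c * x)) \<partial>lborel)"
    by (rule nn_integral_cmult[symmetric]) auto
  also have "\<dots> = (\<integral>\<^sup>+x. ennreal (c powr a) * ennreal (indicator {0..} x * (x powr (a - 1) * exp (- (c * x)))) \<partial>lborel)"
    using assms
    by (intro nn_integral_cong)
       (auto simp: ennreal_mult'[symmetric] powr_mult exp_minus field_simps powr_diff zero_le_mult_iff split: split_indicator)
  also have "\<dots> = ennreal (c powr a) * (\<integral>\<^sup>+x. ennreal (indicator {0..} x * (x powr (a - 1) * exp (- (c * x)))) \<partial>lborel)"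
    by (rule nn_integral_cmult) auto
  finally have *: "ennreal (Gamma a) = \<dots>" .
  have "ennreal (Gamma a / c powr a) = ennreal (1 / c powr a) * ennreal (Gamma a)"
    using assms by (subst ennreal_mult'[symmetric]) (auto simp: field_simps)
  also have "\<dots> = ennreal (1 / c powr a) * ennreal (c powr a) * (\<integral>\<^sup>+x. ennreal (indicator {0..} x * (x powr (a - 1) * exp (- (c * x)))) \<partial>lborel)"
    by (subst *) (simp add: mult.assoc)
  also have "ennreal (1 / c powr a) * ennreal (c powr a) = 1"
    using assms by (subst ennreal_mult'[symmetric]) auto
  finally show ?thesis by simp
qed

section \<open>The laws \<open>mu_measure\<close> and \<open>kappa_measure\<close>\<close>

lemma sets_mu_measure [measurable_cong, simp]: "sets (mu_measure m) = sets borel"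
  by (simp add: mu_measure_def)

lemma sets_kappa_measure [measurable_cong, simp]: "sets (kappa_measure k) = sets borel"
  by (simp add: kappa_measure_def)

lemma space_mu_measure [simp]: "space (mu_measure m) = UNIV"
  by (simp add: mu_measure_def)

lemma space_kappa_measure [simp]: "space (kappa_measure k) = UNIV"
  by (simp add: kappa_measure_def)

lemma one_minus_sq_nonneg: "v \<in> {-1..1} \<Longrightarrow> 0 \<le> 1 - v\<^sup>2" for v :: real
  by (simp add: abs_square_le_1 abs_le_iff)

lemma nn_integral_mu_measure_pos:
  assumes [measurable]: "F \<in> borel_measurable borel" and m: "0 < m"
  shows "(\<integral>\<^sup>+v. F v \<partial>mu_measure m)
    = ennreal (c_const (m - 1/2)) * (\<integral>\<^sup>+v. F v * beta_weight m v \<partial>lborel)"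
proof -
  have "(\<integral>\<^sup>+v. F v \<partial>mu_measure m)
      = (\<integral>\<^sup>+v. ennreal (indicator {-1..1} v * (c_const (m - 1/2) * (1 - v\<^sup>2) powr (m - 1))) * F v \<partial>lborel)"
    using m by (simp add: mu_measure_def nn_integral_density)
  also have "\<dots> = (\<integral>\<^sup>+v. ennreal (c_const (m - 1/2)) * (F v * beta_weight m v) \<partial>lborel)"
    using c_const_nonneg[OF m]
    by (intro nn_integral_cong) (auto simp: ennreal_mult' mult_ac split: split_indicator)
  also have "\<dots> = ennreal (c_const (m - 1/2)) * (\<integral>\<^sup>+v. F v * beta_weight m v \<partial>lborel)"
    by (rule nn_integral_cmult) auto
  finally show ?thesis .
qed

lemma ennreal_half_add_half: "ennreal (1/2) * (x + x) = x"
proof -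
  have "ennreal (1/2) * (x + x) = (ennreal (1/2) * ennreal 2) * x"
    by (simp add: mult_2[symmetric] mult.assoc)
  also have "ennreal (1/2) * ennreal 2 = 1" by (subst ennreal_mult'[symmetric]) auto
  finally show ?thesis by simp
qed

lemma inverse_2_mult_2_ennreal: "inverse 2 * 2 = (1::ennreal)" "inverse 2 + inverse 2 = (1::ennreal)"
  using ennreal_half_add_half[of 1] by (auto simp: mult_2_right)

lemma nn_integral_mu_measure_0:
  assumes [measurable]: "F \<in> borel_measurable borel"
  shows "(\<integral>\<^sup>+v. F v \<partial>mu_measure 0) = ennreal (1/2) * (F 1 + F (- 1))"
  by (simp add: mu_measure_def nn_integral_distr uniform_count_measure_def nn_integral_point_measure_finite
       distrib_left add.commute)

lemma nn_integral_kappa_measure_0: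
  assumes [measurable]: "F \<in> borel_measurable borel"
  shows "(\<integral>\<^sup>+v. F v \<partial>kappa_measure 0) = F 1"
  by (simp add: kappa_measure_def nn_integral_return)

lemma nn_integral_kappa_measure_pos:
  assumes [measurable]: "F \<in> borel_measurable borel" and m: "0 < m"
  shows "(\<integral>\<^sup>+v. F v \<partial>kappa_measure m)
    = ennreal (c_const (m - 1/2)) * (\<integral>\<^sup>+v. F v * ennreal (indicator {-1..1} v * ((1 + v) * (1 - v\<^sup>2) powr (m - 1))) \<partial>lborel)"
proof -
  have "(\<integral>\<^sup>+v. F v \<partial>kappa_measure m)
      = (\<integral>\<^sup>+v. ennreal (indicator {-1..1} v * (c_const (m - 1/2) * (1 + v) * (1 - v\<^sup>2) powr (m - 1))) * F v \<partial>lborel)"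
    using m by (simp add: kappa_measure_def nn_integral_density)
  also have "\<dots> = (\<integral>\<^sup>+v. ennreal (c_const (m - 1/2)) * (F v * ennreal (indicator {-1..1} v * ((1 + v) * (1 - v\<^sup>2) powr (m - 1)))) \<partial>lborel)"
    using c_const_nonneg[OF m]
    by (intro nn_integral_cong) (auto simp: ennreal_mult' mult_ac split: split_indicator)
  also have "\<dots> = ennreal (c_const (m - 1/2)) * (\<integral>\<^sup>+v. F v * ennreal (indicator {-1..1} v * ((1 + v) * (1 - v\<^sup>2) powr (m - 1))) \<partial>lborel)"
    by (rule nn_integral_cmult) auto
  finally show ?thesis .
qed

text \<open>Evenness folds the integral onto the half-line, where v^2 becomes the variable of a Beta
  integral; the Jacobian 2v accounts for the doubling and for the 1/2 in the first argument.\<close>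

lemma nn_integral_mu_weight:
  assumes m: "0 < m"
  shows "(\<integral>\<^sup>+v. ennreal (v ^ (2 * n)) * beta_weight m v \<partial>lborel)
    = ennreal (Beta (real n + 1/2) m)"
proof -
  have "(\<integral>\<^sup>+v. ennreal (v ^ (2 * n)) * beta_weight m v \<partial>lborel)
     = (\<integral>\<^sup>+v. (ennreal (v ^ (2 * n)) * beta_weight m v
          + ennreal ((-v) ^ (2 * n)) * ennreal (indicator {-1..1} (-v) * (1 - (-v)\<^sup>2) powr (m - 1))) * indicator {0..} v \<partial>lborel)"
    by (subst nn_integral_fold_reflect) auto
  also have "\<dots> = (\<integral>\<^sup>+v. ennreal (indicator {0..1} (v\<^sup>2) * ((v\<^sup>2) powr (real n + 1/2 - 1) * (1 - v\<^sup>2) powr (m - 1))) * ennreal (2 * v) * indicator {0..} v \<partial>lborel)"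
  proof (rule nn_integral_cong_nonzero, goal_cases)
    case (1 v)
    show ?case
    proof (cases "v > 0 \<and> v \<le> 1")
      case True
      then have v: "0 < v" "v \<le> 1" "v\<^sup>2 \<le> 1" by (auto simp: abs_square_le_1)
      have "(v\<^sup>2) powr (real n + 1/2 - 1) * (2 * v) = 2 * v ^ (2 * n)"
      proof -
        have "(v\<^sup>2) powr (real n + 1/2 - 1) = v powr (2 * (real n + 1/2 - 1))"
        proof -
          have "v\<^sup>2 = v powr 2" using v by simp
          then show ?thesis by (simp only: powr_powr)
        qed
        also have "\<dots> * v = v powr (2 * (real n + 1/2 - 1) + 1)"
          using v by (simp only: powr_add) simp
        also have "2 * (real n + 1/2 - 1) + 1 = real (2 * n)" by simp
        also have "v powr real (2 * n) = v ^ (2 * n)" using v by (simp only: powr_realpow)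
        finally show ?thesis by simp
      qed
      then have "indicator {0..1} (v\<^sup>2) * ((v\<^sup>2) powr (real n + 1/2 - 1) * (1 - v\<^sup>2) powr (m - 1)) * (2 * v) = 2 * (v ^ (2 * n) * (1 - v\<^sup>2) powr (m - 1))"
        using v by (simp add: mult_ac)
      then have "ennreal (indicator {0..1} (v\<^sup>2) * ((v\<^sup>2) powr (real n + 1/2 - 1) * (1 - v\<^sup>2) powr (m - 1))) * ennreal (2 * v)
         = ennreal (2 * (v ^ (2 * n) * (1 - v\<^sup>2) powr (m - 1)))"
        using v by (subst ennreal_mult'[symmetric]) auto
      moreover have "ennreal (v ^ (2 * n)) * ennreal ((1 - v\<^sup>2) powr (m - 1)) + ennreal (v ^ (2 * n)) * ennreal ((1 - v\<^sup>2) powr (m - 1))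
         = ennreal (2 * (v ^ (2 * n) * (1 - v\<^sup>2) powr (m - 1)))"
        using v by (simp add: ennreal_mult'[symmetric] ennreal_plus[symmetric] del: ennreal_plus)
      ultimately show ?thesis using v by simp
    next
      case False
      then show ?thesis using \<open>v \<noteq> 0\<close> by (auto simp: abs_square_le_1 split: split_indicator)
    qed
  qed
  also have "\<dots> = (\<integral>\<^sup>+v. ennreal (indicator {0..1} v * (v powr (real n + 1/2 - 1) * (1 - v) powr (m - 1))) * indicator {0..} v \<partial>lborel)"
    by (rule nn_integral_square_subst) auto
  also have "\<dots> = (\<integral>\<^sup>+v. ennreal (indicator {0..1} v * (v powr (real n + 1/2 - 1) * (1 - v) powr (m - 1))) \<partial>lborel)"
    by (intro nn_integral_cong) (auto split: split_indicator)
  also have "\<dots> = ennreal (Beta (real n + 1/2) m)"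
    using m by (intro nn_integral_Beta) auto
  finally show ?thesis .
qed

text \<open>A single formula for the point masses at \<open>m = 0\<close> and the densities at
  \<open>m > 0\<close>, so that moments can later be compared without a case distinction.\<close>

lemma nn_integral_mu_measure_even_moment:
  assumes m: "0 \<le> m"
  shows "(\<integral>\<^sup>+v. ennreal (v ^ (2 * n)) \<partial>mu_measure m)
    = ennreal (Gamma (real n + 1/2) * Gamma (m + 1/2) / (Gamma (1/2) * Gamma (real n + m + 1/2)))"
proof (cases "m = 0")
  case True
  have "Gamma (real n + 1 / 2) \<noteq> (0::real)" "Gamma (1 / 2) \<noteq> (0::real)"
    using Gamma_real_pos[of "real n + 1/2"] Gamma_real_pos[of "1/2"] by linarith+
  then show ?thesis using True
    by (simp add: nn_integral_mu_measure_0 inverse_2_mult_2_ennreal)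
next
  case False
  with m have m: "0 < m" by simp
  have pos: "0 < Gamma (m + 1/2)" "0 < Gamma (m::real)" "0 < Gamma (real n + 1/2)" "0 < Gamma (real n + m + 1/2)"
    using m by (auto intro!: Gamma_real_pos)
  have "(\<integral>\<^sup>+v. ennreal (v ^ (2 * n)) \<partial>mu_measure m) = ennreal (c_const (m - 1/2)) * ennreal (Beta (real n + 1/2) m)"
    using m by (subst nn_integral_mu_measure_pos) (auto simp: nn_integral_mu_weight)
  also have "\<dots> = ennreal (c_const (m - 1/2) * Beta (real n + 1/2) m)"
    using c_const_nonneg[OF m] by (simp add: ennreal_mult')
  also have "c_const (m - 1/2) * Beta (real n + 1/2) m
    = Gamma (real n + 1/2) * Gamma (m + 1/2) / (Gamma (1/2) * Gamma (real n + m + 1/2))"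
    proof -
    have "real n + 1/2 + m = real n + m + 1/2" "1/2 + m = m + 1/2" "m - 1/2 + 1 = m + 1/2" by simp_all
    then show ?thesis using pos by (simp only: c_const_def Beta_def) (simp add: field_simps)
  qed
  finally show ?thesis .
qed

text \<open>The total mass is the moment of order 0, which is where the normalization by
  \<open>c_const\<close> is verified.\<close>

lemma prob_space_mu_measure:
  assumes "0 \<le> m" shows "prob_space (mu_measure m)"
proof
  have "Gamma (m + 1/2) \<noteq> 0" "Gamma (1 / 2) \<noteq> (0::real)"
    using Gamma_real_pos[of "m + 1/2"] Gamma_real_pos[of "1/2"] assms by linarith+
  then show "emeasure (mu_measure m) (space (mu_measure m)) = 1"
    using nn_integral_mu_measure_even_moment[OF assms, of 0] by (simp add: )
qed

lemma nn_integral_mu_measure_reflect: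
  assumes [measurable]: "F \<in> borel_measurable borel" and "0 \<le> m"
  shows "(\<integral>\<^sup>+v. F (- v) \<partial>mu_measure m) = (\<integral>\<^sup>+v. F v \<partial>mu_measure m)"
proof (cases "m = 0")
  case True then show ?thesis by (simp add: nn_integral_mu_measure_0 add.commute)
next
  case False
  with assms have m: "0 < m" by simp
  let ?w = "\<lambda>v. beta_weight m v"
  have "(\<integral>\<^sup>+v. F (- v) * ?w v \<partial>lborel) = (\<integral>\<^sup>+v. F (- v) * ?w (- v) \<partial>lborel)"
    by (rule nn_integral_cong) (auto split: split_indicator)
  also have "\<dots> = (\<integral>\<^sup>+v. F v * ?w v \<partial>lborel)"
    by (rule nn_integral_reflect[where F="\<lambda>v. F v * ?w v"]) auto
  finally show ?thesis using m
    by (subst (1 2) nn_integral_mu_measure_pos) auto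
qed

text \<open>Because (1 + v) + (1 - v) = 2, the even part of \<open>kappa_measure k\<close> is
  \<open>mu_measure k\<close>; the asymmetric factor disappears as soon as v and -v are
  averaged.\<close>

lemma nn_integral_kappa_measure_symmetrize:
  assumes [measurable]: "F \<in> borel_measurable borel" and k: "0 \<le> k"
  shows "(\<integral>\<^sup>+v. F v + F (- v) \<partial>kappa_measure k) = 2 * (\<integral>\<^sup>+v. F v \<partial>mu_measure k)"
proof (cases "k = 0")
  case True then show ?thesis
    using inverse_2_mult_2_ennreal(1)
    by (simp add: nn_integral_mu_measure_0 nn_integral_kappa_measure_0 mult.assoc[symmetric] mult.commute[of 2])
next
  case False
  with k have k: "0 < k" by simp
  let ?w = "\<lambda>v. indicat_real {- 1..1} v * ((1 + v) * (1 - v\<^sup>2) powr (k - 1))"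
  have "(\<integral>\<^sup>+v. (F v + F (- v)) * ennreal (?w v) \<partial>lborel)
     = (\<integral>\<^sup>+v. F v * ennreal (?w v) \<partial>lborel) + (\<integral>\<^sup>+v. F (- v) * ennreal (?w v) \<partial>lborel)"
    by (subst nn_integral_add[symmetric]) (auto simp: distrib_right)
  also have "(\<integral>\<^sup>+v. F (- v) * ennreal (?w v) \<partial>lborel) = (\<integral>\<^sup>+v. F v * ennreal (?w (- v)) \<partial>lborel)"
    by (subst nn_integral_reflect[symmetric]) auto
  also have "(\<integral>\<^sup>+v. F v * ennreal (?w v) \<partial>lborel) + \<dots> = (\<integral>\<^sup>+v. F v * ennreal (?w v) + F v * ennreal (?w (- v)) \<partial>lborel)"
    by (rule nn_integral_add[symmetric]) auto
  also have "\<dots> = (\<integral>\<^sup>+v. 2 * (F v * beta_weight k v) \<partial>lborel)"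
  proof (rule nn_integral_cong, goal_cases)
    case (1 v)
    show ?case
    proof (cases "v \<in> {-1..1}")
      case True
      have "ennreal (?w v) + ennreal (?w (- v)) = ennreal (?w v + ?w (- v))"
        using True by (intro ennreal_plus[symmetric]) auto
      also have "?w v + ?w (- v) = 2 * (indicator {-1..1} v * (1 - v\<^sup>2) powr (k - 1))"
        using True by (simp add: algebra_simps)
      also have "ennreal \<dots> = 2 * beta_weight k v"
        by (simp add: ennreal_mult')
      finally show ?thesis
        by (simp only: distrib_left[symmetric] mult_ac)
    qed auto
  qed
  also have "\<dots> = 2 * (\<integral>\<^sup>+v. F v * beta_weight k v \<partial>lborel)"
    by (rule nn_integral_cmult) auto
  finally show ?thesis using k
    by (subst nn_integral_mu_measure_pos, simp, simp, subst nn_integral_kappa_measure_pos) (auto simp: mult_ac)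
qed

lemma prob_space_kappa_measure:
  assumes "0 \<le> k" shows "prob_space (kappa_measure k)"
proof
  interpret mu: prob_space "mu_measure k" by (rule prob_space_mu_measure[OF assms])
  \<comment> \<open>With the constant 1/2 the symmetrized integrand is 1, so the total mass is
    reduced to that of \<open>mu_measure k\<close>.\<close>
  have "(\<integral>\<^sup>+v. ennreal (1/2) + ennreal (1/2) \<partial>kappa_measure k) = 2 * (\<integral>\<^sup>+v. ennreal (1/2) \<partial>mu_measure k)"
    by (rule nn_integral_kappa_measure_symmetrize) (use assms in auto)
  moreover have "ennreal (1/2) + ennreal (1/2) = 1" "2 * ennreal (1/2) = 1"
    using inverse_2_mult_2_ennreal by (auto simp: mult.commute[of 2])
  ultimately show "emeasure (kappa_measure k) (space (kappa_measure k)) = 1"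
    by (simp add: mu.emeasure_space_1[simplified])
qed

lemma AE_mu_measure_bounded: 
  assumes "0 \<le> m" shows "AE v in mu_measure m. \<bar>v\<bar> \<le> 1"
proof -
  have "(\<integral>\<^sup>+v. indicator (- {-1..1}) v \<partial>mu_measure m) = 0"
  proof (cases "m = 0")
    case False
    have "(\<integral>\<^sup>+v. indicator (- {-1..1}) v * beta_weight m v \<partial>lborel) = (\<integral>\<^sup>+v. 0 \<partial>(lborel :: real measure))"
      by (rule nn_integral_cong) (auto split: split_indicator)
    then show ?thesis using False assms by (subst nn_integral_mu_measure_pos) auto
  qed (use nn_integral_mu_measure_0[of "indicator (- {-1..1})"] in simp)
  then have "emeasure (mu_measure m) (- {-1..1}) = 0"
    by (subst (asm) nn_integral_indicator) auto
  then show ?thesis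
    by (intro AE_I[where N="- {-1..1}"]) auto
qed

lemma AE_kappa_measure_bounded:
  assumes "0 \<le> k" shows "AE v in kappa_measure k. \<bar>v\<bar> \<le> 1"
proof -
  have "(\<integral>\<^sup>+v. indicator (- {-1..1}) v \<partial>kappa_measure k) = 0"
  proof (cases "k = 0")
    case False
    have "(\<integral>\<^sup>+v. indicator (- {-1..1}) v * ennreal (indicat_real {- 1..1} v * ((1 + v) * (1 - v\<^sup>2) powr (k - 1))) \<partial>lborel) = (\<integral>\<^sup>+v. 0 \<partial>(lborel :: real measure))"
      by (rule nn_integral_cong) (auto split: split_indicator)
    then show ?thesis using False assms by (subst nn_integral_kappa_measure_pos) auto
  qed (use nn_integral_kappa_measure_0[of "indicator (- {-1..1})"] in simp)
  then have "emeasure (kappa_measure k) (- {-1..1}) = 0"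
    by (subst (asm) nn_integral_indicator) auto
  then show ?thesis
    by (intro AE_I[where N="- {-1..1}"]) auto
qed

section \<open>Moments and the Bessel function\<close>

text \<open>On [-1,1] all absolute moments are at most 1, so the Taylor remainder of the
  characteristic function is at most 2|t|^n/n! and the moment series converges to it
  everywhere.\<close>

lemma (in real_distribution) char_sums:
  assumes "AE x in M. \<bar>x\<bar> \<le> 1"
  shows "(\<lambda>k. (\<i> * t) ^ k / fact k * expectation (\<lambda>x. x ^ k)) sums char M t"
    and "integrable M (\<lambda>x. x ^ k)"
proof -
  have int: "integrable M (\<lambda>x. x ^ k)" for k
    by (rule integrable_const_bound[where B=1])
       (use assms in \<open>auto elim!: eventually_mono simp: power_abs intro!: power_le_one\<close>)
  then show "integrable M (\<lambda>x. x ^ k)" .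
  have le1: "expectation (\<lambda>x. \<bar>x\<bar> ^ k) \<le> 1" for k
    by (rule integral_le_const[OF integrable_abs[OF int, unfolded power_abs]])
       (use assms in \<open>auto elim!: eventually_mono intro!: power_le_one\<close>)
  have bound: "norm ((\<Sum>k\<le>n. (\<i> * t) ^ k / fact k * expectation (\<lambda>x. x ^ k)) - char M t) \<le> 2 * (\<bar>t\<bar> ^ n / fact n)" for n
  proof -
    have "norm ((\<Sum>k\<le>n. (\<i> * t) ^ k / fact k * expectation (\<lambda>x. x ^ k)) - char M t)
        \<le> (2 * \<bar>t\<bar> ^ n / fact n) * expectation (\<lambda>x. \<bar>x\<bar> ^ n)"
      by (subst norm_minus_commute) (rule char_approx1, rule int)
    also have "\<dots> \<le> (2 * \<bar>t\<bar> ^ n / fact n) * 1"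
      by (rule mult_left_mono[OF le1]) auto
    finally show ?thesis by simp
  qed
  have "(\<lambda>n. 2 * (\<bar>t\<bar> ^ n / fact n)) \<longlonglongrightarrow> 0"
    using summable_LIMSEQ_zero[OF summable_exp[of "\<bar>t\<bar>"]]
    by (intro tendsto_mult_right_zero) (simp add: divide_inverse mult.commute)
  then have "(\<lambda>n. (\<Sum>k\<le>n. (\<i> * t) ^ k / fact k * expectation (\<lambda>x. x ^ k)) - char M t) \<longlonglongrightarrow> 0"
    by (rule Lim_null_comparison[OF always_eventually, rotated]) (use bound in auto)
  then show "(\<lambda>k. (\<i> * t) ^ k / fact k * expectation (\<lambda>x. x ^ k)) sums char M t"
    unfolding sums_def_le by (simp add: LIM_zero_iff)
qed

text \<open>The moments are, up to fixed factors, the Taylor coefficients of the characteristic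
  function, which determines the law by Levy's theorem.\<close>

lemma real_distribution_eqI_moments:
  assumes "real_distribution M" "real_distribution N"
    and "AE x in M. \<bar>x\<bar> \<le> 1" "AE x in N. \<bar>x\<bar> \<le> 1"
    and "\<And>k. (LINT x|M. x ^ k) = (LINT x|N. x ^ k)"
  shows "M = N"
proof (rule Levy_uniqueness[OF assms(1,2)], rule ext)
  fix t
  show "char M t = char N t"
    using real_distribution.char_sums(1)[OF assms(1,3), of t] real_distribution.char_sums(1)[OF assms(2,4), of t]
    by (simp add: assms(5) sums_unique2)
qed

lemma real_distribution_mu_measure: "0 \<le> m \<Longrightarrow> real_distribution (mu_measure m)"
  by (simp add: real_distribution_def real_distribution_axioms_def prob_space_mu_measure)

lemma integral_mu_measure_even_moment:
  assumes "0 \<le> m"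
  shows "(LINT v|mu_measure m. v ^ (2 * n)) = Gamma (real n + 1/2) * Gamma (m + 1/2) / (Gamma (1/2) * Gamma (real n + m + 1/2))"
proof -
  have "0 < Gamma (m + 1/2)" "0 < Gamma (real n + 1/2)" "0 < Gamma (real n + m + 1/2)" "0 < Gamma (1/2::real)"
    using assms by (auto intro!: Gamma_real_pos)
  then show ?thesis using assms
    by (subst integral_eq_nn_integral) (auto simp: nn_integral_mu_measure_even_moment)
qed

lemma mu_measure_reflect:
  assumes "0 \<le> m" shows "distr (mu_measure m) borel uminus = mu_measure m"
proof (rule measure_eqI)
  fix A assume "A \<in> sets (distr (mu_measure m) borel uminus)"
  then have [measurable]: "A \<in> sets borel" by simp
  have "emeasure (distr (mu_measure m) borel uminus) A = (\<integral>\<^sup>+v. indicator A v \<partial>distr (mu_measure m) borel uminus)"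
    by simp
  also have "\<dots> = (\<integral>\<^sup>+v. indicator A (- v) \<partial>mu_measure m)"
    by (rule nn_integral_distr) auto
  also have "\<dots> = emeasure (mu_measure m) A"
    by (subst nn_integral_mu_measure_reflect) (use assms in auto)
  finally show "emeasure (distr (mu_measure m) borel uminus) A = emeasure (mu_measure m) A" .
qed simp

lemma integral_mu_measure_odd_moment:
  assumes "0 \<le> m" "odd k"
  shows "(LINT v|mu_measure m. v ^ k) = 0"
proof -
  have "(LINT v|mu_measure m. v ^ k) = (LINT v|distr (mu_measure m) borel uminus. v ^ k)"
    by (simp add: mu_measure_reflect assms)
  also have "\<dots> = (LINT v|mu_measure m. (- v) ^ k)"
    by (rule integral_distr) auto
  also have "\<dots> = - (LINT v|mu_measure m. v ^ k)"
    using assms by simp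
  finally show ?thesis by simp
qed

section \<open>Poisson's integral for the Bessel function\<close>

lemma Gamma_half_integer: "Gamma (real n + 1/2) * (4 ^ n * fact n) = Gamma (1/2) * fact (2 * n)"
proof (induction n)
  case (Suc n)
  have "Gamma (real n + 1/2 + 1) = (real n + 1/2) * Gamma (real n + 1/2)"
    by (rule Gamma_plus1) (auto elim!: nonpos_Ints_cases)
  then have "Gamma (real (Suc n) + 1/2) * (4 ^ Suc n * fact (Suc n))
     = (real n + 1/2) * (4 * real (Suc n)) * (Gamma (real n + 1/2) * (4 ^ n * fact n))"
    by (simp add: add_ac mult_ac)
  also have "\<dots> = Gamma (1/2) * ((real n + 1/2) * (4 * real (Suc n)) * fact (2 * n))"
    unfolding Suc.IH by (simp only: mult_ac)
  also have "(real n + 1/2) * (4 * real (Suc n)) * fact (2 * n) = fact (2 * Suc n)"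
    by (simp add: algebra_simps)
  finally show ?case .
qed simp

text \<open>Poisson's integral in series form: the moment of order 2n of
  \<open>mu_measure (a - 1/2)\<close> carries a factor (2n)!/(4^n n!), which turns the Taylor series
  of the characteristic function term by term into the Bessel series. At \<open>a = 1/2\<close> the
  law consists of two point masses and the identity is the cosine series. Convergence of the Bessel
  series is obtained along the way.\<close>

lemma bessel_J_sums:
  assumes a: "1/2 \<le> a" and z: "0 < z"
  shows "(\<lambda>n. (- 1) ^ n / fact n * rGamma (real n + (a - 1) + 1) * (z / 2) powr (2 * real n + (a - 1)))
    sums (Re (char (mu_measure (a - 1/2)) z) / (Gamma a * 2 powr (a - 1) * z powr (- (a - 1))))"
    (is "?b sums _")
proof -
  interpret M: real_distribution "mu_measure (a - 1/2)"
    using a by (intro real_distribution_mu_measure) simp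
  let ?c = "\<lambda>k. (\<i> * z) ^ k / fact k * (LINT v|mu_measure (a - 1/2). v ^ k)"
  have Ga: "0 < Gamma a" using a by (intro Gamma_real_pos) simp
  have "?c sums char (mu_measure (a - 1/2)) z"
    by (rule M.char_sums(1)) (use a AE_mu_measure_bounded[of "a - 1/2"] in auto)
  \<comment> \<open>Odd moments vanish by symmetry, so only the even terms of the series
    remain.\<close>
  then have "(\<lambda>n. ?c (2 * n)) sums char (mu_measure (a - 1/2)) z"
    by (subst sums_mono_reindex[of "\<lambda>n. 2 * n"])
       (use a in \<open>auto simp: strict_mono_def integral_mu_measure_odd_moment dest!: oddE elim!: evenE intro!: integral_mu_measure_odd_moment\<close>)
  moreover have "?c (2 * n) = complex_of_real (Gamma a * 2 powr (a - 1) * z powr (- (a - 1)) * ?b n)" for n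
  proof -
    have pos: "0 < Gamma (real n + a)" "0 < Gamma (1/2::real)"
      using a by (auto intro!: Gamma_real_pos)
    have m: "(LINT v|mu_measure (a - 1/2). v ^ (2 * n)) = fact (2 * n) / (4 ^ n * fact n) * Gamma a / Gamma (real n + a)"
    proof -
      have "(LINT v|mu_measure (a - 1/2). v ^ (2 * n)) = Gamma (real n + 1/2) * Gamma (a - 1/2 + 1/2) / (Gamma (1/2) * Gamma (real n + (a - 1/2) + 1/2))"
        by (rule integral_mu_measure_even_moment) (use a in simp)
      also have "\<dots> = (Gamma (real n + 1/2) / Gamma (1/2)) * Gamma a / Gamma (real n + a)"
        by simp
      also have "Gamma (real n + 1/2) / Gamma (1/2) = (fact (2 * n) / (4 ^ n * fact n) :: real)"
      proof -
        have "4 ^ n * fact n \<noteq> (0::real)" "Gamma (1/2) \<noteq> (0::real)" using pos(2)[THEN less_imp_neq] by auto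
        moreover have "Gamma (real n + 1/2) * (4 ^ n * fact n) = fact (2 * n) * Gamma (1/2)"
          using Gamma_half_integer[of n] by (simp only: mult.commute)
        ultimately show ?thesis by (intro iffD2[OF frac_eq_eq])
      qed
      finally show ?thesis .
    qed
    have "(z / 2) powr (2 * real n + (a - 1)) = (z / 2) powr (real (2 * n)) * ((z / 2) powr (a - 1))"
      by (simp add: powr_add)
    also have "(z / 2) powr (real (2 * n)) = (z / 2) ^ (2 * n)"
      using z by (subst powr_realpow) auto
    also have "(z / 2) powr (a - 1) = z powr (a - 1) / 2 powr (a - 1)"
      using z by (simp add: powr_divide)
    finally have p: "(z / 2) powr (2 * real n + (a - 1)) = z ^ (2 * n) / 4 ^ n * (z powr (a - 1) / 2 powr (a - 1))"
      by (simp add: power_divide power_mult)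
    have zz: "z powr (- (a - 1)) * z powr (a - 1) = 1"
      using z by (simp add: powr_add[symmetric])
    have "Gamma a * 2 powr (a - 1) * z powr (- (a - 1)) * ?b n
       = Gamma a * (z powr (- (a - 1)) * z powr (a - 1)) * ((- 1) ^ n / fact n / Gamma (real n + a) * (z ^ (2 * n) / 4 ^ n))"
      unfolding p by (simp add: rGamma_inverse_Gamma field_simps)
    also have "\<dots> = (- 1) ^ n * z ^ (2 * n) / fact (2 * n) * (fact (2 * n) / (4 ^ n * fact n) * Gamma a / Gamma (real n + a))"
      unfolding zz using pos by (simp add: field_simps)
    finally have e: "Gamma a * 2 powr (a - 1) * z powr (- (a - 1)) * ?b n = \<dots>" .
    have "(\<i> * complex_of_real z) ^ (2 * n) = complex_of_real ((- 1) ^ n * z ^ (2 * n))"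
      by (simp add: power_mult_distrib power_mult power_minus[of "(complex_of_real z)\<^sup>2"])
    then show ?thesis unfolding e m by simp
  qed
  ultimately have "(\<lambda>n. complex_of_real (Gamma a * 2 powr (a - 1) * z powr (- (a - 1)) * ?b n)) sums char (mu_measure (a - 1/2)) z"
    by simp
  from sums_Re[OF this]
  have sR: "(\<lambda>n. Gamma a * 2 powr (a - 1) * z powr (- (a - 1)) * ?b n) sums Re (char (mu_measure (a - 1/2)) z)"
    by (simp only: Re_complex_of_real)
  have nz: "Gamma a * 2 powr (a - 1) * z powr (- (a - 1)) \<noteq> 0"
    using Ga z by simp
  show "?b sums (Re (char (mu_measure (a - 1/2)) z) / (Gamma a * 2 powr (a - 1) * z powr (- (a - 1))))"
    using sums_divide[OF sR, of "Gamma a * 2 powr (a - 1) * z powr (- (a - 1))"]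
    by (simp only: nonzero_mult_div_cancel_left[OF nz])
qed

text \<open>By Poisson's integral the quotient by the value at 0 is the real part of a
  characteristic function, hence at most 1 in modulus. The right-hand side is that value at
  0.\<close>

lemma bessel_j_bound:
  assumes a: "1/2 \<le> a" and z: "0 \<le> z"
  shows "\<bar>bessel_j (a - 1) z\<bar> \<le> rGamma a / 2 powr (a - 1)"
proof (cases "z = 0")
  case True
  have "0 \<le> rGamma a" using a Gamma_real_pos[of a] by (simp add: rGamma_inverse_Gamma)
  then show ?thesis using True by (simp add: bessel_j_def)
next
  case False
  with z have z: "0 < z" by simp
  interpret M: real_distribution "mu_measure (a - 1/2)"
    using a by (intro real_distribution_mu_measure) simp
  have Ga: "0 < Gamma a" using a by (intro Gamma_real_pos) simp
  have nz: "Gamma a * 2 powr (a - 1) * z powr (- (a - 1)) \<noteq> 0"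
    using Ga z by simp
  have "bessel_J (a - 1) z = Re (char (mu_measure (a - 1/2)) z) / (Gamma a * 2 powr (a - 1) * z powr (- (a - 1)))"
    unfolding bessel_J_def by (rule sums_unique[OF bessel_J_sums[OF a z], symmetric])
  then have "bessel_j (a - 1) z = Re (char (mu_measure (a - 1/2)) z) / (Gamma a * 2 powr (a - 1))"
    using z nz by (simp add: bessel_j_def)
  moreover have "\<bar>Re (char (mu_measure (a - 1/2)) z)\<bar> \<le> 1"
    using abs_Re_le_cmod M.cmod_char_le_1 order_trans by blast
  ultimately show ?thesis
    using Ga by (simp add: abs_mult rGamma_inverse_Gamma divide_simps)
qed

text \<open>The substitution v = 2x - 1 gives a Beta integral with a prefactor \<open>?C\<close>.
  The prefactor is read off from the total mass (\<open>j = 0\<close>) instead of being computed by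
  the duplication formula for Gamma.\<close>

lemma nn_integral_mu_measure_shifted_moment:
  assumes m: "0 < m"
  shows "(\<integral>\<^sup>+v. ennreal (((1 + v) / 2) ^ j) \<partial>mu_measure m)
    = ennreal (Gamma (real j + m) * Gamma (2 * m) / (Gamma (real j + 2 * m) * Gamma m))"
proof -
  let ?C = "c_const (m - 1/2) * (2 * 4 powr (m - 1))"
  have C0: "0 \<le> c_const (m - 1/2)" by (rule c_const_nonneg[OF m])
  have *: "(\<integral>\<^sup>+v. ennreal (((1 + v) / 2) ^ j) \<partial>mu_measure m) = ennreal (?C * Beta (real j + m) m)" for j
  proof -
    let ?f = "\<lambda>v. ennreal (((1 + v) / 2) ^ j) * beta_weight m v"
    have "(\<integral>\<^sup>+v. ?f v \<partial>lborel) = ennreal 2 * (\<integral>\<^sup>+x. ?f (- 1 + 2 * x) \<partial>lborel)"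
      by (subst nn_integral_real_affine[where c=2 and t="-1"]) auto
    also have "(\<integral>\<^sup>+x. ?f (- 1 + 2 * x) \<partial>lborel)
      = (\<integral>\<^sup>+x. ennreal (4 powr (m - 1)) * ennreal (indicator {0..1} x * (x powr (real j + m - 1) * (1 - x) powr (m - 1))) \<partial>lborel)"
    proof (rule nn_integral_cong_nonzero, goal_cases)
      case (1 x)
      show ?case
      proof (cases "x \<in> {0<..1}")
        case True
        have "1 - (- 1 + 2 * x)\<^sup>2 = 4 * x * (1 - x)" by (simp add: power2_eq_square algebra_simps)
        then have "(1 - (- 1 + 2 * x)\<^sup>2) powr (m - 1) = 4 powr (m - 1) * x powr (m - 1) * (1 - x) powr (m - 1)"
          using True by (simp add: powr_mult)
        moreover have "x powr (real j + m - 1) = x ^ j * x powr (m - 1)"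
        proof -
          have "real j + m - 1 = real j + (m - 1)" by simp
          then show ?thesis using True by (simp only: powr_add powr_realpow) (simp add: powr_realpow)
        qed
        ultimately show ?thesis using True
          by (simp add: ennreal_mult'[symmetric] mult_ac)
      qed (use \<open>x \<noteq> 0\<close> in \<open>auto split: split_indicator\<close>)
    qed
    also have "\<dots> = ennreal (4 powr (m - 1)) * ennreal (Beta (real j + m) m)"
      using m by (subst nn_integral_cmult) (auto simp: nn_integral_Beta)
    finally have "(\<integral>\<^sup>+v. ?f v \<partial>lborel) = ennreal 2 * (ennreal (4 powr (m - 1)) * ennreal (Beta (real j + m) m))" .
    moreover have "0 \<le> Beta (real j + m) m"
      using m by (auto simp: Beta_def intro!: divide_nonneg_nonneg mult_nonneg_nonneg less_imp_le[OF Gamma_real_pos])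
    ultimately have "ennreal (c_const (m - 1/2)) * (\<integral>\<^sup>+v. ?f v \<partial>lborel) = ennreal (?C * Beta (real j + m) m)"
      using C0 by (simp only: ennreal_mult[symmetric] mult_nonneg_nonneg powr_ge_zero zero_le_numeral mult.assoc)
    then show ?thesis
      using m by (subst nn_integral_mu_measure_pos) auto
  qed
  interpret prob_space "mu_measure m" by (rule prob_space_mu_measure) (use m in simp)
  have pos: "0 < Gamma m" "0 < Gamma (2 * m)" "0 < Gamma (real j + m)" "0 < Gamma (real j + 2 * m)"
    using m by (auto intro!: Gamma_real_pos)
  then have "0 < Beta m m" by (simp add: Beta_def)
  moreover have "ennreal (?C * Beta m m) = 1"
    using *[of 0] by (simp add: emeasure_space_1[simplified])
  then have "?C * Beta m m = 1" by (simp add: ennreal_eq_1)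
  ultimately have "?C = 1 / Beta m m" by (simp add: field_simps)
  moreover have "real j + m + m = real j + 2 * m" "m + m = 2 * m" by simp_all
  ultimately have "?C * Beta (real j + m) m = Gamma (real j + m) * Gamma (2 * m) / (Gamma (real j + 2 * m) * Gamma m)"
    using pos by (simp only: Beta_def) (simp add: field_simps)
  then show ?thesis
    using *[of j] by (simp only:)
qed

text \<open>Both laws live on [-1,1], so moments decide. Odd ones vanish; by independence the moment
  of order 2j is a shifted moment times an even moment, in whose product \<Gamma>(j+a+1/2) and
  \<Gamma>(a+1/2) cancel.\<close>

lemma mu_measure_product:
  assumes a: "0 \<le> a"
  shows "distr (mu_measure (a + 1/2) \<Otimes>\<^sub>M mu_measure a) borel (\<lambda>(l, c). sqrt ((1 + l) / 2) * c) = mu_measure (2 * a + 1/2)"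
    (is "distr ?P borel ?h = _")
proof -
  interpret L: prob_space "mu_measure (a + 1/2)" by (rule prob_space_mu_measure) (use a in simp)
  interpret C: prob_space "mu_measure a" by (rule prob_space_mu_measure) (use a in simp)
  interpret P: pair_prob_space "mu_measure (a + 1/2)" "mu_measure a" ..
  have h[measurable]: "?h \<in> borel_measurable ?P" by measurable
  interpret D: prob_space "distr ?P borel ?h" by (rule P.prob_space_distr) simp
  have rd: "real_distribution (distr ?P borel ?h)"
    by (simp add: real_distribution_def real_distribution_axioms_def D.prob_space_axioms)
  have ae: "AE x in ?P. \<bar>fst x\<bar> \<le> 1 \<and> \<bar>snd x\<bar> \<le> 1"
  proof (rule P.AE_pair_measure)
    show "{x \<in> space ?P. \<bar>fst x\<bar> \<le> 1 \<and> \<bar>snd x\<bar> \<le> 1} \<in> sets ?P" by measurable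
    show "AE x in mu_measure (a + 1/2). AE y in mu_measure a. \<bar>fst (x, y)\<bar> \<le> 1 \<and> \<bar>snd (x, y)\<bar> \<le> 1"
      using AE_mu_measure_bounded[of "a + 1/2"] AE_mu_measure_bounded[of a] a by (auto elim!: eventually_mono)
  qed
  have hb: "\<bar>?h x\<bar> \<le> 1" if "\<bar>fst x\<bar> \<le> 1 \<and> \<bar>snd x\<bar> \<le> 1" for x
  proof -
    have "\<bar>sqrt ((1 + fst x) / 2)\<bar> * \<bar>snd x\<bar> \<le> 1 * 1" using that by (intro mult_mono) auto
    then show ?thesis by (simp add: abs_mult split_beta)
  qed
  have bd: "AE x in distr ?P borel ?h. \<bar>x\<bar> \<le> 1"
    by (subst AE_distr_iff) (simp, simp, rule eventually_mono[OF ae hb])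
  show ?thesis
  proof (rule real_distribution_eqI_moments[OF rd real_distribution_mu_measure bd AE_mu_measure_bounded])
    fix k :: nat
    have "(LINT x|distr ?P borel ?h. x ^ k) = (LINT x|?P. (?h x) ^ k)"
      by (rule integral_distr) auto
    also have "\<dots> = (LINT l|mu_measure (a + 1/2). LINT c|mu_measure a. (?h (l, c)) ^ k)"
    proof (rule P.integral_fst'[symmetric])
      have "integrable (distr ?P borel ?h) (\<lambda>x. x ^ k)"
        by (rule real_distribution.char_sums(2)[OF rd bd])
      then show "integrable ?P (\<lambda>x. (?h x) ^ k)"
        by (subst (asm) integrable_distr_eq) auto
    qed
    also have "\<dots> = (LINT l|mu_measure (a + 1/2). sqrt ((1 + l) / 2) ^ k * (LINT c|mu_measure a. c ^ k))"
      by (simp add: power_mult_distrib)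
    also have "\<dots> = (LINT l|mu_measure (a + 1/2). sqrt ((1 + l) / 2) ^ k) * (LINT c|mu_measure a. c ^ k)"
      by simp
    also have "\<dots> = (LINT x|mu_measure (2 * a + 1/2). x ^ k)"
    proof (cases "odd k")
      case True then show ?thesis using a by (simp add: integral_mu_measure_odd_moment)
    next
      case False
      then obtain j where k: "k = 2 * j" by (auto elim: evenE)
      have ae1: "AE l in mu_measure (a + 1/2). \<bar>l\<bar> \<le> 1" using a by (intro AE_mu_measure_bounded) simp
      have "(LINT l|mu_measure (a + 1/2). sqrt ((1 + l) / 2) ^ k) = (LINT l|mu_measure (a + 1/2). ((1 + l) / 2) ^ j)"
        by (rule integral_cong_AE) (use ae1 in \<open>auto simp: k power_mult elim!: eventually_mono\<close>)
      also have "\<dots> = enn2real (\<integral>\<^sup>+l. ennreal (((1 + l) / 2) ^ j) \<partial>mu_measure (a + 1/2))"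
        by (rule integral_eq_nn_integral) (use ae1 in \<open>auto elim!: eventually_mono\<close>)
      also have "\<dots> = Gamma (real j + (a + 1/2)) * Gamma (2 * (a + 1/2)) / (Gamma (real j + 2 * (a + 1/2)) * Gamma (a + 1/2))"
      proof -
        have "0 < Gamma (a + 1/2)" "0 < Gamma (2 * (a + 1/2))" "0 < Gamma (real j + (a + 1/2))" "0 < Gamma (real j + 2 * (a + 1/2))"
          using a by (auto intro!: Gamma_real_pos)
        then show ?thesis
          using a by (subst nn_integral_mu_measure_shifted_moment) auto
      qed
      finally have 1: "(LINT l|mu_measure (a + 1/2). sqrt ((1 + l) / 2) ^ k) = \<dots>" .
      have 2: "(LINT c|mu_measure a. c ^ k) = Gamma (real j + 1/2) * Gamma (a + 1/2) / (Gamma (1/2) * Gamma (real j + a + 1/2))"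
        unfolding k by (rule integral_mu_measure_even_moment[OF a])
      have 3: "(LINT c|mu_measure (2 * a + 1/2). c ^ k) = Gamma (real j + 1/2) * Gamma (2 * a + 1/2 + 1/2) / (Gamma (1/2) * Gamma (real j + (2 * a + 1/2) + 1/2))"
        unfolding k by (rule integral_mu_measure_even_moment) (use a in simp)
      have e: "2 * a + 1/2 + 1/2 = 2 * (a + 1/2)" "real j + (2 * a + 1/2) + 1/2 = real j + 2 * (a + 1/2)"
        "real j + a + 1/2 = real j + (a + 1/2)" by auto
      have "0 < Gamma (a + 1/2)" "0 < Gamma (real j + (a + 1/2))"
          using a by (auto intro!: Gamma_real_pos)
      then show ?thesis unfolding 1 2 3 e by (simp add: divide_simps)
    qed
    finally show "(LINT x|distr ?P borel ?h. x ^ k) = (LINT x|mu_measure (2 * a + 1/2). x ^ k)" .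
  qed (use a in auto)
qed

text \<open>The substitution is v = -cos \<theta>, which is increasing on [0,pi]; the sign is
  removed by the symmetry of \<open>mu_measure a\<close>.\<close>

lemma nn_integral_cos_subst:
  assumes [measurable]: "F \<in> borel_measurable borel" and a: "0 < a"
  shows "ennreal (c_const (a - 1/2)) * (\<integral>\<^sup>+\<theta>. F (cos \<theta>) * ennreal (indicator {0..pi} \<theta> * sin \<theta> powr (2 * a - 1)) \<partial>lborel)
    = (\<integral>\<^sup>+w. F w \<partial>mu_measure a)"
proof -
  let ?f = "\<lambda>v. F (- v) * ennreal ((1 - v\<^sup>2) powr (a - 1))"
  have "(\<integral>\<^sup>+v. ?f v * indicator {- cos 0..- cos pi} v \<partial>lborel)
      = (\<integral>\<^sup>+\<theta>. ?f (- cos \<theta>) * ennreal (sin \<theta>) * indicator {0..pi} \<theta> \<partial>lborel)"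
  proof (rule nn_integral_substitution_aux)
    show "((\<lambda>x. - cos x) has_real_derivative sin x) (at x)" for x
      by (auto intro!: derivative_eq_intros)
  qed (auto intro!: continuous_intros sin_ge_zero)
  also have "\<dots> = (\<integral>\<^sup>+\<theta>. F (cos \<theta>) * ennreal (indicator {0..pi} \<theta> * sin \<theta> powr (2 * a - 1)) \<partial>lborel)"
  proof (rule nn_integral_cong)
    fix \<theta> :: real
    show "?f (- cos \<theta>) * ennreal (sin \<theta>) * indicator {0..pi} \<theta> = F (cos \<theta>) * ennreal (indicator {0..pi} \<theta> * sin \<theta> powr (2 * a - 1))"
    proof (cases "\<theta> \<in> {0..pi}")
      case True
      have s0: "0 \<le> sin \<theta>" using True by (intro sin_ge_zero) auto
      have "(1 - (- cos \<theta>)\<^sup>2) powr (a - 1) * sin \<theta> = sin \<theta> powr (2 * a - 1)"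
      proof (cases "sin \<theta> = 0")
        case False
        then have s: "0 < sin \<theta>" using s0 by simp
        have "1 - (- cos \<theta>)\<^sup>2 = sin \<theta> powr 2"
          using s by (simp add: sin_squared_eq)
        then have "(1 - (- cos \<theta>)\<^sup>2) powr (a - 1) = sin \<theta> powr (2 * (a - 1))"
          by (simp only: powr_powr)
        then have "(1 - (- cos \<theta>)\<^sup>2) powr (a - 1) * sin \<theta> = sin \<theta> powr (2 * (a - 1) + 1)"
          using s by (simp only: powr_add) simp
        also have "2 * (a - 1) + 1 = 2 * a - 1" by simp
        finally show ?thesis .
      qed simp
      then show ?thesis using True s0 by (simp add: ennreal_mult'[symmetric] mult.assoc)
    qed simp
  qed
  finally have eq: "(\<integral>\<^sup>+v. ?f v * indicator {- 1..1} v \<partial>lborel) = \<dots>" by simp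
  have "(\<integral>\<^sup>+w. F w \<partial>mu_measure a) = (\<integral>\<^sup>+w. F (- w) \<partial>mu_measure a)"
    using a by (simp add: nn_integral_mu_measure_reflect)
  also have "\<dots> = ennreal (c_const (a - 1/2)) * (\<integral>\<^sup>+v. ?f v * indicator {- 1..1} v \<partial>lborel)"
    using a by (subst nn_integral_mu_measure_pos)
      (auto intro!: arg_cong[where f="(*) _"] nn_integral_cong split: split_indicator)
  finally show ?thesis unfolding eq by simp
qed

section \<open>Laguerre translation\<close>

text \<open>Putting r = t + s + 2 sqrt(ts) w turns 4ts - (r-t-s)^2 into 4ts(1 - w^2); the Jacobian
  is (4ts)^(1/2) and raises the exponent b - 1/2 to b. By Heron's formula the expression is 16 times
  the squared area of a triangle with sides sqrt r, sqrt s, sqrt t, and the indicator says that such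
  a triangle exists (degenerate ones included).\<close>

lemma laguerre_kernel:
  fixes G :: "real \<Rightarrow> ennreal"
  assumes [measurable]: "G \<in> borel_measurable borel" and b: "0 \<le> b" and t: "0 < t" and s: "0 < s"
  defines "k \<equiv> (\<lambda>r s. ennreal (indicator {0..} (4 * t * s - (r - t - s)\<^sup>2) * (4 * t * s - (r - t - s)\<^sup>2) powr (b - 1/2)))"
  shows "ennreal (c_const b) * (\<integral>\<^sup>+r. G r * k r s \<partial>lborel)
    = ennreal ((4 * t * s) powr b) * (\<integral>\<^sup>+w. G (t + s + 2 * sqrt (t * s) * w) \<partial>mu_measure (b + 1/2))"
proof -
  let ?q = "2 * sqrt (t * s)"
  have q: "0 < ?q" "?q\<^sup>2 = 4 * t * s" using t s by (auto simp: power_mult_distrib)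
  have [measurable]: "(\<lambda>r. k r s) \<in> borel_measurable borel" unfolding k_def by measurable
  have k: "k (t + s + ?q * w) s = ennreal ((4 * t * s) powr (b - 1/2)) * ennreal (indicator {-1..1} w * (1 - w\<^sup>2) powr (b - 1/2))" for w
  proof -
    have e: "4 * t * s - (t + s + ?q * w - t - s)\<^sup>2 = (4 * t * s) * (1 - w\<^sup>2)"
      using q(2) by (simp add: power_mult_distrib algebra_simps)
    have "(0 \<le> (4 * t * s) * (1 - w\<^sup>2)) \<longleftrightarrow> w \<in> {-1..1}"
      using t s by (simp add: zero_le_mult_iff abs_square_le_1 abs_le_iff)
        (auto simp: zero_le_mult_iff mult_le_0_iff)
    then show ?thesis
      unfolding k_def e using t s
      by (auto simp: powr_mult ennreal_mult'[symmetric] one_minus_sq_nonneg split: split_indicator)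
  qed
  have "(\<integral>\<^sup>+r. G r * k r s \<partial>lborel) = ennreal ?q * (\<integral>\<^sup>+w. G (t + s + ?q * w) * k (t + s + ?q * w) s \<partial>lborel)"
    using q by (subst nn_integral_real_affine[where c="?q" and t="t + s"]) auto
  also have "(\<integral>\<^sup>+w. G (t + s + ?q * w) * k (t + s + ?q * w) s \<partial>lborel)
     = (\<integral>\<^sup>+w. ennreal ((4 * t * s) powr (b - 1/2)) * (G (t + s + ?q * w) * ennreal (indicator {-1..1} w * (1 - w\<^sup>2) powr (b - 1/2))) \<partial>lborel)"
    unfolding k by (simp add: mult_ac)
  also have "\<dots> = ennreal ((4 * t * s) powr (b - 1/2)) * (\<integral>\<^sup>+w. G (t + s + ?q * w) * ennreal (indicator {-1..1} w * (1 - w\<^sup>2) powr (b - 1/2)) \<partial>lborel)"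
    by (rule nn_integral_cmult) measurable
  finally have *: "(\<integral>\<^sup>+r. G r * k r s \<partial>lborel) = ennreal ?q * \<dots>" .
  have "?q = (4 * t * s) powr (1/2)" using t s by (simp add: powr_half_sqrt real_sqrt_mult)
  then have "?q * (4 * t * s) powr (b - 1/2) = (4 * t * s) powr b"
    by (simp only: powr_add[symmetric]) simp
  then have **: "ennreal ?q * ennreal ((4 * t * s) powr (b - 1/2)) = ennreal ((4 * t * s) powr b)"
    using q by (simp add: ennreal_mult'[symmetric])
  have mu: "(\<integral>\<^sup>+w. G (t + s + ?q * w) \<partial>mu_measure (b + 1/2))
     = ennreal (c_const b) * (\<integral>\<^sup>+w. G (t + s + ?q * w) * ennreal (indicator {-1..1} w * (1 - w\<^sup>2) powr (b - 1/2)) \<partial>lborel)"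
    using b by (subst nn_integral_mu_measure_pos) auto
  show ?thesis
    unfolding * mu **[symmetric] by (simp only: mult_ac)
qed

text \<open>In the variables \<open>r, s\<close> the kernel is a power of \<open>4 t s - (r - t - s)\<^sup>2\<close>, which is symmetric in \<open>r, s, t\<close>;
  so the integral in \<open>s\<close> is evaluated by the same substitution as the one in \<open>r\<close>.\<close>

lemma laguerre_translation:
  fixes G :: "real \<Rightarrow> ennreal"
  assumes [measurable]: "G \<in> borel_measurable borel" and b: "0 \<le> b" and t: "0 \<le> t"
  shows "(\<integral>\<^sup>+s. power_weight b s * (\<integral>\<^sup>+w. G (t + s + 2 * sqrt (t * s) * w) \<partial>mu_measure (b + 1/2)) \<partial>lborel)
    = (\<integral>\<^sup>+r. power_weight b r * G r \<partial>lborel)"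
\<comment> \<open>For \<open>t = 0\<close> the kernel degenerates and the translation is the
  identity.\<close>
proof (cases "t = 0")
  case True
  interpret prob_space "mu_measure (b + 1/2)" by (rule prob_space_mu_measure) (use b in simp)
  show ?thesis using True by (simp add: emeasure_space_1[simplified])
next
  case False
  with t have t: "0 < t" by simp
  define k where "k = (\<lambda>r s. ennreal (indicator {0..} (4 * t * s - (r - t - s)\<^sup>2) * (4 * t * s - (r - t - s)\<^sup>2) powr (b - 1/2)))"
  have k_meas[measurable]: "(\<lambda>(r, s). k r s) \<in> borel_measurable (borel \<Otimes>\<^sub>M borel)" unfolding k_def by measurable
  have k_sym: "k r s = k s r" for r s
    unfolding k_def by (simp add: power2_eq_square algebra_simps)
  have k_neg: "k r s = 0" if "r < 0 \<or> s < 0" for r s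
  proof -
    have aux: "4 * t * s - (r - t - s)\<^sup>2 < 0" if "s < 0" for r s
      using t that by (smt (verit) mult_pos_neg zero_le_power2)
    have "4 * t * s - (r - t - s)\<^sup>2 = 4 * t * r - (s - t - r)\<^sup>2"
      by (simp add: power2_eq_square algebra_simps)
    then show ?thesis using that aux[of s r] aux[of r s] unfolding k_def by auto
  qed
  interpret prob_space "mu_measure (b + 1/2)" by (rule prob_space_mu_measure) (use b in simp)
  let ?I = "\<lambda>s. \<integral>\<^sup>+w. G (t + s + 2 * sqrt (t * s) * w) \<partial>mu_measure (b + 1/2)"
  have K: "ennreal (c_const b) * (\<integral>\<^sup>+r. G r * k r s \<partial>lborel) = ennreal ((4 * t * s) powr b) * ?I s" if "0 < s" for s
    unfolding k_def by (rule laguerre_kernel) (use that t b in auto)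
  \<comment> \<open>This is \<open>laguerre_kernel\<close> for \<open>G = 1\<close> with
    \<open>r\<close> in the place of \<open>s\<close>; by \<open>k_sym\<close> it evaluates the
    integral over the other variable.\<close>
  have K1: "ennreal (c_const b) * (\<integral>\<^sup>+s. k r s \<partial>lborel) = ennreal ((4 * t * r) powr b)" if "0 < r" for r
  proof -
    have "ennreal (c_const b) * (\<integral>\<^sup>+s. 1 * k s r \<partial>lborel) = ennreal ((4 * t * r) powr b) * (\<integral>\<^sup>+w. 1 \<partial>mu_measure (b + 1/2))"
      unfolding k_def by (rule laguerre_kernel) (use that t b in auto)
    then show ?thesis by (simp add: emeasure_space_1[simplified] k_sym[of _ r])
  qed
  have c4: "ennreal ((4 * t) powr b) * power_weight b s = ennreal (indicator {0..} s * (4 * t * s) powr b)" for s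
    using t by (auto simp: ennreal_mult'[symmetric] powr_mult split: split_indicator)
  have [measurable]: "?I \<in> borel_measurable borel" by measurable
  \<comment> \<open>Multiplying by (4t)^b turns s^b into the factor (4ts)^b of
    \<open>laguerre_kernel\<close>; being positive and finite it is cancelled at the end.\<close>
  have "ennreal ((4 * t) powr b) * (\<integral>\<^sup>+s. power_weight b s * ?I s \<partial>lborel)
      = (\<integral>\<^sup>+s. ennreal (indicator {0..} s * (4 * t * s) powr b) * ?I s \<partial>lborel)"
    by (subst nn_integral_cmult[symmetric]) (auto simp: c4 mult.assoc[symmetric])
  also have "\<dots> = (\<integral>\<^sup>+s. (\<integral>\<^sup>+r. ennreal (c_const b) * (G r * k r s) \<partial>lborel) \<partial>lborel)"
  proof (rule nn_integral_cong_nonzero, goal_cases)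
    case (1 s)
    show ?case
    proof (cases "0 < s")
      case True then show ?thesis by (subst nn_integral_cmult) (auto simp: K)
    next
      case False then show ?thesis using \<open>s \<noteq> 0\<close> by (simp add: k_neg)
    qed
  qed
  also have "\<dots> = (\<integral>\<^sup>+r. (\<integral>\<^sup>+s. ennreal (c_const b) * (G r * k r s) \<partial>lborel) \<partial>lborel)"
    by (rule lborel_pair.Fubini'[symmetric]) measurable
  also have "\<dots> = (\<integral>\<^sup>+r. ennreal ((4 * t) powr b) * (power_weight b r * G r) \<partial>lborel)"
  proof (rule nn_integral_cong_nonzero, goal_cases)
    case (1 r)
    have "(\<integral>\<^sup>+s. ennreal (c_const b) * (G r * k r s) \<partial>lborel) = (\<integral>\<^sup>+s. G r * (ennreal (c_const b) * k r s) \<partial>lborel)"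
      by (simp only: mult_ac)
    also have "\<dots> = G r * (ennreal (c_const b) * (\<integral>\<^sup>+s. k r s \<partial>lborel))"
      by (subst nn_integral_cmult, measurable, subst nn_integral_cmult, measurable)
    also have "\<dots> = ennreal ((4 * t) powr b) * (power_weight b r * G r)"
    proof (cases "0 < r")
      case True then show ?thesis
        by (subst mult.assoc[symmetric], subst c4) (simp add: K1 mult.commute)
    next
      case False then show ?thesis using \<open>r \<noteq> 0\<close> by (simp add: k_neg)
    qed
    finally show ?case .
  qed
  also have "\<dots> = ennreal ((4 * t) powr b) * (\<integral>\<^sup>+r. power_weight b r * G r \<partial>lborel)"
    by (rule nn_integral_cmult) measurable
  finally show ?thesis
    using t by (subst (asm) ennreal_mult_cancel_left) (auto simp: ennreal_eq_0_iff)
qed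

section \<open>Gaussian mixtures of Beta laws\<close>

text \<open>The integral of q^a exp(-q^2/2) over the half-line, in closed form.\<close>

definition gauss_moment :: "real \<Rightarrow> real" where
  "gauss_moment a = 2 powr (a / 2 - 1/2) * Gamma (a / 2 + 1/2)"

lemma gauss_moment_pos: "0 \<le> a \<Longrightarrow> 0 < gauss_moment a"
  unfolding gauss_moment_def by (intro mult_pos_pos Gamma_real_pos) auto

lemma nn_integral_gauss_moment:
  assumes "0 \<le> a"
  shows "(\<integral>\<^sup>+q. gauss_weight a q \<partial>lborel) = ennreal (gauss_moment a)"
proof -
  let ?F = "\<lambda>x. ennreal (1/2 * (indicator {0..} x * (x powr (a / 2 + 1/2 - 1) * exp (- (1/2 * x)))))"
  have "(\<integral>\<^sup>+q. gauss_weight a q \<partial>lborel)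
     = (\<integral>\<^sup>+q. ?F (q\<^sup>2) * ennreal (2 * q) * indicator {0..} q \<partial>lborel)"
  proof (rule nn_integral_cong_nonzero, goal_cases)
    case (1 q)
    show ?case
    proof (cases "0 < q")
      case True
      have "q\<^sup>2 = q powr 2" using True by simp
      then have "(q\<^sup>2) powr (a / 2 + 1/2 - 1) = q powr (2 * (a / 2 + 1/2 - 1))" by (simp only: powr_powr)
      then have "(q\<^sup>2) powr (a / 2 + 1/2 - 1) * q = q powr (2 * (a / 2 + 1/2 - 1) + 1)"
        using True by (simp only: powr_add) simp
      also have "2 * (a / 2 + 1/2 - 1) + 1 = a" by simp
      finally have *: "(q\<^sup>2) powr (a / 2 + 1/2 - 1) * q = q powr a" .
      have "1/2 * (indicator {0..} (q\<^sup>2) * ((q\<^sup>2) powr (a / 2 + 1/2 - 1) * exp (- (1/2 * q\<^sup>2)))) * (2 * q)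
         = ((q\<^sup>2) powr (a / 2 + 1/2 - 1) * q) * exp (- (1/2 * q\<^sup>2))"
        using True by simp
      also have "\<dots> = q powr a * exp (- q\<^sup>2 / 2)" unfolding * by simp
      finally show ?thesis using True by (subst ennreal_mult'[symmetric]) auto
    qed (use \<open>q \<noteq> 0\<close> in auto)
  qed
  also have "\<dots> = (\<integral>\<^sup>+q. ?F q * indicator {0..} q \<partial>lborel)"
    by (rule nn_integral_square_subst) measurable
  also have "\<dots> = (\<integral>\<^sup>+q. ennreal (1/2) * ennreal (indicator {0..} q * (q powr (a / 2 + 1/2 - 1) * exp (- (1/2 * q)))) \<partial>lborel)"
    by (intro nn_integral_cong, subst ennreal_mult') (auto split: split_indicator)
  also have "\<dots> = ennreal (1/2) * ennreal (Gamma (a / 2 + 1/2) / (1/2) powr (a / 2 + 1/2))"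
    using assms by (subst nn_integral_cmult, measurable, subst nn_integral_Gamma_scaled) auto
  also have "\<dots> = ennreal (gauss_moment a)"
  proof -
    have "(1/2) powr (a / 2 + 1/2) = 1 / (2 powr (a / 2 - 1/2) * (2::real))"
    proof -
      have "2 powr (a / 2 - 1/2) * (2::real) = 2 powr (a / 2 - 1/2 + 1)" by (simp only: powr_add) simp
      also have "a / 2 - 1/2 + 1 = a / 2 + 1/2" by simp
      finally show ?thesis by (simp add: powr_divide)
    qed
    then show ?thesis
      by (subst ennreal_mult'[symmetric]) (auto simp: gauss_moment_def mult.commute)
  qed
  finally show ?thesis .
qed

text \<open>If 2m+1 is an integer n at least 2, this projects a standard normal vector of R^n to one
  coordinate: q is its length, with density proportional to q^(n-1) exp(-q^2/2), and v a coordinate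
  of its direction. The computation below does the same for real m.\<close>

lemma mu_measure_gauss:
  assumes [measurable]: "F \<in> borel_measurable borel" and m: "0 \<le> m"
  shows "(\<integral>\<^sup>+q. gauss_weight (2 * m) q * (\<integral>\<^sup>+v. F (q * v) \<partial>mu_measure m) \<partial>lborel)
     = ennreal (gauss_moment (2 * m)) * (\<integral>\<^sup>+z. F z \<partial>gauss)"
proof -
  \<comment> \<open>Only proportionality with a factor independent of \<open>F\<close> is shown
    here; the choice \<open>F = 1\<close> then identifies the factor.\<close>
  have "\<exists>K. \<forall>F \<in> borel_measurable borel.
     (\<integral>\<^sup>+q. gauss_weight (2 * m) q * (\<integral>\<^sup>+v. F (q * v) \<partial>mu_measure m) \<partial>lborel)
     = K * (\<integral>\<^sup>+z. F z \<partial>gauss)"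
  proof (cases "m = 0")
    case True
    have "(\<integral>\<^sup>+q. gauss_weight (2 * m) q * (\<integral>\<^sup>+v. F (q * v) \<partial>mu_measure m) \<partial>lborel)
     = ennreal (1/2 * sqrt (2 * pi)) * (\<integral>\<^sup>+z. F z \<partial>gauss)"
      if [measurable]: "F \<in> borel_measurable borel" for F
    proof -
      let ?g = "\<lambda>q. F q * ennreal (exp (- q\<^sup>2 / 2))"
      have "(\<integral>\<^sup>+q. gauss_weight (2 * m) q * (\<integral>\<^sup>+v. F (q * v) \<partial>mu_measure m) \<partial>lborel)
        = (\<integral>\<^sup>+q. ennreal (1/2) * ((?g q + ?g (- q)) * indicator {0..} q) \<partial>lborel)"
      proof (rule nn_integral_cong_nonzero, goal_cases)
        case (1 q)
        have "(\<integral>\<^sup>+v. F (q * v) \<partial>mu_measure m) = ennreal (1/2) * (F q + F (- q))"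
          unfolding True by (subst nn_integral_mu_measure_0) auto
        then show ?case
          using \<open>q \<noteq> 0\<close> True by (auto simp: distrib_left distrib_right mult_ac split: split_indicator)
      qed
      also have "\<dots> = ennreal (1/2) * (\<integral>\<^sup>+q. ?g q \<partial>lborel)"
        by (subst nn_integral_cmult, measurable, subst (2) nn_integral_fold_reflect, measurable)
      also have "(\<integral>\<^sup>+q. ?g q \<partial>lborel) = (\<integral>\<^sup>+q. ennreal (sqrt (2 * pi)) * (ennreal (std_normal_density q) * F q) \<partial>lborel)"
      proof (rule nn_integral_cong, goal_cases)
        case (1 q)
        have "ennreal (sqrt (2 * pi)) * ennreal (std_normal_density q) = ennreal (exp (- q\<^sup>2 / 2))"
          by (subst ennreal_mult'[symmetric]) (auto simp: std_normal_density_def)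
        then show ?case
          by (simp only: mult.assoc[symmetric]) (simp only: mult.commute)
      qed
      also have "\<dots> = ennreal (sqrt (2 * pi)) * (\<integral>\<^sup>+z. F z \<partial>gauss)"
        by (subst nn_integral_cmult, measurable, subst nn_integral_density) auto
      finally show ?thesis
        by (subst ennreal_mult') (simp_all add: mult.assoc)
    qed
    then show ?thesis by blast
  next
    case False
    with m have m: "0 < m" by simp
    let ?K = "ennreal (c_const (m - 1/2)) * (ennreal (1/2 * sqrt (2 * pi)) * ennreal (Gamma m / (1/2) powr m))"
    have "(\<integral>\<^sup>+q. gauss_weight (2 * m) q * (\<integral>\<^sup>+v. F (q * v) \<partial>mu_measure m) \<partial>lborel)
     = ?K * (\<integral>\<^sup>+z. F z \<partial>gauss)"
      if [measurable]: "F \<in> borel_measurable borel" for F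
    proof -
      \<comment> \<open>With z = qv the weight q^(2m) (1-v^2)^(m-1) dv becomes q (q^2-z^2)^(m-1) dz,
        and the condition |v| <= 1 becomes |z| <= q.\<close>
      define h where "h = (\<lambda>z q. indicator {0..} q * ((if \<bar>z\<bar> \<le> q then 1 else 0) * (q * (q\<^sup>2 - z\<^sup>2) powr (m - 1) * exp (- q\<^sup>2 / 2))) :: real)"
      have [measurable]: "(\<lambda>(z, q). h z q) \<in> borel_measurable (borel \<Otimes>\<^sub>M borel)" unfolding h_def by measurable
      have 1: "gauss_weight (2 * m) q * (\<integral>\<^sup>+v. F (q * v) \<partial>mu_measure m)
         = ennreal (c_const (m - 1/2)) * (\<integral>\<^sup>+z. F z * ennreal (h z q) \<partial>lborel)" if "q \<noteq> 0" for q
      proof (cases "0 < q")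
        case True
        have "(\<integral>\<^sup>+z. F z * ennreal (h z q) \<partial>lborel) = ennreal q * (\<integral>\<^sup>+v. F (q * v) * ennreal (h (q * v) q) \<partial>lborel)"
          using True by (subst nn_integral_real_affine[where c=q and t=0]) auto
        also have "\<dots> = (\<integral>\<^sup>+v. ennreal q * (F (q * v) * ennreal (h (q * v) q)) \<partial>lborel)"
          by (rule nn_integral_cmult[symmetric]) measurable
        also have "\<dots> = (\<integral>\<^sup>+v. ennreal (q powr (2 * m) * exp (- q\<^sup>2 / 2)) * (F (q * v) * beta_weight m v) \<partial>lborel)"
        proof (rule nn_integral_cong, goal_cases)
          case (1 v)
          have "(if \<bar>q * v\<bar> \<le> q then 1 else 0) = (indicator {-1..1} v :: real)"
            using True by (auto simp: abs_mult split: split_indicator)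
          moreover have "q * (q * (q\<^sup>2 - (q * v)\<^sup>2) powr (m - 1)) = q powr (2 * m) * (1 - v\<^sup>2) powr (m - 1)" if "v \<in> {-1..1}"
          proof -
            have e: "q\<^sup>2 - (q * v)\<^sup>2 = q powr 2 * (1 - v\<^sup>2)" using True by (simp add: power_mult_distrib algebra_simps)
            have "(q\<^sup>2 - (q * v)\<^sup>2) powr (m - 1) = q powr (2 * (m - 1)) * (1 - v\<^sup>2) powr (m - 1)"
              unfolding e using that by (subst powr_mult) (auto simp: powr_powr one_minus_sq_nonneg)
            moreover have "q * (q * q powr (2 * (m - 1))) = q powr (2 * m)"
            proof -
              have "q * (q * q powr (2 * (m - 1))) = q powr (1 + (1 + 2 * (m - 1)))"
                using True by (simp only: powr_add) simp
              then show ?thesis by simp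
            qed
            ultimately show ?thesis by (simp only: mult.assoc[symmetric])
          qed
          ultimately have "q * h (q * v) q = q powr (2 * m) * exp (- q\<^sup>2 / 2) * (indicator {-1..1} v * (1 - v\<^sup>2) powr (m - 1))"
            using True unfolding h_def by (auto simp: mult_ac split: split_indicator_asm if_splits)
          then show ?case
            using True by (simp only: mult.left_commute[of _ "F _"]) (simp add: ennreal_mult'[symmetric])
        qed
        also have "\<dots> = ennreal (q powr (2 * m) * exp (- q\<^sup>2 / 2)) * (\<integral>\<^sup>+v. F (q * v) * beta_weight m v \<partial>lborel)"
          by (rule nn_integral_cmult) measurable
        finally show ?thesis using True m
          by (subst nn_integral_mu_measure_pos) (auto simp: mult_ac)
      next
        case False then show ?thesis using that by (simp add: h_def)
      qed
      \<comment> \<open>In the variable x = q^2, shifted by z^2, the factor exp(-z^2/2) splits off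
        and a Gamma integral free of z remains: this produces the normal density.\<close>
      have 2: "(\<integral>\<^sup>+q. ennreal (h z q) \<partial>lborel) = ennreal (1/2 * exp (- z\<^sup>2 / 2)) * ennreal (Gamma m / (1/2) powr m)" for z
      proof -
        let ?F = "\<lambda>x. ennreal (1/2 * exp (- z\<^sup>2 / 2)) * ennreal (indicator {0..} (x - z\<^sup>2) * ((x - z\<^sup>2) powr (m - 1) * exp (- (1/2 * (x - z\<^sup>2)))))"
        have "(\<integral>\<^sup>+q. ennreal (h z q) \<partial>lborel) = (\<integral>\<^sup>+q. ?F (q\<^sup>2) * ennreal (2 * q) * indicator {0..} q \<partial>lborel)"
        proof (rule nn_integral_cong, goal_cases)
          case (1 q)
          show ?case
          proof (cases "0 \<le> q")
            case True
            have "\<bar>z\<bar> \<le> q \<longleftrightarrow> z\<^sup>2 \<le> q\<^sup>2" using True abs_le_square_iff[of z q] by simp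
            moreover have "exp (- z\<^sup>2 / 2) * exp (- (1/2 * (q\<^sup>2 - z\<^sup>2))) = exp (- q\<^sup>2 / 2)"
              by (simp add: exp_add[symmetric] field_simps)
            ultimately have "h z q = 1/2 * exp (- z\<^sup>2 / 2) * (indicator {0..} (q\<^sup>2 - z\<^sup>2) * ((q\<^sup>2 - z\<^sup>2) powr (m - 1) * exp (- (1/2 * (q\<^sup>2 - z\<^sup>2))))) * (2 * q)"
              unfolding h_def using True by (auto split: split_indicator)
            then show ?thesis using True by (simp add: ennreal_mult'[symmetric])
          qed (simp add: h_def)
        qed
        also have "\<dots> = (\<integral>\<^sup>+q. ?F q * indicator {0..} q \<partial>lborel)"
          by (rule nn_integral_square_subst) measurable
        also have "\<dots> = (\<integral>\<^sup>+q. ?F q \<partial>lborel)"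
          by (rule nn_integral_cong) (auto split: split_indicator intro: order_trans[OF zero_le_power2])
        also have "\<dots> = (\<integral>\<^sup>+x. ?F (z\<^sup>2 + 1 * x) \<partial>lborel)"
          by (subst nn_integral_real_affine[where c=1 and t="z\<^sup>2"]) auto
        also have "\<dots> = ennreal (1/2 * exp (- z\<^sup>2 / 2)) * (\<integral>\<^sup>+x. ennreal (indicator {0..} x * (x powr (m - 1) * exp (- (1/2 * x)))) \<partial>lborel)"
          by (subst nn_integral_cmult[symmetric]) auto
        also have "\<dots> = ennreal (1/2 * exp (- z\<^sup>2 / 2)) * ennreal (Gamma m / (1/2) powr m)"
          using m by (subst nn_integral_Gamma_scaled) auto
        finally show ?thesis .
      qed
      have "(\<integral>\<^sup>+q. gauss_weight (2 * m) q * (\<integral>\<^sup>+v. F (q * v) \<partial>mu_measure m) \<partial>lborel)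
         = (\<integral>\<^sup>+q. ennreal (c_const (m - 1/2)) * (\<integral>\<^sup>+z. F z * ennreal (h z q) \<partial>lborel) \<partial>lborel)"
        by (rule nn_integral_cong_nonzero, rule 1)
      also have "\<dots> = ennreal (c_const (m - 1/2)) * (\<integral>\<^sup>+q. (\<integral>\<^sup>+z. F z * ennreal (h z q) \<partial>lborel) \<partial>lborel)"
        by (rule nn_integral_cmult) measurable
      also have "(\<integral>\<^sup>+q. (\<integral>\<^sup>+z. F z * ennreal (h z q) \<partial>lborel) \<partial>lborel) = (\<integral>\<^sup>+z. (\<integral>\<^sup>+q. F z * ennreal (h z q) \<partial>lborel) \<partial>lborel)"
        by (rule lborel_pair.Fubini'[symmetric]) measurable
      also have "\<dots> = (\<integral>\<^sup>+z. F z * (ennreal (1/2 * exp (- z\<^sup>2 / 2)) * ennreal (Gamma m / (1/2) powr m)) \<partial>lborel)"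
        by (subst nn_integral_cmult) (simp_all only: 2, measurable)
      also have "\<dots> = (\<integral>\<^sup>+z. (ennreal (1/2 * sqrt (2 * pi)) * ennreal (Gamma m / (1/2) powr m)) * (ennreal (std_normal_density z) * F z) \<partial>lborel)"
      proof (rule nn_integral_cong, goal_cases)
        case (1 z)
        have e: "ennreal (1/2 * sqrt (2 * pi)) * ennreal (std_normal_density z) = ennreal (1/2 * exp (- z\<^sup>2 / 2))"
          by (subst ennreal_mult'[symmetric]) (auto simp: std_normal_density_def)
        show ?case
          unfolding e[symmetric] by (simp only: mult_ac)
      qed
      also have "\<dots> = (ennreal (1/2 * sqrt (2 * pi)) * ennreal (Gamma m / (1/2) powr m)) * (\<integral>\<^sup>+z. F z \<partial>gauss)"
        by (subst nn_integral_cmult, measurable, subst nn_integral_density) auto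
      finally show ?thesis by (simp only: mult.assoc)
    qed
    then show ?thesis by blast
  qed
  then obtain K where K: "\<And>F. F \<in> borel_measurable borel \<Longrightarrow> (\<integral>\<^sup>+q. gauss_weight (2 * m) q * (\<integral>\<^sup>+v. F (q * v) \<partial>mu_measure m) \<partial>lborel)
     = K * (\<integral>\<^sup>+z. F z \<partial>gauss)" by blast
  interpret prob_space "mu_measure m" by (rule prob_space_mu_measure[OF m])
  interpret N: real_distribution gauss by (rule real_dist_normal_dist)
  have "ennreal (gauss_moment (2 * m)) = K"
    using K[of "\<lambda>_. 1"] m N.emeasure_space_1 nn_integral_gauss_moment[of "2 * m"]
    by (simp add: emeasure_space_1[simplified])
  then show ?thesis using K[OF assms(1)] by simp
qed

text \<open>Adding the contributions of y and -y symmetrizes the inner integral, so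
  \<open>kappa_measure k\<close> may be replaced by \<open>mu_measure k\<close>; the factor 2 comes
  from the two half-lines.\<close>

lemma kappa_measure_gauss:
  assumes [measurable]: "F \<in> borel_measurable borel" and k: "0 \<le> k"
  shows "(\<integral>\<^sup>+y. ennreal (\<bar>y\<bar> powr (2 * k) * exp (- y\<^sup>2 / 2)) * (\<integral>\<^sup>+u. F (y * u) \<partial>kappa_measure k) \<partial>lborel)
     = ennreal (2 * gauss_moment (2 * k)) * (\<integral>\<^sup>+z. F z \<partial>gauss)"
proof -
  interpret prob_space "kappa_measure k" by (rule prob_space_kappa_measure[OF k])
  let ?g = "\<lambda>y. ennreal (\<bar>y\<bar> powr (2 * k) * exp (- y\<^sup>2 / 2)) * (\<integral>\<^sup>+u. F (y * u) \<partial>kappa_measure k)"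
  have [measurable]: "?g \<in> borel_measurable borel" by measurable
  have "(\<integral>\<^sup>+y. ?g y \<partial>lborel) = (\<integral>\<^sup>+y. (?g y + ?g (- y)) * indicator {0..} y \<partial>lborel)"
    by (rule nn_integral_fold_reflect) measurable
  also have "\<dots> = (\<integral>\<^sup>+y. 2 * (gauss_weight (2 * k) y * (\<integral>\<^sup>+v. F (y * v) \<partial>mu_measure k)) \<partial>lborel)"
  proof (rule nn_integral_cong, goal_cases)
    case (1 y)
    have "(\<integral>\<^sup>+u. F (y * u) \<partial>kappa_measure k) + (\<integral>\<^sup>+u. F (- y * u) \<partial>kappa_measure k) = (\<integral>\<^sup>+u. F (y * u) + F (y * (- u)) \<partial>kappa_measure k)"
      by (subst nn_integral_add[symmetric]) auto
    also have "\<dots> = 2 * (\<integral>\<^sup>+v. F (y * v) \<partial>mu_measure k)"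
      using k by (intro nn_integral_kappa_measure_symmetrize) auto
    finally have sm: "(\<integral>\<^sup>+u. F (y * u) \<partial>kappa_measure k) + (\<integral>\<^sup>+u. F (- y * u) \<partial>kappa_measure k) = \<dots>" .
    show ?case
    proof (cases "0 \<le> y")
      case True
      define A where "A = ennreal (\<bar>y\<bar> powr (2 * k) * exp (- y\<^sup>2 / 2))"
      have "?g y + ?g (- y) = A * ((\<integral>\<^sup>+u. F (y * u) \<partial>kappa_measure k) + (\<integral>\<^sup>+u. F (- y * u) \<partial>kappa_measure k))"
        by (simp add: A_def distrib_left)
      then show ?thesis unfolding sm using True by (simp add: A_def mult_ac)
    qed simp
  qed
  also have "\<dots> = 2 * (\<integral>\<^sup>+y. gauss_weight (2 * k) y * (\<integral>\<^sup>+v. F (y * v) \<partial>mu_measure k) \<partial>lborel)"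
  proof (rule nn_integral_cmult)
    interpret M: prob_space "mu_measure k" by (rule prob_space_mu_measure[OF k])
    show "(\<lambda>y. gauss_weight (2 * k) y * (\<integral>\<^sup>+v. F (y * v) \<partial>mu_measure k)) \<in> borel_measurable lborel" by measurable
  qed
  also have "\<dots> = 2 * (ennreal (gauss_moment (2 * k)) * (\<integral>\<^sup>+z. F z \<partial>gauss))"
    by (subst mu_measure_gauss) (use k in auto)
  also have "\<dots> = ennreal (2 * gauss_moment (2 * k)) * (\<integral>\<^sup>+z. F z \<partial>gauss)"
    by (simp add: ennreal_mult' mult.assoc)
  finally show ?thesis .
qed

section \<open>Product measures and Gaussian vectors\<close>

lemma borel_measurable_vecI [measurable]:
  fixes f :: "'a \<Rightarrow> 'i::finite \<Rightarrow> real"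
  assumes [measurable]: "\<And>i. (\<lambda>x. f x i) \<in> borel_measurable M"
  shows "(\<lambda>x. \<chi> i. f x i) \<in> borel_measurable M"
  by (subst borel_measurable_euclidean_space) (auto simp: Basis_vec_def inner_axis)

lemma borel_measurable_vec_nth' [measurable (raw)]:
  fixes f :: "'a \<Rightarrow> real ^ 'i"
  assumes "f \<in> borel_measurable M"
  shows "(\<lambda>x. f x $ i) \<in> borel_measurable M"
  using assms by (subst (asm) borel_measurable_euclidean_space) (auto simp: Basis_vec_def cart_eq_inner_axis)

lemma lborel_vec:
  "distr (\<Pi>\<^sub>M i\<in>(UNIV::'i::finite set). lborel) borel (\<lambda>f. \<chi> i. f i) = (lborel :: (real ^ 'i) measure)"
proof (rule lborel_eqI[symmetric])
  interpret product_sigma_finite "\<lambda>i::'i. lborel :: real measure" by standard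
  fix l u :: "real ^ 'i" assume lu: "\<And>b. b \<in> Basis \<Longrightarrow> l \<bullet> b \<le> u \<bullet> b"
  have le: "l $ i \<le> u $ i" for i
    using lu[of "axis i 1"] by (simp add: cart_eq_inner_axis)
  have "emeasure (distr (\<Pi>\<^sub>M i\<in>(UNIV::'i set). lborel) borel (\<lambda>f. \<chi> i. f i)) (box l u)
     = emeasure (\<Pi>\<^sub>M i\<in>(UNIV::'i set). lborel) (\<Pi>\<^sub>E i\<in>UNIV. {l $ i<..<u $ i})"
    by (subst emeasure_distr) (auto intro!: arg_cong2[where f=emeasure] simp: space_PiM PiE_def extensional_def mem_box_cart Pi_def)
  also have "\<dots> = (\<Prod>i\<in>UNIV. ennreal (u $ i - l $ i))"
    by (subst emeasure_PiM) (auto simp: le)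
  also have "\<dots> = ennreal (\<Prod>i\<in>UNIV. u $ i - l $ i)"
    by (rule prod_ennreal) (simp add: le)
  also have "(\<Prod>i\<in>UNIV. u $ i - l $ i) = (\<Prod>b\<in>Basis. (u - l) \<bullet> b)"
  proof -
    have B: "(Basis :: (real ^ 'i) set) = range (\<lambda>i. axis i 1)" by (auto simp: Basis_vec_def)
    have inj: "inj (\<lambda>i::'i. axis i (1::real))" by (auto simp: inj_on_def axis_eq_axis)
    show ?thesis unfolding B by (subst prod.reindex[OF inj]) (simp add: inner_axis)
  qed
  finally show "emeasure (distr (\<Pi>\<^sub>M i\<in>(UNIV::'i set). lborel) borel (\<lambda>f. \<chi> i. f i)) (box l u) = \<dots>" .
qed simp

lemma nn_integral_lborel_vec:
  fixes F :: "real ^ 'i \<Rightarrow> ennreal"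
  assumes [measurable]: "F \<in> borel_measurable borel"
  shows "(\<integral>\<^sup>+x. F x \<partial>lborel) = (\<integral>\<^sup>+f. F (\<chi> i. f i) \<partial>(\<Pi>\<^sub>M i\<in>UNIV. lborel))"
  unfolding lborel_vec[symmetric] by (subst nn_integral_distr) auto

lemma sets_PiM_kappa_measure [measurable_cong]:
  "sets (\<Pi>\<^sub>M i\<in>I. kappa_measure (k i)) = sets (\<Pi>\<^sub>M i\<in>I. borel)"
  by (rule sets_PiM_cong) auto

lemma sets_PiM_std_normal [measurable_cong]:
  "sets (\<Pi>\<^sub>M i\<in>I. gauss) = sets (\<Pi>\<^sub>M i\<in>I. borel)"
  by (rule sets_PiM_cong) auto

lemma sets_PiM_lborel' [measurable_cong]:
  "sets (\<Pi>\<^sub>M i\<in>I. lborel) = sets (\<Pi>\<^sub>M i\<in>I. borel)"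
  by (rule sets_PiM_cong) auto

text \<open>For a general \<open>F\<close> the integral does not factor, so the one-dimensional
  identity is lifted as an equality of measures: the image of the normalized weight under
  coordinatewise multiplication is the Gaussian product measure.\<close>

lemma PiM_kappa_measure_gauss:
  fixes k :: "'i::finite \<Rightarrow> real" and F :: "('i \<Rightarrow> real) \<Rightarrow> ennreal"
  assumes k: "\<And>i. 0 \<le> k i" and F[measurable]: "F \<in> borel_measurable (\<Pi>\<^sub>M i\<in>UNIV. borel)"
  shows "(\<integral>\<^sup>+y. (\<Prod>i\<in>UNIV. ennreal (\<bar>y i\<bar> powr (2 * k i) * exp (- (y i)\<^sup>2 / 2)))
            * (\<integral>\<^sup>+u. F (\<lambda>i. y i * u i) \<partial>(\<Pi>\<^sub>M i\<in>UNIV. kappa_measure (k i))) \<partial>(\<Pi>\<^sub>M i\<in>UNIV. lborel))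
    = ennreal (\<Prod>i\<in>UNIV. 2 * gauss_moment (2 * k i)) * (\<integral>\<^sup>+z. F z \<partial>(\<Pi>\<^sub>M i\<in>UNIV. gauss))"
proof -
  interpret L: product_sigma_finite "\<lambda>i::'i. lborel :: real measure" by standard
  interpret K: product_prob_space "\<lambda>i. kappa_measure (k i)"
    by (simp add: product_prob_space_def product_sigma_finite_def product_prob_space_axioms_def
         prob_space_kappa_measure k prob_space_imp_sigma_finite)
  interpret N: product_prob_space "\<lambda>i::'i. gauss"
    using real_dist_normal_dist
    by (simp add: product_prob_space_def product_sigma_finite_def product_prob_space_axioms_def
         real_distribution_def prob_space_imp_sigma_finite)
  let ?L = "\<Pi>\<^sub>M i\<in>(UNIV::'i set). (lborel :: real measure)" and ?K = "\<Pi>\<^sub>M i\<in>UNIV. kappa_measure (k i)"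
  let ?B = "\<Pi>\<^sub>M i\<in>(UNIV::'i set). (borel :: real measure)"
  interpret PL: finite_product_sigma_finite "\<lambda>i::'i. lborel :: real measure" UNIV by standard simp
  interpret PK: prob_space ?K by (rule prob_space_PiM) (simp add: prob_space_kappa_measure k)
  \<comment> \<open>The weights are normalized so that each coordinate of the image measure is
    exactly a standard normal law.\<close>
  define w where "w = (\<lambda>i y. \<bar>y\<bar> powr (2 * k i) * exp (- y\<^sup>2 / 2) / (2 * gauss_moment (2 * k i)))"
  define c where "c = (\<lambda>i. 2 * gauss_moment (2 * k i))"
  have c: "0 < c i" for i unfolding c_def using k[of i] gauss_moment_pos[of "2 * k i"] by simp
  have [measurable]: "w i \<in> borel_measurable borel" for i unfolding w_def by measurable
  have w0: "0 \<le> w i y" for i y using c[of i] unfolding w_def c_def by simp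
  have cw: "ennreal (c i) * ennreal (w i y) = ennreal (\<bar>y\<bar> powr (2 * k i) * exp (- y\<^sup>2 / 2))" for i y
    using c[of i] by (subst ennreal_mult'[symmetric]) (auto simp: w_def c_def)
  have one: "(\<integral>\<^sup>+y. ennreal (w i y) * (\<integral>\<^sup>+u. F (y * u) \<partial>kappa_measure (k i)) \<partial>lborel) = (\<integral>\<^sup>+z. F z \<partial>gauss)"
    if [measurable]: "F \<in> borel_measurable borel" for i F
  proof -
    interpret prob_space "kappa_measure (k i)" by (rule prob_space_kappa_measure[OF k])
    have "ennreal (c i) * (\<integral>\<^sup>+y. ennreal (w i y) * (\<integral>\<^sup>+u. F (y * u) \<partial>kappa_measure (k i)) \<partial>lborel)
       = (\<integral>\<^sup>+y. ennreal (\<bar>y\<bar> powr (2 * k i) * exp (- y\<^sup>2 / 2)) * (\<integral>\<^sup>+u. F (y * u) \<partial>kappa_measure (k i)) \<partial>lborel)"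
      by (subst nn_integral_cmult[symmetric]) (auto simp: mult.assoc[symmetric] cw)
    also have "\<dots> = ennreal (c i) * (\<integral>\<^sup>+z. F z \<partial>gauss)"
      unfolding c_def by (rule kappa_measure_gauss) (auto simp: k)
    finally show ?thesis using c[of i] by (subst (asm) ennreal_mult_cancel_left) (auto simp: ennreal_eq_0_iff)
  qed
  let ?h = "\<lambda>(y, u). (\<lambda>i. y i * u i)"
  let ?P = "distr (density (?L \<Otimes>\<^sub>M ?K) (\<lambda>(y, u). \<Prod>i\<in>UNIV. ennreal (w i (y i)))) ?B ?h"
  have h[measurable]: "?h \<in> measurable (?L \<Otimes>\<^sub>M ?K) ?B"
    by (rule measurable_PiM_single') (auto simp: split_beta space_PiM)
  have P_int: "(\<integral>\<^sup>+z. G z \<partial>?P) = (\<integral>\<^sup>+y. (\<Prod>i\<in>UNIV. ennreal (w i (y i))) * (\<integral>\<^sup>+u. G (\<lambda>i. y i * u i) \<partial>?K) \<partial>?L)"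
    if [measurable]: "G \<in> borel_measurable ?B" for G
  proof -
    have [measurable]: "(\<lambda>x. G (?h x)) \<in> borel_measurable (?L \<Otimes>\<^sub>M ?K)"
      by (rule measurable_compose[OF h]) measurable
    have "(\<integral>\<^sup>+z. G z \<partial>?P) = (\<integral>\<^sup>+x. (\<Prod>i\<in>UNIV. ennreal (w i (fst x i))) * G (?h x) \<partial>(?L \<Otimes>\<^sub>M ?K))"
      by (subst nn_integral_distr, measurable, subst nn_integral_density) (auto simp: split_beta')
    also have "\<dots> = (\<integral>\<^sup>+y. (\<integral>\<^sup>+u. (\<Prod>i\<in>UNIV. ennreal (w i (y i))) * G (\<lambda>i. y i * u i) \<partial>?K) \<partial>?L)"
      by (subst PK.nn_integral_fst[symmetric]) (auto simp: split_beta')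
    also have "\<dots> = (\<integral>\<^sup>+y. (\<Prod>i\<in>UNIV. ennreal (w i (y i))) * (\<integral>\<^sup>+u. G (\<lambda>i. y i * u i) \<partial>?K) \<partial>?L)"
    proof (rule nn_integral_cong, rule nn_integral_cmult)
      fix y assume "y \<in> space ?L"
      then have "(\<lambda>u. G (?h (y, u))) \<in> borel_measurable ?K"
        by (intro measurable_compose[OF measurable_Pair1' measurable_compose[OF h]]) auto
      then show "(\<lambda>u. G (\<lambda>i. y i * u i)) \<in> borel_measurable ?K" by simp
    qed
    finally show ?thesis .
  qed
  \<comment> \<open>Agreement on boxes suffices; there all integrals factor and \<open>one\<close>
    applies in each coordinate.\<close>
  have "?P = (\<Pi>\<^sub>M i\<in>UNIV. gauss)"
  proof (rule N.PiM_eqI)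
    fix A :: "'i \<Rightarrow> real set" assume "\<And>i. i \<in> UNIV \<Longrightarrow> A i \<in> sets gauss"
    then have A[measurable]: "A i \<in> sets borel" for i by simp
    have PA: "Pi\<^sub>E UNIV A \<in> sets ?B" by (rule sets_PiM_I_finite) auto
    have ind: "indicator (Pi\<^sub>E UNIV A) z = (\<Prod>i\<in>UNIV. indicator (A i) (z i) :: ennreal)" for z
    proof (cases "z \<in> Pi\<^sub>E UNIV A")
      case False
      then obtain i where "z i \<notin> A i" by (auto simp: PiE_def Pi_def extensional_def)
      then have "(\<Prod>i\<in>UNIV. indicator (A i) (z i)) = (0::ennreal)"
        by (intro prod_zero) (auto intro!: exI[of _ i])
      then show ?thesis using False by simp
    qed (auto simp: PiE_def Pi_def)
    have "emeasure ?P (Pi\<^sub>E UNIV A) = (\<integral>\<^sup>+z. indicator (Pi\<^sub>E UNIV A) z \<partial>?P)"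
      using PA by simp
    also have "\<dots> = (\<integral>\<^sup>+y. (\<Prod>i\<in>UNIV. ennreal (w i (y i))) * (\<integral>\<^sup>+u. indicator (Pi\<^sub>E UNIV A) (\<lambda>i. y i * u i) \<partial>?K) \<partial>?L)"
      by (rule P_int) (use PA in measurable)
    also have "\<dots> = (\<integral>\<^sup>+y. (\<Prod>i\<in>UNIV. ennreal (w i (y i)) * (\<integral>\<^sup>+u. indicator (A i) (y i * u) \<partial>kappa_measure (k i))) \<partial>?L)"
    proof (rule nn_integral_cong, goal_cases)
      case (1 y)
      have "(\<integral>\<^sup>+u. indicator (Pi\<^sub>E UNIV A) (\<lambda>i. y i * u i) \<partial>?K) = (\<integral>\<^sup>+u. (\<Prod>i\<in>UNIV. indicator (A i) (y i * u i)) \<partial>?K)"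
        by (simp only: ind)
      also have "\<dots> = (\<Prod>i\<in>UNIV. \<integral>\<^sup>+u. indicator (A i) (y i * u) \<partial>kappa_measure (k i))"
        by (rule K.product_nn_integral_prod) auto
      finally show ?case
        by (simp add: prod.distrib)
    qed
    also have "\<dots> = (\<Prod>i\<in>UNIV. \<integral>\<^sup>+y. ennreal (w i y) * (\<integral>\<^sup>+u. indicator (A i) (y * u) \<partial>kappa_measure (k i)) \<partial>lborel)"
    proof (rule L.product_nn_integral_prod)
      fix i
      interpret prob_space "kappa_measure (k i)" by (rule prob_space_kappa_measure[OF k])
      show "(\<lambda>y. ennreal (w i y) * (\<integral>\<^sup>+u. indicator (A i) (y * u) \<partial>kappa_measure (k i))) \<in> borel_measurable lborel"
        by measurable
    qed simp
    also have "\<dots> = (\<Prod>i\<in>UNIV. emeasure gauss (A i))"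
      by (subst one) auto
    finally show "emeasure ?P (Pi\<^sub>E UNIV A) = (\<Prod>i\<in>UNIV. emeasure gauss (A i))" .
  qed (auto simp: sets_PiM_std_normal)
  then have "(\<integral>\<^sup>+z. F z \<partial>(\<Pi>\<^sub>M i\<in>UNIV. gauss)) = (\<integral>\<^sup>+z. F z \<partial>?P)" by simp
  also have "\<dots> = (\<integral>\<^sup>+y. (\<Prod>i\<in>UNIV. ennreal (w i (y i))) * (\<integral>\<^sup>+u. F (\<lambda>i. y i * u i) \<partial>?K) \<partial>?L)"
    by (rule P_int) measurable
  finally have eq: "(\<integral>\<^sup>+z. F z \<partial>(\<Pi>\<^sub>M i\<in>UNIV. gauss)) = \<dots>" .
  have pc: "ennreal (\<Prod>i\<in>UNIV. c i) = (\<Prod>i\<in>UNIV. ennreal (c i))"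
    using c by (intro prod_ennreal[symmetric]) (auto intro: less_imp_le)
  have m: "(\<lambda>y. (\<integral>\<^sup>+u. F (\<lambda>i. y i * u i) \<partial>?K)) \<in> borel_measurable ?L"
  proof -
    have "(\<lambda>x. F (?h x)) \<in> borel_measurable (?L \<Otimes>\<^sub>M ?K)"
      by (rule measurable_compose[OF h]) measurable
    from PK.borel_measurable_nn_integral_fst[OF this] show ?thesis by simp
  qed
  show ?thesis
    unfolding eq c_def[symmetric] pc
    by (subst nn_integral_cmult[symmetric])
       (use m in \<open>auto simp: mult.assoc[symmetric] prod.distrib[symmetric] cw\<close>)
qed

text \<open>Rotation invariance, seen on characteristic functions: the exponents (a x_i)^2/2 and (a
  x')^2/2 add up to a^2/2 because the coefficient vector is a unit vector.\<close>

lemma PiM_std_normal_linear: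
  fixes x :: "'i::finite \<Rightarrow> real"
  assumes "(\<Sum>i\<in>UNIV. (x i)\<^sup>2) + x'\<^sup>2 = 1"
  shows "distr ((\<Pi>\<^sub>M i\<in>UNIV. gauss) \<Otimes>\<^sub>M gauss) borel
     (\<lambda>(z, z'). (\<Sum>i\<in>UNIV. x i * z i) + x' * z') = gauss"
    (is "distr ?P borel ?h = ?N")
proof -
  interpret N: real_distribution ?N by (rule real_dist_normal_dist)
  interpret PN: product_prob_space "\<lambda>i::'i. ?N"
    by (simp add: product_prob_space_def product_sigma_finite_def product_prob_space_axioms_def
         N.prob_space_axioms prob_space_imp_sigma_finite)
  interpret Z: prob_space "\<Pi>\<^sub>M i\<in>(UNIV::'i set). ?N" by (rule prob_space_PiM) (rule N.prob_space_axioms)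
  interpret P: pair_prob_space "\<Pi>\<^sub>M i\<in>(UNIV::'i set). ?N" ?N ..
  have h[measurable]: "?h \<in> borel_measurable ?P" by measurable
  interpret D: prob_space "distr ?P borel ?h" by (rule P.prob_space_distr) simp
  have rd: "real_distribution (distr ?P borel ?h)"
    by (simp add: real_distribution_def real_distribution_axioms_def D.prob_space_axioms)
  show ?thesis
  proof (rule Levy_uniqueness[OF rd real_dist_normal_dist], rule ext)
    fix a :: real
    have int1: "integrable ?N (\<lambda>z. iexp (b * z))" for b
      by (rule N.integrable_const_bound[where B=1]) auto
    have ch: "(LINT z|?N. iexp (b * z)) = complex_of_real (exp (- b\<^sup>2 / 2))" for b
      using char_std_normal_distribution by (simp add: char_def fun_eq_iff)
    have "char (distr ?P borel ?h) a = (LINT p|?P. iexp (a * ?h p))"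
      unfolding char_def by (rule integral_distr) auto
    also have "\<dots> = (LINT z|(\<Pi>\<^sub>M i\<in>UNIV. ?N). LINT z'|?N. iexp (a * ?h (z, z')))"
      by (rule P.integral_fst'[symmetric], rule P.P.integrable_const_bound[where B=1]) auto
    also have "\<dots> = (LINT z|(\<Pi>\<^sub>M i\<in>UNIV. ?N). LINT z'|?N. (\<Prod>i\<in>UNIV. iexp ((a * x i) * z i)) * iexp ((a * x') * z'))"
      by (intro Bochner_Integration.integral_cong refl)
         (simp add: exp_sum[symmetric] exp_add[symmetric] algebra_simps sum_distrib_left)
    also have "\<dots> = (LINT z|(\<Pi>\<^sub>M i\<in>UNIV. ?N). (\<Prod>i\<in>UNIV. iexp ((a * x i) * z i))) * (LINT z'|?N. iexp ((a * x') * z'))"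
      by simp
    also have "\<dots> = (\<Prod>i\<in>UNIV. LINT z|?N. iexp ((a * x i) * z)) * (LINT z'|?N. iexp ((a * x') * z'))"
      by (subst PN.product_integral_prod) (simp, rule int1, rule refl)
    also have "\<dots> = complex_of_real ((\<Prod>i\<in>UNIV. exp (- (a * x i)\<^sup>2 / 2)) * exp (- (a * x')\<^sup>2 / 2))"
      unfolding ch by simp
    also have "(\<Prod>i\<in>UNIV. exp (- (a * x i)\<^sup>2 / 2)) * exp (- (a * x')\<^sup>2 / 2) = exp (- a\<^sup>2 / 2 * ((\<Sum>i\<in>UNIV. (x i)\<^sup>2) + x'\<^sup>2))"
      by (simp add: exp_sum[symmetric] exp_add[symmetric] power_mult_distrib algebra_simps sum_distrib_left sum_divide_distrib sum_negf)
    also have "complex_of_real \<dots> = char ?N a"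
      unfolding assms by (simp add: char_std_normal_distribution)
    finally show "char (distr ?P borel ?h) a = char ?N a" .
  qed
qed

text \<open>For fixed r, q = sqrt(s^2 - r^2) satisfies s ds = q dq, and the exponential splits as
  exp(-r^2/2) exp(-q^2/2). Both sides are compared through the variable x = q^2.\<close>

lemma nn_integral_gauss_radial:
  assumes [measurable]: "H \<in> borel_measurable borel" and r: "0 \<le> r"
  shows "(\<integral>\<^sup>+s. ennreal (indicator {r..} s * (s * exp (- s\<^sup>2 / 2) * (s\<^sup>2 - r\<^sup>2) powr (m - 1/2))) * H (sqrt (s\<^sup>2 - r\<^sup>2)) \<partial>lborel)
    = ennreal (exp (- r\<^sup>2 / 2)) * (\<integral>\<^sup>+q. gauss_weight (2 * m) q * H q \<partial>lborel)"
proof -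
  let ?F = "\<lambda>x. ennreal (1/2 * (indicator {0..} x * (x powr (m - 1/2) * exp (- (1/2 * x))))) * H (sqrt x)"
  let ?G = "\<lambda>x. ennreal (exp (- r\<^sup>2 / 2)) * ?F (x - r\<^sup>2)"
  have "(\<integral>\<^sup>+s. ennreal (indicator {r..} s * (s * exp (- s\<^sup>2 / 2) * (s\<^sup>2 - r\<^sup>2) powr (m - 1/2))) * H (sqrt (s\<^sup>2 - r\<^sup>2)) \<partial>lborel)
     = (\<integral>\<^sup>+s. ?G (s\<^sup>2) * ennreal (2 * s) * indicator {0..} s \<partial>lborel)"
  proof (rule nn_integral_cong, goal_cases)
    case (1 s)
    show ?case
    proof (cases "0 \<le> s")
      case True
      have "r \<le> s \<longleftrightarrow> r\<^sup>2 \<le> s\<^sup>2" using True r by (simp add: power_mono_iff)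
      moreover have "exp (- r\<^sup>2 / 2) * exp (- (1/2 * (s\<^sup>2 - r\<^sup>2))) = exp (- s\<^sup>2 / 2)"
        by (simp add: exp_add[symmetric] field_simps)
      ultimately have e: "indicator {r..} s * (s * exp (- s\<^sup>2 / 2) * (s\<^sup>2 - r\<^sup>2) powr (m - 1/2))
         = exp (- r\<^sup>2 / 2) * ((1/2 * (indicator {0..} (s\<^sup>2 - r\<^sup>2) * ((s\<^sup>2 - r\<^sup>2) powr (m - 1/2) * exp (- (1/2 * (s\<^sup>2 - r\<^sup>2)))))) * (2 * s))"
        by (auto split: split_indicator)
      show ?thesis
        unfolding e using True by (subst ennreal_mult', simp, subst ennreal_mult', simp) (simp add: mult_ac)
    next
      case False then show ?thesis using r by simp
    qed
  qed
  also have "\<dots> = (\<integral>\<^sup>+s. ?G s * indicator {0..} s \<partial>lborel)"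
    by (rule nn_integral_square_subst) measurable
  also have "\<dots> = (\<integral>\<^sup>+s. ?G s \<partial>lborel)"
    by (rule nn_integral_cong) (auto split: split_indicator intro: order_trans[OF zero_le_power2])
  also have "\<dots> = (\<integral>\<^sup>+x. ?G (r\<^sup>2 + 1 * x) \<partial>lborel)"
    by (subst nn_integral_real_affine[where c=1 and t="r\<^sup>2"]) auto
  also have "\<dots> = (\<integral>\<^sup>+x. ennreal (exp (- r\<^sup>2 / 2)) * (?F x * indicator {0..} x) \<partial>lborel)"
    by (rule nn_integral_cong) (auto split: split_indicator)
  also have "\<dots> = ennreal (exp (- r\<^sup>2 / 2)) * (\<integral>\<^sup>+x. ?F x * indicator {0..} x \<partial>lborel)"
    by (rule nn_integral_cmult) measurable
  also have "(\<integral>\<^sup>+x. ?F x * indicator {0..} x \<partial>lborel) = (\<integral>\<^sup>+q. ?F (q\<^sup>2) * ennreal (2 * q) * indicator {0..} q \<partial>lborel)"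
    by (rule nn_integral_square_subst[symmetric]) measurable
  also have "\<dots> = (\<integral>\<^sup>+q. gauss_weight (2 * m) q * H q \<partial>lborel)"
  proof (rule nn_integral_cong_nonzero, goal_cases)
    case (1 q)
    show ?case
    proof (cases "0 < q")
      case True
      have "q\<^sup>2 = q powr 2" using True by simp
      then have "(q\<^sup>2) powr (m - 1/2) = q powr (2 * (m - 1/2))" by (simp only: powr_powr)
      then have "(q\<^sup>2) powr (m - 1/2) * q = q powr (2 * (m - 1/2) + 1)"
        using True by (simp only: powr_add) simp
      also have "2 * (m - 1/2) + 1 = 2 * m" by simp
      finally have *: "(q\<^sup>2) powr (m - 1/2) * q = q powr (2 * m)" .
      have "1/2 * (indicator {0..} (q\<^sup>2) * ((q\<^sup>2) powr (m - 1/2) * exp (- (1/2 * q\<^sup>2)))) * (2 * q)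
         = ((q\<^sup>2) powr (m - 1/2) * q) * exp (- (1/2 * q\<^sup>2))"
        using True by simp
      also have "\<dots> = q powr (2 * m) * exp (- q\<^sup>2 / 2)" unfolding * by simp
      finally have "ennreal (1/2 * (indicator {0..} (q\<^sup>2) * ((q\<^sup>2) powr (m - 1/2) * exp (- (1/2 * q\<^sup>2))))) * ennreal (2 * q) = ennreal (q powr (2 * m) * exp (- q\<^sup>2 / 2))"
        using True by (subst ennreal_mult'[symmetric]) auto
      then have "?F (q\<^sup>2) * ennreal (2 * q) = ennreal (q powr (2 * m) * exp (- q\<^sup>2 / 2)) * H q"
        using True by (simp only: mult_ac real_sqrt_abs abs_of_pos)
      then show ?thesis using True by simp
    qed (use \<open>q \<noteq> 0\<close> in auto)
  qed
  finally show ?thesis .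
qed

lemma nn_integral_lborel_scaleR:
  fixes F :: "'a::euclidean_space \<Rightarrow> ennreal"
  assumes [measurable]: "F \<in> borel_measurable borel" and c: "c \<noteq> 0"
  shows "(\<integral>\<^sup>+x. F x \<partial>lborel) = ennreal (\<bar>c\<bar> ^ DIM('a)) * (\<integral>\<^sup>+x. F (c *\<^sub>R x) \<partial>lborel)"
  by (subst lborel_affine[OF c, of 0]) (simp add: nn_integral_density nn_integral_distr nn_integral_cmult)

text \<open>The hypothesis says that a variable with law \<open>M\<close> becomes standard normal
  when multiplied by an independent radius; by \<open>mu_measure_gauss\<close> the same holds for
  \<open>mu_measure m\<close>. The k-th moment of the product factors and the radius has nonzero
  moments, so the moments of the two laws agree.\<close>

lemma mu_measure_eqI_gauss:
  assumes M: "real_distribution M" and bd: "AE x in M. \<bar>x\<bar> \<le> 1" and m: "0 \<le> m"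
    and eq: "\<And>F. F \<in> borel_measurable borel \<Longrightarrow>
      (\<integral>\<^sup>+s. gauss_weight (2 * m) s * (\<integral>\<^sup>+l. F (s * l) \<partial>M) \<partial>lborel)
      = ennreal (gauss_moment (2 * m)) * (\<integral>\<^sup>+z. F z \<partial>gauss)"
  shows "M = mu_measure m"
proof -
  let ?N = gauss
  have g: "0 < gauss_moment (2 * m)" using m by (intro gauss_moment_pos) simp
  define w where "w = (\<lambda>s. indicator {0..} s * (s powr (2 * m) * exp (- s\<^sup>2 / 2)) / gauss_moment (2 * m))"
  have [measurable]: "w \<in> borel_measurable borel" unfolding w_def by measurable
  have w0: "0 \<le> w s" for s using g by (simp add: w_def)
  have gw: "ennreal (gauss_moment (2 * m)) * ennreal (w s) = gauss_weight (2 * m) s" for s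
    using g by (subst ennreal_mult'[symmetric]) (auto simp: w_def)
  define R where "R = density lborel (\<lambda>s. ennreal (w s))"
  have R: "sets R = sets borel" by (simp add: R_def)
  have R_int: "(\<integral>\<^sup>+s. f s \<partial>R) = (\<integral>\<^sup>+s. ennreal (w s) * f s \<partial>lborel)" if "f \<in> borel_measurable borel" for f
    unfolding R_def using that by (simp add: nn_integral_density)
  have R_mom: "(\<integral>\<^sup>+s. ennreal (s ^ k) \<partial>R) = ennreal (gauss_moment (2 * m + k) / gauss_moment (2 * m))" for k
  proof -
    have "ennreal (gauss_moment (2 * m)) * (\<integral>\<^sup>+s. ennreal (s ^ k) \<partial>R) = (\<integral>\<^sup>+s. gauss_weight (2 * m) s * ennreal (s ^ k) \<partial>lborel)"
      by (subst R_int, measurable, subst nn_integral_cmult[symmetric]) (auto simp: gw mult.assoc[symmetric])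
    also have "\<dots> = (\<integral>\<^sup>+s. gauss_weight (2 * m + k) s \<partial>lborel)"
    proof (rule nn_integral_cong_nonzero, goal_cases)
      case (1 s)
      then show ?case
        by (cases "0 < s") (auto simp: powr_add powr_realpow ennreal_mult'[symmetric] mult_ac)
    qed
    also have "\<dots> = ennreal (gauss_moment (2 * m) * (gauss_moment (2 * m + k) / gauss_moment (2 * m)))"
      using m g by (subst nn_integral_gauss_moment) auto
    also have "\<dots> = ennreal (gauss_moment (2 * m)) * ennreal (gauss_moment (2 * m + k) / gauss_moment (2 * m))"
      using g by (intro ennreal_mult') simp
    finally show ?thesis using g by (subst (asm) ennreal_mult_cancel_left) (auto simp: ennreal_eq_0_iff)
  qed
  interpret R: prob_space R
    using R_mom[of 0] g by (intro prob_spaceI) simp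
  have [measurable_cong]: "sets R = sets borel" by (rule R)
  have ae0: "AE s in R. 0 \<le> s"
    unfolding R_def by (subst AE_density) (auto simp: w_def split: split_indicator)
  \<comment> \<open>The radius is nonnegative, so its moments of odd order are nonzero as
    well.\<close>
  have R_pos: "(LINT s|R. s ^ k) \<noteq> 0" for k
  proof -
    have "(LINT s|R. s ^ k) = enn2real (\<integral>\<^sup>+s. ennreal (s ^ k) \<partial>R)"
      by (rule integral_eq_nn_integral) (use ae0 in \<open>auto elim!: eventually_mono\<close>)
    also have "\<dots> = gauss_moment (2 * m + k) / gauss_moment (2 * m)"
      unfolding R_mom using g gauss_moment_pos[of "2 * m + k"] m by simp
    finally show ?thesis using g gauss_moment_pos[of "2 * m + k"] m by simp
  qed
  \<comment> \<open>Stated for an arbitrary law, since it is applied once to the given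
    \<open>M\<close> and once to \<open>mu_measure m\<close>.\<close>
  have key: "(LINT s|R. s ^ k) * (LINT l|M. l ^ k) = (LINT z|?N. z ^ k)"
    if M: "real_distribution M" and
      eq: "\<And>F. F \<in> borel_measurable borel \<Longrightarrow>
      (\<integral>\<^sup>+s. gauss_weight (2 * m) s * (\<integral>\<^sup>+l. F (s * l) \<partial>M) \<partial>lborel)
      = ennreal (gauss_moment (2 * m)) * (\<integral>\<^sup>+z. F z \<partial>gauss)" for M k
  proof -
    interpret M: real_distribution M by fact
    have [measurable_cong]: "sets M = sets borel" by simp
    interpret P: pair_prob_space R M ..
    have [measurable]: "(\<lambda>(s, l). s * l) \<in> borel_measurable (R \<Otimes>\<^sub>M M)" by measurable
    have "distr (R \<Otimes>\<^sub>M M) borel (\<lambda>(s, l). s * l) = ?N"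
    proof (rule measure_eqI)
      fix A assume "A \<in> sets (distr (R \<Otimes>\<^sub>M M) borel (\<lambda>(s, l). s * l))"
      then have [measurable]: "A \<in> sets borel" by simp
      have "emeasure (distr (R \<Otimes>\<^sub>M M) borel (\<lambda>(s, l). s * l)) A = (\<integral>\<^sup>+z. indicator A z \<partial>distr (R \<Otimes>\<^sub>M M) borel (\<lambda>(s, l). s * l))"
        by simp
      also have "\<dots> = (\<integral>\<^sup>+p. indicator A (fst p * snd p) \<partial>(R \<Otimes>\<^sub>M M))"
        by (subst nn_integral_distr) (auto simp: split_beta')
      also have "\<dots> = (\<integral>\<^sup>+s. \<integral>\<^sup>+l. indicator A (s * l) \<partial>M \<partial>R)"
        by (subst M.nn_integral_fst[symmetric]) auto
      also have "\<dots> = (\<integral>\<^sup>+s. ennreal (w s) * (\<integral>\<^sup>+l. indicator A (s * l) \<partial>M) \<partial>lborel)"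
        by (rule R_int) measurable
      finally have e: "emeasure (distr (R \<Otimes>\<^sub>M M) borel (\<lambda>(s, l). s * l)) A = \<dots>" .
      have "ennreal (gauss_moment (2 * m)) * (\<integral>\<^sup>+s. ennreal (w s) * (\<integral>\<^sup>+l. indicator A (s * l) \<partial>M) \<partial>lborel)
         = ennreal (gauss_moment (2 * m)) * (\<integral>\<^sup>+z. indicator A z \<partial>?N)"
        by (subst eq[symmetric], measurable, subst nn_integral_cmult[symmetric]) (auto simp: gw mult.assoc[symmetric])
      then have "(\<integral>\<^sup>+s. ennreal (w s) * (\<integral>\<^sup>+l. indicator A (s * l) \<partial>M) \<partial>lborel) = emeasure ?N A"
        using g by (subst (asm) ennreal_mult_cancel_left) (auto simp: ennreal_eq_0_iff)
      then show "emeasure (distr (R \<Otimes>\<^sub>M M) borel (\<lambda>(s, l). s * l)) A = emeasure ?N A" unfolding e .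
    qed simp
    note d = this
    have "integrable (distr (R \<Otimes>\<^sub>M M) borel (\<lambda>(s, l). s * l)) (\<lambda>z. z ^ k)"
      unfolding d by (rule integrable_std_normal_distribution_moment)
    then have int: "integrable (R \<Otimes>\<^sub>M M) (\<lambda>p. (fst p * snd p) ^ k)"
      by (subst (asm) integrable_distr_eq) (auto simp: split_beta')
    have "(LINT z|?N. z ^ k) = (LINT p|(R \<Otimes>\<^sub>M M). (fst p * snd p) ^ k)"
      unfolding d[symmetric] by (subst integral_distr) (auto simp: split_beta')
    also have "\<dots> = (LINT s|R. LINT l|M. (s * l) ^ k)"
      using P.integral_fst'[OF int] by simp
    also have "\<dots> = (LINT s|R. s ^ k) * (LINT l|M. l ^ k)"
      by (simp add: power_mult_distrib)
    finally show ?thesis by simp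
  qed
  show ?thesis
  proof (rule real_distribution_eqI_moments[OF M real_distribution_mu_measure[OF m] bd AE_mu_measure_bounded[OF m]])
    fix k
    have "(LINT s|R. s ^ k) * (LINT l|M. l ^ k) = (LINT s|R. s ^ k) * (LINT l|mu_measure m. l ^ k)"
      using key[OF M eq, of k] key[OF real_distribution_mu_measure[OF m] mu_measure_gauss[OF _ m], of k] by simp
    then show "(LINT l|M. l ^ k) = (LINT l|mu_measure m. l ^ k)" using R_pos[of k] by simp
  qed
qed

section \<open>A Funk--Hecke formula on the ball\<close>

text \<open>Cauchy-Schwarz for (x,a) and (y,b) in one dimension more, after bounding the multipliers
  by 1 in modulus. It yields both |L| <= 1 on the ball and the bound for \<rho> on the cone.\<close>

lemma abs_bilinear_le:
  fixes x y :: "real ^ 'd" and u :: "'d \<Rightarrow> real"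
  assumes "\<And>i. \<bar>u i\<bar> \<le> 1" "\<bar>v\<bar> \<le> 1"
  shows "\<bar>(\<Sum>i\<in>UNIV. x $ i * y $ i * u i) + a * b * v\<bar> \<le> sqrt ((norm x)\<^sup>2 + a\<^sup>2) * sqrt ((norm y)\<^sup>2 + b\<^sup>2)"
proof -
  have "\<bar>(\<Sum>i\<in>UNIV. x $ i * y $ i * u i)\<bar> \<le> (\<Sum>i\<in>UNIV. \<bar>x $ i\<bar> * \<bar>y $ i\<bar>)"
    by (rule sum_abs[THEN order_trans], rule sum_mono)
       (use assms in \<open>auto simp: abs_mult intro!: mult_left_le\<close>)
  also have "\<dots> \<le> L2_set (\<lambda>i. x $ i) UNIV * L2_set (\<lambda>i. y $ i) UNIV"
    by (rule L2_set_mult_ineq)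
  also have "\<dots> = norm x * norm y" by (simp add: norm_vec_def L2_set_def)
  finally have 1: "\<bar>(\<Sum>i\<in>UNIV. x $ i * y $ i * u i)\<bar> \<le> norm x * norm y" .
  have 2: "\<bar>a * b * v\<bar> \<le> \<bar>a\<bar> * \<bar>b\<bar>"
    using assms by (auto simp: abs_mult intro!: mult_left_le)
  have "norm x * norm y + \<bar>a\<bar> * \<bar>b\<bar> \<le> sqrt ((norm x)\<^sup>2 + a\<^sup>2) * sqrt ((norm y)\<^sup>2 + b\<^sup>2)"
  proof -
    \<comment> \<open>The difference of the two sides is the square of |x||b| - |a||y|.\<close>
    have "(norm x * norm y + \<bar>a\<bar> * \<bar>b\<bar>)\<^sup>2 \<le> ((norm x)\<^sup>2 + \<bar>a\<bar>\<^sup>2) * ((norm y)\<^sup>2 + \<bar>b\<bar>\<^sup>2)"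
      using zero_le_power2[of "norm x * \<bar>b\<bar> - \<bar>a\<bar> * norm y"] by (simp only: power2_eq_square) (simp add: algebra_simps)
    then show ?thesis
      by (simp add: real_sqrt_mult[symmetric] real_le_rsqrt)
  qed
  with 1 2 show ?thesis by linarith
qed

section \<open>The cone, its weights and the cube\<close>

lemma solid_cone_iff: "z \<in> solid_cone \<longleftrightarrow> norm (fst z) \<le> snd z"
  using norm_ge_zero[of "fst z"] by (cases z) (auto simp: solid_cone_def simp del: norm_ge_zero intro: order_trans)

lemma sets_solid_cone [measurable]: "(solid_cone :: ((real ^ 'd) \<times> real) set) \<in> sets borel"
proof -
  have "closed {z :: (real ^ 'd) \<times> real. norm (fst z) \<le> snd z}"
    by (intro closed_Collect_le continuous_intros)
  moreover have "(solid_cone :: ((real ^ 'd) \<times> real) set) = {z. norm (fst z) \<le> snd z}"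
    by (auto simp: solid_cone_iff)
  ultimately show ?thesis by (simp only: borel_closed)
qed

lemma borel_measurable_dunkl_h [measurable]: "dunkl_h \<kappa> \<in> borel_measurable borel"
  unfolding dunkl_h_def[abs_def] by measurable

lemma dunkl_h_sq: "(dunkl_h \<kappa> x)\<^sup>2 = (\<Prod>i\<in>UNIV. \<bar>x $ i\<bar> powr (2 * \<kappa> $ i))"
  by (simp only: dunkl_h_def prod_power_distrib power2_eq_square mult_2 powr_add prod.distrib)

lemma dunkl_h_scaleR:
  assumes "0 < s"
  shows "dunkl_h \<kappa> (s *\<^sub>R x) = s powr (\<Sum>i\<in>UNIV. \<kappa> $ i) * dunkl_h \<kappa> x"
  using assms by (simp add: dunkl_h_def abs_mult powr_mult prod.distrib powr_sum)

lemma borel_measurable_cone_u [measurable]: "cone_u \<kappa> \<mu> \<in> borel_measurable borel"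
  unfolding cone_u_def borel_prod[symmetric] by measurable

lemma borel_measurable_cone_W [measurable]: "cone_W \<kappa> \<mu> \<in> borel_measurable borel"
  unfolding cone_W_def borel_prod[symmetric] by measurable

lemma cone_u_nonneg: "0 \<le> cone_u \<kappa> \<mu> z"
  by (simp add: cone_u_def split: prod.split)

lemma cone_W_eq: "cone_W \<kappa> \<mu> z = cone_u \<kappa> \<mu> z * exp (- snd z)"
  by (simp add: cone_W_def cone_u_def split: prod.split)

lemma sets_cube_measure [measurable_cong]:
  "sets (cube_measure \<kappa> \<mu>) = sets ((\<Pi>\<^sub>M i\<in>UNIV. borel) \<Otimes>\<^sub>M borel)"
  unfolding cube_measure_def by (intro sets_pair_measure_cong sets_PiM_kappa_measure sets_mu_measure)

lemma mult_right_commute_ennreal: "(a * b) * c = (a * c) * b" for a b c :: ennreal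
  by (simp only: mult_ac)

locale cone_weight =
  fixes \<kappa> :: "real ^ 'd" and \<mu> :: real
  assumes kappa_nonneg: "0 \<le> \<kappa> $ i" and mu_nonneg: "0 \<le> \<mu>"
begin

abbreviation "\<alpha> \<equiv> cone_alpha \<kappa> \<mu>"

abbreviation (input) "cubeM \<equiv> cube_measure \<kappa> \<mu>"

abbreviation (input) "cone_weight_at z \<equiv> ennreal (indicator solid_cone z * cone_u \<kappa> \<mu> z)"

lemma alpha_nonneg: "0 \<le> \<alpha>"
proof -
  have "1 \<le> CARD('d)" by (simp add: Suc_le_eq)
  then show ?thesis using mu_nonneg by (auto simp: cone_alpha_def intro!: add_nonneg_nonneg sum_nonneg kappa_nonneg)
qed

text \<open>The weight \<open>cone_u\<close> on the slice t = 1 of the cone.\<close>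

definition ball_weight :: "real ^ 'd \<Rightarrow> real" where
  "ball_weight x = indicator (cball 0 1) x * ((dunkl_h \<kappa> x)\<^sup>2 * (1 - (norm x)\<^sup>2) powr (\<mu> - 1/2))"

lemma borel_measurable_ball_weight [measurable]: "ball_weight \<in> borel_measurable borel"
proof -
  have [measurable]: "cball 0 1 \<in> sets (borel :: (real ^ 'd) measure)" by (intro borel_closed closed_cball)
  show ?thesis unfolding ball_weight_def[abs_def] by measurable
qed

lemma prob_space_PiM_kappa: "prob_space (\<Pi>\<^sub>M i\<in>UNIV. kappa_measure (\<kappa> $ i))"
  by (rule prob_space_PiM) (simp add: prob_space_kappa_measure kappa_nonneg)

sublocale cube: prob_space "cubeM"
proof -
  interpret K: prob_space "\<Pi>\<^sub>M i\<in>UNIV. kappa_measure (\<kappa> $ i)" by (rule prob_space_PiM_kappa)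
  interpret M: prob_space "mu_measure \<mu>" by (rule prob_space_mu_measure[OF mu_nonneg])
  interpret P: pair_prob_space "\<Pi>\<^sub>M i\<in>UNIV. kappa_measure (\<kappa> $ i)" "mu_measure \<mu>" ..
  show "prob_space (cubeM)" unfolding cube_measure_def by (rule P.prob_space_axioms)
qed

lemma AE_cube_bounded: "AE p in cubeM. (\<forall>i. \<bar>fst p i\<bar> \<le> 1) \<and> \<bar>snd p\<bar> \<le> 1"
proof -
  interpret K: prob_space "\<Pi>\<^sub>M i\<in>UNIV. kappa_measure (\<kappa> $ i)" by (rule prob_space_PiM_kappa)
  interpret M: prob_space "mu_measure \<mu>" by (rule prob_space_mu_measure[OF mu_nonneg])
  interpret P: pair_prob_space "\<Pi>\<^sub>M i\<in>UNIV. kappa_measure (\<kappa> $ i)" "mu_measure \<mu>" ..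
  have 1: "AE u in (\<Pi>\<^sub>M i\<in>UNIV. kappa_measure (\<kappa> $ i)). \<bar>u i\<bar> \<le> 1" for i
    by (rule AE_PiM_component[where P="\<lambda>x. \<bar>x\<bar> \<le> 1"]) (auto simp: prob_space_kappa_measure kappa_nonneg AE_kappa_measure_bounded)
  have 2: "AE u in (\<Pi>\<^sub>M i\<in>UNIV. kappa_measure (\<kappa> $ i)). \<forall>i. \<bar>u i\<bar> \<le> 1"
    using 1 by (simp add: AE_all_countable)
  show ?thesis unfolding cube_measure_def
  proof (rule P.AE_pair_measure)
    show "AE x in (\<Pi>\<^sub>M i\<in>UNIV. kappa_measure (\<kappa> $ i)). AE y in mu_measure \<mu>. (\<forall>i. \<bar>fst (x, y) i\<bar> \<le> 1) \<and> \<bar>snd (x, y)\<bar> \<le> 1"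
      using 2 AE_mu_measure_bounded[OF mu_nonneg] by (auto elim!: eventually_mono)
  qed measurable
qed

lemma nn_integral_cube:
  assumes [measurable]: "f \<in> borel_measurable ((\<Pi>\<^sub>M i\<in>UNIV. borel) \<Otimes>\<^sub>M borel)"
  shows "(\<integral>\<^sup>+p. f p \<partial>cubeM) = (\<integral>\<^sup>+u. \<integral>\<^sup>+v. f (u, v) \<partial>mu_measure \<mu> \<partial>(\<Pi>\<^sub>M i\<in>UNIV. kappa_measure (\<kappa> $ i)))"
proof -
  interpret M: prob_space "mu_measure \<mu>" by (rule prob_space_mu_measure[OF mu_nonneg])
  show ?thesis unfolding cube_measure_def
    by (rule M.nn_integral_fst[symmetric]) measurable
qed

text \<open>\<open>cone_u\<close> is homogeneous of degree 2|\<kappa>| + 2\<mu> - 1 = 2\<alpha> - d,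
  and the slice at height s is the unit ball scaled by s, with Jacobian s^d; together they give
  s^(2\<alpha>).\<close>

lemma nn_integral_cone_polar:
  fixes \<Phi> :: "(real ^ 'd) \<times> real \<Rightarrow> ennreal"
  assumes [measurable]: "\<Phi> \<in> borel_measurable borel"
  shows "(\<integral>\<^sup>+z. \<Phi> z * cone_weight_at z \<partial>lborel)
    = (\<integral>\<^sup>+s. power_weight (2 * \<alpha>) s * (\<integral>\<^sup>+x. \<Phi> (s *\<^sub>R x, s) * ennreal (ball_weight x) \<partial>lborel) \<partial>lborel)"
proof -
  let ?f = "\<lambda>z. \<Phi> z * cone_weight_at z"
  have f[measurable]: "?f \<in> borel_measurable (borel \<Otimes>\<^sub>M borel)" unfolding borel_prod by measurable
  have \<Phi>[measurable]: "\<Phi> \<in> borel_measurable (borel \<Otimes>\<^sub>M borel)" unfolding borel_prod by measurable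
  have "(\<integral>\<^sup>+z. ?f z \<partial>lborel) = (\<integral>\<^sup>+s. \<integral>\<^sup>+y. ?f (y, s) \<partial>lborel \<partial>lborel)"
    unfolding lborel_prod[symmetric] by (rule lborel_pair.nn_integral_snd[symmetric]) (use f in simp)
  also have "\<dots> = (\<integral>\<^sup>+s. power_weight (2 * \<alpha>) s * (\<integral>\<^sup>+x. \<Phi> (s *\<^sub>R x, s) * ennreal (ball_weight x) \<partial>lborel) \<partial>lborel)"
  proof (rule nn_integral_cong_nonzero, goal_cases)
    case (1 s)
    show ?case
    proof (cases "0 < s")
      case True
      have "(\<integral>\<^sup>+y. ?f (y, s) \<partial>lborel) = ennreal (s ^ CARD('d)) * (\<integral>\<^sup>+x. ?f (s *\<^sub>R x, s) \<partial>lborel)"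
        using True by (subst nn_integral_lborel_scaleR[where c=s]) auto
      also have "(\<integral>\<^sup>+x. ?f (s *\<^sub>R x, s) \<partial>lborel) = (\<integral>\<^sup>+x. ennreal (s powr (2 * \<alpha> - CARD('d))) * (\<Phi> (s *\<^sub>R x, s) * ennreal (ball_weight x)) \<partial>lborel)"
      proof (rule nn_integral_cong)
        fix x :: "real ^ 'd"
        have c: "(s *\<^sub>R x, s) \<in> solid_cone \<longleftrightarrow> x \<in> cball 0 1"
          using True by (simp add: solid_cone_iff)
        have "indicator solid_cone (s *\<^sub>R x, s) * cone_u \<kappa> \<mu> (s *\<^sub>R x, s) = s powr (2 * \<alpha> - CARD('d)) * ball_weight x"
        proof (cases "x \<in> cball 0 1")
          case x: True
          have n: "0 \<le> 1 - (norm x)\<^sup>2" using x by (simp add: power_le_one)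
          have "(s\<^sup>2 - (norm (s *\<^sub>R x))\<^sup>2) = s powr 2 * (1 - (norm x)\<^sup>2)"
            using True by (simp add: power_mult_distrib algebra_simps)
          then have "(s\<^sup>2 - (norm (s *\<^sub>R x))\<^sup>2) powr (\<mu> - 1/2) = s powr (2 * (\<mu> - 1/2)) * (1 - (norm x)\<^sup>2) powr (\<mu> - 1/2)"
            using n True by (simp only: powr_mult powr_ge_zero powr_powr)
          moreover have "(dunkl_h \<kappa> (s *\<^sub>R x))\<^sup>2 = s powr (2 * (\<Sum>i\<in>UNIV. \<kappa> $ i)) * (dunkl_h \<kappa> x)\<^sup>2"
            using True by (simp only: dunkl_h_scaleR power_mult_distrib power2_eq_square mult_2 powr_add mult_ac)
          moreover have "s powr (2 * \<alpha> - CARD('d)) = s powr (2 * (\<Sum>i\<in>UNIV. \<kappa> $ i)) * s powr (2 * (\<mu> - 1/2))"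
          proof -
            have "2 * \<alpha> - CARD('d) = 2 * (\<Sum>i\<in>UNIV. \<kappa> $ i) + 2 * (\<mu> - 1/2)"
              by (simp add: cone_alpha_def field_simps)
            then show ?thesis by (simp only: powr_add)
          qed
          ultimately show ?thesis using x by (simp add: c cone_u_def ball_weight_def)
        next
          case False then show ?thesis by (simp add: c ball_weight_def)
        qed
        then show "?f (s *\<^sub>R x, s) = ennreal (s powr (2 * \<alpha> - CARD('d))) * (\<Phi> (s *\<^sub>R x, s) * ennreal (ball_weight x))"
          by (simp only: ennreal_mult'[OF powr_ge_zero] mult.left_commute)
      qed
      also have "\<dots> = ennreal (s powr (2 * \<alpha> - CARD('d))) * (\<integral>\<^sup>+x. \<Phi> (s *\<^sub>R x, s) * ennreal (ball_weight x) \<partial>lborel)"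
        by (rule nn_integral_cmult) measurable
      also have "ennreal (s ^ CARD('d)) * \<dots> = ennreal (s ^ CARD('d) * s powr (2 * \<alpha> - CARD('d))) * (\<integral>\<^sup>+x. \<Phi> (s *\<^sub>R x, s) * ennreal (ball_weight x) \<partial>lborel)"
        using True by (simp add: ennreal_mult' mult.assoc)
      also have "s ^ CARD('d) * s powr (2 * \<alpha> - CARD('d)) = s powr (2 * \<alpha>)"
        using True by (simp add: powr_realpow[symmetric] powr_add[symmetric])
      finally show ?thesis using True by simp
    next
      case False
      then have "s < 0" using \<open>s \<noteq> 0\<close> by simp
      then have "(y, s) \<notin> solid_cone" for y :: "real ^ 'd" by (simp add: solid_cone_def)
      then show ?thesis using \<open>s < 0\<close> by simp
    qed
  qed
  finally show ?thesis .
qed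

definition gauss_mass :: real where
  "gauss_mass = (\<Prod>i\<in>UNIV. 2 * gauss_moment (2 * \<kappa> $ i)) * gauss_moment (2 * \<mu>)"

text \<open>This will be the integral of \<open>ball_weight\<close>. It has the form of a quotient
  because it is obtained from a Gaussian integral over the cone by splitting off the radial
  moment.\<close>

definition ball_mass :: real where
  "ball_mass = gauss_mass / gauss_moment (2 * (\<alpha> + 1/2))"

lemma gauss_mass_pos: "0 < gauss_mass"
  unfolding gauss_mass_def
  by (intro mult_pos_pos prod_pos ballI gauss_moment_pos) (simp_all add: kappa_nonneg mu_nonneg)

lemma ball_mass_pos: "0 < ball_mass"
  unfolding ball_mass_def using alpha_nonneg
  by (intro divide_pos_pos gauss_mass_pos gauss_moment_pos) simp

text \<open>For \<open>z = (t *\<^sub>R x, t)\<close> and \<open>w = (s *\<^sub>R y, s)\<close> in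
  the cone, with \<open>a\<close> completing \<open>x\<close> to the unit vector attached to z, the
  radicand of \<open>cone_rho\<close> is ts(1 + \<open>ball_form x a y p\<close>)/2.\<close>

definition ball_form :: "real ^ 'd \<Rightarrow> real \<Rightarrow> real ^ 'd \<Rightarrow> ('d \<Rightarrow> real) \<times> real \<Rightarrow> real" where
  "ball_form x a y p = (\<Sum>i\<in>UNIV. x $ i * y $ i * fst p i) + a * sqrt (1 - (norm y)\<^sup>2) * snd p"

lemma borel_measurable_ball_form [measurable]:
  "(\<lambda>(y, p). ball_form x a y p) \<in> borel_measurable (borel \<Otimes>\<^sub>M ((\<Pi>\<^sub>M i\<in>UNIV. borel) \<Otimes>\<^sub>M borel))"
  unfolding ball_form_def by measurable

text \<open>In Cartesian coordinates, with \<open>q = sqrt (s\<^sup>2 - \<bar>y\<bar>\<^sup>2)\<close> as an additional coordinate, the measure on the cone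
  becomes a product measure.\<close>

lemma ball_form_gauss:
  assumes F[measurable]: "F \<in> borel_measurable borel" and X: "(norm x)\<^sup>2 + a\<^sup>2 = 1"
  shows "(\<integral>\<^sup>+s. gauss_weight (2 * (\<alpha> + 1/2)) s *
     (\<integral>\<^sup>+y. ennreal (ball_weight y) * (\<integral>\<^sup>+p. F (s * ball_form x a y p) \<partial>cubeM) \<partial>lborel) \<partial>lborel)
   = ennreal gauss_mass * (\<integral>\<^sup>+z. F z \<partial>gauss)"
    (is "?LHS = _")
proof -
  let ?N = gauss
  let ?K = "\<Pi>\<^sub>M i\<in>UNIV. kappa_measure (\<kappa> $ i)"
  interpret K: prob_space ?K by (rule prob_space_PiM_kappa)
  interpret M: prob_space "mu_measure \<mu>" by (rule prob_space_mu_measure[OF mu_nonneg])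
  interpret KL: pair_sigma_finite ?K "lborel :: real measure" ..
  interpret N: real_distribution ?N by (rule real_dist_normal_dist)
  \<comment> \<open>The exponent 2\<alpha> + 1 of the radial weight is split: s^(2\<alpha>) is what
    polar decomposition of the cone supplies, the remaining s goes into \<open>\<Phi>\<close>. The
    left-hand side is thus an integral over the cone.\<close>
  define \<Phi> where "\<Phi> = (\<lambda>z. ennreal (indicator {0..} (snd z) * (snd z * exp (- (snd z)\<^sup>2 / 2))) *
     (\<integral>\<^sup>+p. F ((\<Sum>i\<in>UNIV. x $ i * fst z $ i * fst p i) + a * sqrt ((snd z)\<^sup>2 - (norm (fst z))\<^sup>2) * snd p) \<partial>cubeM))"
  have \<Phi>[measurable]: "\<Phi> \<in> borel_measurable (borel \<Otimes>\<^sub>M borel)" unfolding \<Phi>_def by measurable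
  have \<Phi>'[measurable]: "\<Phi> \<in> borel_measurable borel" unfolding borel_prod[symmetric] by (rule \<Phi>)
  have "?LHS = (\<integral>\<^sup>+s. power_weight (2 * \<alpha>) s * (\<integral>\<^sup>+y. \<Phi> (s *\<^sub>R y, s) * ennreal (ball_weight y) \<partial>lborel) \<partial>lborel)"
  proof (rule nn_integral_cong_nonzero, goal_cases)
    case (1 s)
    show ?case
    proof (cases "0 < s")
      case True
      have "(\<integral>\<^sup>+y. \<Phi> (s *\<^sub>R y, s) * ennreal (ball_weight y) \<partial>lborel)
        = (\<integral>\<^sup>+y. ennreal (s * exp (- s\<^sup>2 / 2)) * (ennreal (ball_weight y) * (\<integral>\<^sup>+p. F (s * ball_form x a y p) \<partial>cubeM)) \<partial>lborel)"
      proof (rule nn_integral_cong)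
        fix y :: "real ^ 'd"
        have "sqrt (s\<^sup>2 - (norm (s *\<^sub>R y))\<^sup>2) = s * sqrt (1 - (norm y)\<^sup>2)"
        proof -
          have "s\<^sup>2 - (norm (s *\<^sub>R y))\<^sup>2 = s\<^sup>2 * (1 - (norm y)\<^sup>2)"
            using True by (simp add: power_mult_distrib algebra_simps)
          then show ?thesis using True by (simp add: real_sqrt_mult)
        qed
        then have "(\<Sum>i\<in>UNIV. x $ i * (s *\<^sub>R y) $ i * fst p i) + a * sqrt (s\<^sup>2 - (norm (s *\<^sub>R y))\<^sup>2) * snd p = s * ball_form x a y p" for p
          by (simp add: ball_form_def sum_distrib_left algebra_simps)
        then have "\<Phi> (s *\<^sub>R y, s) = ennreal (s * exp (- s\<^sup>2 / 2)) * (\<integral>\<^sup>+p. F (s * ball_form x a y p) \<partial>cubeM)"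
          using True unfolding \<Phi>_def fst_conv snd_conv by simp
        then show "\<Phi> (s *\<^sub>R y, s) * ennreal (ball_weight y) = ennreal (s * exp (- s\<^sup>2 / 2)) * (ennreal (ball_weight y) * (\<integral>\<^sup>+p. F (s * ball_form x a y p) \<partial>cubeM))"
          by (simp only: mult_ac)
      qed
      also have "\<dots> = ennreal (s * exp (- s\<^sup>2 / 2)) * (\<integral>\<^sup>+y. ennreal (ball_weight y) * (\<integral>\<^sup>+p. F (s * ball_form x a y p) \<partial>cubeM) \<partial>lborel)"
        by (rule nn_integral_cmult) measurable
      finally have e: "(\<integral>\<^sup>+y. \<Phi> (s *\<^sub>R y, s) * ennreal (ball_weight y) \<partial>lborel) = \<dots>" .
      have "s powr (2 * (\<alpha> + 1/2)) = s powr (2 * \<alpha>) * s"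
      proof -
        have "2 * (\<alpha> + 1/2) = 2 * \<alpha> + 1" by simp
        then show ?thesis using True by (simp only: powr_add) simp
      qed
      then have "ennreal (s powr (2 * (\<alpha> + 1/2)) * exp (- s\<^sup>2 / 2)) = ennreal (s powr (2 * \<alpha>)) * ennreal (s * exp (- s\<^sup>2 / 2))"
        using True by (subst ennreal_mult'[symmetric]) (auto simp: mult.assoc)
      then show ?thesis unfolding e using True by (simp add: mult.assoc)
    qed (use \<open>s \<noteq> 0\<close> in simp)
  qed
  also have "\<dots> = (\<integral>\<^sup>+z. \<Phi> z * cone_weight_at z \<partial>lborel)"
    by (rule nn_integral_cone_polar[symmetric]) measurable
  \<comment> \<open>Now the height s is integrated first, for fixed y, so that q = sqrt(s^2 - |y|^2)
    can replace it; the weight exp(-s^2/2) then splits over q and the coordinates of y.\<close>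
  also have "\<dots> = (\<integral>\<^sup>+y. \<integral>\<^sup>+s. \<Phi> (y, s) * cone_weight_at (y, s) \<partial>lborel \<partial>lborel)"
  proof -
    have "(\<lambda>z. \<Phi> z * cone_weight_at z) \<in> borel_measurable (borel \<Otimes>\<^sub>M borel)"
      unfolding borel_prod by measurable
    then show ?thesis
      unfolding lborel_prod[symmetric] by (intro lborel.nn_integral_fst[symmetric]) simp
  qed
  also have "\<dots> = (\<integral>\<^sup>+y. (\<Prod>i\<in>UNIV. ennreal (\<bar>y $ i\<bar> powr (2 * \<kappa> $ i) * exp (- (y $ i)\<^sup>2 / 2)))
     * (\<integral>\<^sup>+u. (\<integral>\<^sup>+z. ennreal (gauss_moment (2 * \<mu>)) * F ((\<Sum>i\<in>UNIV. x $ i * (y $ i * u i)) + a * z) \<partial>?N) \<partial>?K) \<partial>lborel)"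
  proof (rule nn_integral_cong, goal_cases)
    case (1 y)
    let ?H = "\<lambda>q. \<integral>\<^sup>+p. F ((\<Sum>i\<in>UNIV. x $ i * y $ i * fst p i) + a * q * snd p) \<partial>cubeM"
    let ?w = "\<lambda>q. gauss_weight (2 * \<mu>) q"
    have "(\<integral>\<^sup>+s. \<Phi> (y, s) * cone_weight_at (y, s) \<partial>lborel)
      = (\<integral>\<^sup>+s. ennreal ((dunkl_h \<kappa> y)\<^sup>2) * (ennreal (indicator {norm y..} s * (s * exp (- s\<^sup>2 / 2) * (s\<^sup>2 - (norm y)\<^sup>2) powr (\<mu> - 1/2))) * ?H (sqrt (s\<^sup>2 - (norm y)\<^sup>2))) \<partial>lborel)"
    proof (rule nn_integral_cong)
      fix s :: real
      show "\<Phi> (y, s) * cone_weight_at (y, s)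
        = ennreal ((dunkl_h \<kappa> y)\<^sup>2) * (ennreal (indicator {norm y..} s * (s * exp (- s\<^sup>2 / 2) * (s\<^sup>2 - (norm y)\<^sup>2) powr (\<mu> - 1/2))) * ?H (sqrt (s\<^sup>2 - (norm y)\<^sup>2)))"
      proof (cases "norm y \<le> s")
        case True
        then have s: "0 \<le> s" using norm_ge_zero[of y] by linarith
        have "ennreal (s * exp (- s\<^sup>2 / 2)) * ennreal (cone_u \<kappa> \<mu> (y, s)) = ennreal ((dunkl_h \<kappa> y)\<^sup>2) * ennreal (s * exp (- s\<^sup>2 / 2) * (s\<^sup>2 - (norm y)\<^sup>2) powr (\<mu> - 1/2))"
          using s by (simp add: ennreal_mult'[symmetric] cone_u_def mult_ac)
        note e = this
        have p: "\<Phi> (y, s) = ennreal (s * exp (- s\<^sup>2 / 2)) * ?H (sqrt (s\<^sup>2 - (norm y)\<^sup>2))"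
          using s unfolding \<Phi>_def by simp
        have "\<Phi> (y, s) * ennreal (cone_u \<kappa> \<mu> (y, s)) = (ennreal (s * exp (- s\<^sup>2 / 2)) * ennreal (cone_u \<kappa> \<mu> (y, s))) * ?H (sqrt (s\<^sup>2 - (norm y)\<^sup>2))"
          unfolding p by (rule mult_right_commute_ennreal)
        also note e
        finally have "\<Phi> (y, s) * ennreal (cone_u \<kappa> \<mu> (y, s)) = ennreal ((dunkl_h \<kappa> y)\<^sup>2) * ennreal (s * exp (- s\<^sup>2 / 2) * (s\<^sup>2 - (norm y)\<^sup>2) powr (\<mu> - 1/2)) * ?H (sqrt (s\<^sup>2 - (norm y)\<^sup>2))" .
        then show ?thesis using True by (simp add: solid_cone_iff mult.assoc)
      qed (simp add: solid_cone_iff)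
    qed
    also have "\<dots> = ennreal ((dunkl_h \<kappa> y)\<^sup>2) * (\<integral>\<^sup>+s. ennreal (indicator {norm y..} s * (s * exp (- s\<^sup>2 / 2) * (s\<^sup>2 - (norm y)\<^sup>2) powr (\<mu> - 1/2))) * ?H (sqrt (s\<^sup>2 - (norm y)\<^sup>2)) \<partial>lborel)"
      by (rule nn_integral_cmult) measurable
    also have "\<dots> = ennreal ((dunkl_h \<kappa> y)\<^sup>2) * (ennreal (exp (- (norm y)\<^sup>2 / 2)) * (\<integral>\<^sup>+q. ?w q * ?H q \<partial>lborel))"
      by (subst nn_integral_gauss_radial) auto
    also have "\<dots> = ennreal ((dunkl_h \<kappa> y)\<^sup>2 * exp (- (norm y)\<^sup>2 / 2)) * (\<integral>\<^sup>+q. ?w q * ?H q \<partial>lborel)"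
      by (simp add: ennreal_mult' mult.assoc)
    also have "(dunkl_h \<kappa> y)\<^sup>2 * exp (- (norm y)\<^sup>2 / 2) = (\<Prod>i\<in>UNIV. \<bar>y $ i\<bar> powr (2 * \<kappa> $ i) * exp (- (y $ i)\<^sup>2 / 2))"
      by (simp add: dunkl_h_sq prod.distrib norm_vec_def L2_set_def sum_nonneg exp_sum[symmetric] sum_negf sum_divide_distrib)
    also have "ennreal \<dots> = (\<Prod>i\<in>UNIV. ennreal (\<bar>y $ i\<bar> powr (2 * \<kappa> $ i) * exp (- (y $ i)\<^sup>2 / 2)))"
      by (rule prod_ennreal[symmetric]) simp
    also have "(\<integral>\<^sup>+q. ?w q * ?H q \<partial>lborel) = (\<integral>\<^sup>+q. (\<integral>\<^sup>+u. ?w q * (\<integral>\<^sup>+v. F ((\<Sum>i\<in>UNIV. x $ i * (y $ i * u i)) + a * (q * v)) \<partial>mu_measure \<mu>) \<partial>?K) \<partial>lborel)"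
    proof (rule nn_integral_cong)
      fix q :: real
      have "?H q = (\<integral>\<^sup>+u. \<integral>\<^sup>+v. F ((\<Sum>i\<in>UNIV. x $ i * (y $ i * u i)) + a * (q * v)) \<partial>mu_measure \<mu> \<partial>?K)"
        by (subst nn_integral_cube) (auto simp: mult.assoc)
      then show "?w q * ?H q = (\<integral>\<^sup>+u. ?w q * (\<integral>\<^sup>+v. F ((\<Sum>i\<in>UNIV. x $ i * (y $ i * u i)) + a * (q * v)) \<partial>mu_measure \<mu>) \<partial>?K)"
        by (simp only:) (rule nn_integral_cmult[symmetric], measurable)
    qed
    \<comment> \<open>Exchanging u and q brings q next to v, where \<open>mu_measure_gauss\<close>
      merges the product q v into one normal variable.\<close>
    also have "\<dots> = (\<integral>\<^sup>+u. (\<integral>\<^sup>+q. ?w q * (\<integral>\<^sup>+v. F ((\<Sum>i\<in>UNIV. x $ i * (y $ i * u i)) + a * (q * v)) \<partial>mu_measure \<mu>) \<partial>lborel) \<partial>?K)"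
      by (rule KL.Fubini') measurable
    also have "\<dots> = (\<integral>\<^sup>+u. (\<integral>\<^sup>+z. ennreal (gauss_moment (2 * \<mu>)) * F ((\<Sum>i\<in>UNIV. x $ i * (y $ i * u i)) + a * z) \<partial>?N) \<partial>?K)"
    proof (rule nn_integral_cong)
      fix u :: "'d \<Rightarrow> real"
      have "(\<integral>\<^sup>+q. ?w q * (\<integral>\<^sup>+v. F ((\<Sum>i\<in>UNIV. x $ i * (y $ i * u i)) + a * (q * v)) \<partial>mu_measure \<mu>) \<partial>lborel)
         = ennreal (gauss_moment (2 * \<mu>)) * (\<integral>\<^sup>+z. F ((\<Sum>i\<in>UNIV. x $ i * (y $ i * u i)) + a * z) \<partial>?N)"
        using mu_nonneg by (intro mu_measure_gauss[where F="\<lambda>r. F (_ + a * r)"]) auto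
      also have "\<dots> = (\<integral>\<^sup>+z. ennreal (gauss_moment (2 * \<mu>)) * F ((\<Sum>i\<in>UNIV. x $ i * (y $ i * u i)) + a * z) \<partial>?N)"
        by (rule nn_integral_cmult[symmetric]) measurable
      finally show "(\<integral>\<^sup>+q. ?w q * (\<integral>\<^sup>+v. F ((\<Sum>i\<in>UNIV. x $ i * (y $ i * u i)) + a * (q * v)) \<partial>mu_measure \<mu>) \<partial>lborel) = \<dots>" .
    qed
    finally show ?case .
  qed
  \<comment> \<open>As a product of one-dimensional measures the y-integral can be joined with u
    coordinate by coordinate, each y_i u_i becoming a normal variable.\<close>
  also have "\<dots> = (\<integral>\<^sup>+y. (\<Prod>i\<in>UNIV. ennreal (\<bar>y i\<bar> powr (2 * \<kappa> $ i) * exp (- (y i)\<^sup>2 / 2)))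
     * (\<integral>\<^sup>+u. (\<integral>\<^sup>+z. ennreal (gauss_moment (2 * \<mu>)) * F ((\<Sum>i\<in>UNIV. x $ i * (y i * u i)) + a * z) \<partial>?N) \<partial>?K) \<partial>(\<Pi>\<^sub>M i\<in>UNIV. lborel))"
    by (subst nn_integral_lborel_vec) auto
  also have "\<dots> = ennreal (\<Prod>i\<in>UNIV. 2 * gauss_moment (2 * \<kappa> $ i)) *
     (\<integral>\<^sup>+y. (\<integral>\<^sup>+z. ennreal (gauss_moment (2 * \<mu>)) * F ((\<Sum>i\<in>UNIV. x $ i * y i) + a * z) \<partial>?N) \<partial>(\<Pi>\<^sub>M i\<in>UNIV. ?N))"
    by (rule PiM_kappa_measure_gauss[where F="\<lambda>y. \<integral>\<^sup>+z. ennreal (gauss_moment (2 * \<mu>)) * F ((\<Sum>i\<in>UNIV. x $ i * y i) + a * z) \<partial>?N"])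
       (rule kappa_nonneg, measurable)
  also have "(\<integral>\<^sup>+y. (\<integral>\<^sup>+z. ennreal (gauss_moment (2 * \<mu>)) * F ((\<Sum>i\<in>UNIV. x $ i * y i) + a * z) \<partial>?N) \<partial>(\<Pi>\<^sub>M i\<in>UNIV. ?N))
     = (\<integral>\<^sup>+p. ennreal (gauss_moment (2 * \<mu>)) * F ((\<Sum>i\<in>UNIV. x $ i * fst p i) + a * snd p) \<partial>((\<Pi>\<^sub>M i\<in>UNIV. ?N) \<Otimes>\<^sub>M ?N))"
    by (subst N.nn_integral_fst[symmetric]) auto
  also have "\<dots> = ennreal (gauss_moment (2 * \<mu>)) * (\<integral>\<^sup>+p. F ((\<Sum>i\<in>UNIV. x $ i * fst p i) + a * snd p) \<partial>((\<Pi>\<^sub>M i\<in>UNIV. ?N) \<Otimes>\<^sub>M ?N))"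
    by (rule nn_integral_cmult) measurable
  \<comment> \<open>This is the point at which the dependence on (x,a) disappears.\<close>
  also have "(\<integral>\<^sup>+p. F ((\<Sum>i\<in>UNIV. x $ i * fst p i) + a * snd p) \<partial>((\<Pi>\<^sub>M i\<in>UNIV. ?N) \<Otimes>\<^sub>M ?N)) = (\<integral>\<^sup>+z. F z \<partial>?N)"
  proof -
    have X': "(\<Sum>i\<in>UNIV. (x $ i)\<^sup>2) + a\<^sup>2 = 1" using X by (simp add: norm_vec_def L2_set_def sum_nonneg)
    show ?thesis
      by (subst (3) PiM_std_normal_linear[OF X', symmetric], subst nn_integral_distr) (auto simp: split_beta')
  qed
  finally show ?thesis
    unfolding gauss_mass_def using gauss_moment_pos[of "2 * \<mu>"] mu_nonneg
    by (simp add: ennreal_mult'' mult.assoc)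
qed

end

section \<open>The kernel of the translation\<close>

text \<open>The variable \<open>c\<close> stands for cos \<theta>; for \<alpha> > 0 its law under
  the normalized density sin^(2\<alpha>-1) is \<open>mu_measure \<alpha>\<close>. Values in
  \<open>ennreal\<close> let Tonelli be applied before any integrability is known.\<close>

definition cone_kernel :: "real ^ 'd \<Rightarrow> real \<Rightarrow> (real \<Rightarrow> ennreal) \<Rightarrow> (real ^ 'd) \<times> real \<Rightarrow> (real ^ 'd) \<times> real \<Rightarrow> ennreal" where
  "cone_kernel \<kappa> \<mu> G z w =
     (\<integral>\<^sup>+p. \<integral>\<^sup>+c. G (snd z + snd w + 2 * cone_rho z w p * c) \<partial>mu_measure (cone_alpha \<kappa> \<mu>) \<partial>cube_measure \<kappa> \<mu>)"

lemma cone_rho_commute: "cone_rho z w p = cone_rho w z p"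
  by (cases z, cases w, cases p) (simp add: cone_rho_def mult_ac)

lemma cone_kernel_commute: "cone_kernel \<kappa> \<mu> G z w = cone_kernel \<kappa> \<mu> G w z"
  by (simp add: cone_kernel_def cone_rho_commute[of z w] add.commute)

lemma cone_rho_eq:
  "cone_rho z w p = sqrt ((snd z * snd w + (\<Sum>i\<in>UNIV. fst z $ i * fst w $ i * fst p i)
     + sqrt ((snd z)\<^sup>2 - (norm (fst z))\<^sup>2) * sqrt ((snd w)\<^sup>2 - (norm (fst w))\<^sup>2) * snd p) / 2)"
  by (cases z, cases w, cases p) (simp add: cone_rho_def)

lemma borel_measurable_cone_rho_pair:
  "(\<lambda>x. cone_rho (fst (fst x)) (snd (fst x)) (snd x)) \<in>
     borel_measurable (((borel \<Otimes>\<^sub>M borel) \<Otimes>\<^sub>M (borel \<Otimes>\<^sub>M borel)) \<Otimes>\<^sub>M ((\<Pi>\<^sub>M i\<in>UNIV. borel) \<Otimes>\<^sub>M borel))"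
  unfolding cone_rho_eq by measurable

lemma borel_measurable_cone_rho [measurable (raw)]:
  assumes "f \<in> measurable M borel" "g \<in> measurable M borel" "h \<in> measurable M ((\<Pi>\<^sub>M i\<in>UNIV. borel) \<Otimes>\<^sub>M borel)"
  shows "(\<lambda>x. cone_rho (f x) (g x) (h x)) \<in> borel_measurable M"
proof -
  have "(\<lambda>x. ((f x, g x), h x)) \<in> measurable M (((borel \<Otimes>\<^sub>M borel) \<Otimes>\<^sub>M (borel \<Otimes>\<^sub>M borel)) \<Otimes>\<^sub>M ((\<Pi>\<^sub>M i\<in>UNIV. borel) \<Otimes>\<^sub>M borel))"
    using assms by (intro measurable_Pair) (simp_all add: borel_prod)
  from measurable_compose[OF this borel_measurable_cone_rho_pair] show ?thesis by simp
qed

lemma borel_measurable_snd' [measurable (raw)]: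
  fixes f :: "'a \<Rightarrow> ('b::second_countable_topology) \<times> real"
  assumes "f \<in> measurable M borel"
  shows "(\<lambda>x. snd (f x)) \<in> borel_measurable M"
  using assms by (rule measurable_compose) (auto intro!: borel_measurable_continuous_onI continuous_intros)

context cone_weight
begin

text \<open>For \<open>F = 1\<close> and the unit vector (0,1) the inner integral in
  \<open>ball_form_gauss\<close> is constant in s, so the radial moment factors out and can be
  divided by.\<close>

lemma nn_integral_ball_weight: "(\<integral>\<^sup>+y. ennreal (ball_weight y) \<partial>lborel) = ennreal ball_mass"
proof -
  let ?B = "\<integral>\<^sup>+y. ennreal (ball_weight y) \<partial>lborel"
  let ?g = "gauss_moment (2 * (\<alpha> + 1/2))"
  interpret N: real_distribution gauss by (rule real_dist_normal_dist)
  have g: "0 < ?g" using alpha_nonneg by (intro gauss_moment_pos) simp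
  have "ennreal gauss_mass = (\<integral>\<^sup>+s. gauss_weight (2 * (\<alpha> + 1/2)) s * ?B \<partial>lborel)"
    using ball_form_gauss[of "\<lambda>_. 1" 0 1] N.emeasure_space_1 by (simp add: cube.emeasure_space_1)
  also have "\<dots> = (\<integral>\<^sup>+s. gauss_weight (2 * (\<alpha> + 1/2)) s \<partial>lborel) * ?B"
    by (rule nn_integral_multc) measurable
  also have "\<dots> = ennreal ?g * ?B"
    using alpha_nonneg by (subst nn_integral_gauss_moment) auto
  finally have "ennreal ?g * ?B = ennreal ?g * ennreal ball_mass"
    using g gauss_mass_pos by (simp add: ball_mass_def ennreal_mult'[symmetric])
  then show ?thesis using g by (subst (asm) ennreal_mult_cancel_left) (auto simp: ennreal_eq_0_iff)
qed

lemma abs_ball_form_le: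
  assumes "(norm x)\<^sup>2 + a\<^sup>2 = 1" "norm y \<le> 1" "\<And>i. \<bar>fst p i\<bar> \<le> 1" "\<bar>snd p\<bar> \<le> 1"
  shows "\<bar>ball_form x a y p\<bar> \<le> 1"
proof -
  have "\<bar>ball_form x a y p\<bar> \<le> sqrt ((norm x)\<^sup>2 + a\<^sup>2) * sqrt ((norm y)\<^sup>2 + (sqrt (1 - (norm y)\<^sup>2))\<^sup>2)"
    unfolding ball_form_def by (rule abs_bilinear_le) (use assms in auto)
  also have "\<dots> = 1" using assms by (simp add: power_le_one)
  finally show ?thesis .
qed

text \<open>After division by \<open>ball_mass\<close> the weight is a probability law
  \<open>D\<close>, and \<open>ball_form\<close> pushes \<open>D\<close> times the cube measure to a
  law on [-1,1]. By \<open>ball_form_gauss\<close> a radius turns this law into a Gaussian one,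
  which characterizes it.\<close>

lemma funk_hecke:
  assumes F[measurable]: "F \<in> borel_measurable borel" and X: "(norm x)\<^sup>2 + a\<^sup>2 = 1"
  shows "(\<integral>\<^sup>+y. ennreal (ball_weight y) * (\<integral>\<^sup>+p. F (ball_form x a y p) \<partial>cubeM) \<partial>lborel)
    = ennreal ball_mass * (\<integral>\<^sup>+l. F l \<partial>mu_measure (\<alpha> + 1/2))"
proof -
  define D where "D = density lborel (\<lambda>y. ennreal (ball_weight y / ball_mass))"
  have [measurable_cong]: "sets D = sets borel" by (simp add: D_def)
  have bw: "ennreal ball_mass * ennreal (ball_weight y / ball_mass) = ennreal (ball_weight y)" for y
    using ball_mass_pos by (subst ennreal_mult'[symmetric]) auto
  have D_int: "ennreal ball_mass * (\<integral>\<^sup>+y. f y \<partial>D) = (\<integral>\<^sup>+y. ennreal (ball_weight y) * f y \<partial>lborel)"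
    if [measurable]: "f \<in> borel_measurable borel" for f
    unfolding D_def
    by (subst nn_integral_density, measurable, subst nn_integral_cmult[symmetric]) (auto simp: bw mult.assoc[symmetric])
  interpret D: prob_space D
  proof
    have "ennreal ball_mass * emeasure D (space D) = ennreal ball_mass * 1"
      using D_int[of "\<lambda>_. 1"] nn_integral_ball_weight by simp
    then show "emeasure D (space D) = 1"
      using ball_mass_pos by (subst (asm) ennreal_mult_cancel_left) (auto simp: ennreal_eq_0_iff)
  qed
  interpret P: pair_prob_space D "cubeM" ..
  let ?P = "D \<Otimes>\<^sub>M cubeM" and ?h = "\<lambda>(y, p). ball_form x a y p"
  have h[measurable]: "?h \<in> borel_measurable ?P" by measurable
  let ?M = "distr ?P borel ?h"
  interpret M: prob_space ?M by (rule P.prob_space_distr) simp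
  have rd: "real_distribution ?M"
    by (simp add: real_distribution_def real_distribution_axioms_def M.prob_space_axioms)
  have M_int: "(\<integral>\<^sup>+l. f l \<partial>?M) = (\<integral>\<^sup>+y. (\<integral>\<^sup>+p. f (ball_form x a y p) \<partial>cubeM) \<partial>D)"
    if [measurable]: "f \<in> borel_measurable borel" for f
    by (subst nn_integral_distr, measurable, subst cube.nn_integral_fst[symmetric]) auto
  have AE_D: "AE y in D. norm y \<le> 1"
    unfolding D_def
    by (subst AE_density, measurable, rule AE_I2) (auto simp: ball_weight_def split: split_indicator)
  have "AE q in ?P. \<bar>?h q\<bar> \<le> 1"
  proof (rule P.AE_pair_measure)
    show "AE y in D. AE p in cubeM. \<bar>?h (y, p)\<bar> \<le> 1"
      using AE_D AE_cube_bounded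
      by (elim eventually_mono) (auto elim!: eventually_mono intro!: abs_ball_form_le[OF X])
  qed measurable
  then have bd: "AE l in ?M. \<bar>l\<bar> \<le> 1" by (subst AE_distr_iff) auto
  have "?M = mu_measure (\<alpha> + 1/2)"
  proof (rule mu_measure_eqI_gauss[OF rd bd])
    show "0 \<le> \<alpha> + 1/2" using alpha_nonneg by simp
    fix F :: "real \<Rightarrow> ennreal" assume [measurable]: "F \<in> borel_measurable borel"
    let ?w = "\<lambda>s. gauss_weight (2 * (\<alpha> + 1/2)) s"
    have "ennreal ball_mass * (\<integral>\<^sup>+s. ?w s * (\<integral>\<^sup>+l. F (s * l) \<partial>?M) \<partial>lborel)
       = (\<integral>\<^sup>+s. ?w s * (ennreal ball_mass * (\<integral>\<^sup>+l. F (s * l) \<partial>?M)) \<partial>lborel)"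
      by (subst nn_integral_cmult[symmetric]) (auto simp: mult_ac)
    also have "\<dots> = ennreal gauss_mass * (\<integral>\<^sup>+z. F z \<partial>gauss)"
      by (subst M_int, measurable, subst D_int, measurable) (rule ball_form_gauss[OF _ X], measurable)
    also have "\<dots> = ennreal ball_mass * (ennreal (gauss_moment (2 * (\<alpha> + 1/2))) * (\<integral>\<^sup>+z. F z \<partial>gauss))"
    proof -
      have "0 < gauss_moment (2 * (\<alpha> + 1/2))" using alpha_nonneg by (intro gauss_moment_pos) simp
      then have "gauss_mass = ball_mass * gauss_moment (2 * (\<alpha> + 1/2))" by (simp add: ball_mass_def)
      then show ?thesis using ball_mass_pos by (simp only: ennreal_mult'[OF less_imp_le] mult.assoc)
    qed
    finally show "(\<integral>\<^sup>+s. ?w s * (\<integral>\<^sup>+l. F (s * l) \<partial>?M) \<partial>lborel)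
       = ennreal (gauss_moment (2 * (\<alpha> + 1/2))) * (\<integral>\<^sup>+z. F z \<partial>gauss)"
      using ball_mass_pos by (subst (asm) ennreal_mult_cancel_left) (auto simp: ennreal_eq_0_iff)
  qed
  then have "ennreal ball_mass * (\<integral>\<^sup>+l. F l \<partial>mu_measure (\<alpha> + 1/2)) = ennreal ball_mass * (\<integral>\<^sup>+l. F l \<partial>?M)" by simp
  also have "\<dots> = (\<integral>\<^sup>+y. ennreal (ball_weight y) * (\<integral>\<^sup>+p. F (ball_form x a y p) \<partial>cubeM) \<partial>lborel)"
    by (subst M_int, measurable, subst D_int, measurable)
  finally show ?thesis by simp
qed

lemma prob_space_mu_alpha: "prob_space (mu_measure \<alpha>)"
  by (rule prob_space_mu_measure[OF alpha_nonneg])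

lemma borel_measurable_cone_kernel [measurable (raw)]:
  assumes [measurable]: "G \<in> borel_measurable borel" "f \<in> measurable M borel" "g \<in> measurable M borel"
  shows "(\<lambda>x. cone_kernel \<kappa> \<mu> G (f x) (g x)) \<in> borel_measurable M"
proof -
  interpret mu: prob_space "mu_measure \<alpha>" by (rule prob_space_mu_alpha)
  show ?thesis unfolding cone_kernel_def by measurable
qed

text \<open>Polar decomposition isolates the slice integral; \<open>funk_hecke\<close> removes the
  direction of z, leaving a mean over \<open>l\<close> and \<open>c\<close> which depends on z only
  through its height t.\<close>

lemma nn_integral_cone_kernel:
  assumes [measurable]: "G \<in> borel_measurable borel" and z: "z \<in> solid_cone"
  shows "(\<integral>\<^sup>+w. cone_kernel \<kappa> \<mu> G z w * cone_weight_at w \<partial>lborel)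
    = ennreal ball_mass * (\<integral>\<^sup>+r. power_weight (2 * \<alpha>) r * G r \<partial>lborel)"
proof -
  interpret mu: prob_space "mu_measure \<alpha>" by (rule prob_space_mu_alpha)
  interpret mu2: prob_space "mu_measure (\<alpha> + 1/2)" by (rule prob_space_mu_measure) (use alpha_nonneg in simp)
  interpret mu3: prob_space "mu_measure (2 * \<alpha> + 1/2)" by (rule prob_space_mu_measure) (use alpha_nonneg in simp)
  define t where "t = snd z"
  have t: "0 \<le> t" "norm (fst z) \<le> t" using z norm_ge_zero[of "fst z"] by (auto simp: solid_cone_iff t_def simp del: norm_ge_zero)
  \<comment> \<open>At the apex t = 0 there is no direction to normalize; (0,1) is taken as unit
    vector, which is consistent since both sides of \<open>rho\<close> then vanish.\<close>
  define x where "x = (if t = 0 then 0 else fst z /\<^sub>R t)"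
  define a where "a = (if t = 0 then 1 else sqrt (t\<^sup>2 - (norm (fst z))\<^sup>2) / t)"
  have tx: "(norm (fst z))\<^sup>2 \<le> t\<^sup>2" using t by (simp add: power_mono)
  have X: "(norm x)\<^sup>2 + a\<^sup>2 = 1"
    using t tx by (auto simp: x_def a_def power_divide power_mult_distrib divide_simps)
  have zx: "fst z = t *\<^sub>R x" "sqrt (t\<^sup>2 - (norm (fst z))\<^sup>2) = t * a"
    using t by (auto simp: x_def a_def)
  have rho: "cone_rho z (s *\<^sub>R y, s) p = sqrt (t * s) * sqrt ((1 + ball_form x a y p) / 2)" if "0 \<le> s" "norm y \<le> 1" for s y p
  proof -
    have "s\<^sup>2 - (norm (s *\<^sub>R y))\<^sup>2 = s\<^sup>2 * (1 - (norm y)\<^sup>2)"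
      by (simp add: power_mult_distrib algebra_simps)
    then have sq: "sqrt (s\<^sup>2 - (norm (s *\<^sub>R y))\<^sup>2) = s * sqrt (1 - (norm y)\<^sup>2)"
      using that by (simp add: real_sqrt_mult)
    have "t * s + (\<Sum>i\<in>UNIV. fst z $ i * (s *\<^sub>R y) $ i * fst p i)
       + sqrt (t\<^sup>2 - (norm (fst z))\<^sup>2) * sqrt (s\<^sup>2 - (norm (s *\<^sub>R y))\<^sup>2) * snd p = t * s * (1 + ball_form x a y p)"
      unfolding zx(2) sq unfolding zx(1) by (simp add: ball_form_def sum_distrib_left algebra_simps)
    then show ?thesis
      by (simp add: cone_rho_eq t_def[symmetric] real_sqrt_mult[symmetric])
  qed
  let ?F = "\<lambda>s l. \<integral>\<^sup>+c. G (t + s + 2 * (sqrt (t * s) * sqrt ((1 + l) / 2)) * c) \<partial>mu_measure \<alpha>"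
  have "(\<integral>\<^sup>+w. cone_kernel \<kappa> \<mu> G z w * cone_weight_at w \<partial>lborel)
     = (\<integral>\<^sup>+s. power_weight (2 * \<alpha>) s * (\<integral>\<^sup>+y. cone_kernel \<kappa> \<mu> G z (s *\<^sub>R y, s) * ennreal (ball_weight y) \<partial>lborel) \<partial>lborel)"
    by (rule nn_integral_cone_polar) measurable
  also have "\<dots> = (\<integral>\<^sup>+s. ennreal ball_mass * (power_weight (2 * \<alpha>) s * (\<integral>\<^sup>+w. G (t + s + 2 * sqrt (t * s) * w) \<partial>mu_measure (2 * \<alpha> + 1/2))) \<partial>lborel)"
  proof (rule nn_integral_cong, goal_cases)
    case (1 s)
    show ?case
    proof (cases "0 \<le> s")
      case True
      have "(\<integral>\<^sup>+y. cone_kernel \<kappa> \<mu> G z (s *\<^sub>R y, s) * ennreal (ball_weight y) \<partial>lborel)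
         = (\<integral>\<^sup>+y. ennreal (ball_weight y) * (\<integral>\<^sup>+p. ?F s (ball_form x a y p) \<partial>cubeM) \<partial>lborel)"
      proof (rule nn_integral_cong)
        fix y :: "real ^ 'd"
        show "cone_kernel \<kappa> \<mu> G z (s *\<^sub>R y, s) * ennreal (ball_weight y) = ennreal (ball_weight y) * (\<integral>\<^sup>+p. ?F s (ball_form x a y p) \<partial>cubeM)"
        proof (cases "norm y \<le> 1")
          case y: True
          show ?thesis unfolding cone_kernel_def by (simp add: rho[OF True y] t_def[symmetric] mult.commute)
        next
          case False then show ?thesis by (simp add: ball_weight_def)
        qed
      qed
      also have "\<dots> = ennreal ball_mass * (\<integral>\<^sup>+l. ?F s l \<partial>mu_measure (\<alpha> + 1/2))"
        by (rule funk_hecke[OF _ X]) measurable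
      \<comment> \<open>\<open>mu_measure_product\<close> merges \<open>l\<close> and
        \<open>c\<close> into a single Beta variable.\<close>
      also have "(\<integral>\<^sup>+l. ?F s l \<partial>mu_measure (\<alpha> + 1/2)) = (\<integral>\<^sup>+w. G (t + s + 2 * sqrt (t * s) * w) \<partial>mu_measure (2 * \<alpha> + 1/2))"
        unfolding mu_measure_product[OF alpha_nonneg, symmetric]
        by (subst nn_integral_distr, measurable, subst mu.nn_integral_fst[symmetric]) (auto simp: mult_ac)
      finally have e: "(\<integral>\<^sup>+y. cone_kernel \<kappa> \<mu> G z (s *\<^sub>R y, s) * ennreal (ball_weight y) \<partial>lborel) = ennreal ball_mass * \<dots>" .
      show ?thesis unfolding e by (rule mult.left_commute)
    qed simp
  qed
  also have "\<dots> = ennreal ball_mass * (\<integral>\<^sup>+s. power_weight (2 * \<alpha>) s * (\<integral>\<^sup>+w. G (t + s + 2 * sqrt (t * s) * w) \<partial>mu_measure (2 * \<alpha> + 1/2)) \<partial>lborel)"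
    by (rule nn_integral_cmult) measurable
  \<comment> \<open>The half-line translation with parameter
    \<open>b = 2 * \<alpha>\<close>.\<close>
  also have "\<dots> = ennreal ball_mass * (\<integral>\<^sup>+r. power_weight (2 * \<alpha>) r * G r \<partial>lborel)"
    by (subst laguerre_translation) (use alpha_nonneg t in auto)
  finally show ?thesis .
qed

text \<open>Polar decomposition of exp(-t): the slices contribute \<open>ball_mass\<close>, the
  heights the Gamma integral of order 2\<alpha> + 1.\<close>

lemma cone_b_eq:
  "cone_b \<kappa> \<mu> = 1 / (ball_mass * Gamma (2 * \<alpha> + 1))"
proof -
  have G: "0 < Gamma (2 * \<alpha> + 1)" using alpha_nonneg by (intro Gamma_real_pos) simp
  have e: "(\<integral>\<^sup>+z. ennreal (indicator solid_cone z *\<^sub>R cone_W \<kappa> \<mu> z) \<partial>lborel) = ennreal (ball_mass * Gamma (2 * \<alpha> + 1))"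
  proof -
    have "(\<integral>\<^sup>+z. ennreal (indicator solid_cone z *\<^sub>R cone_W \<kappa> \<mu> z) \<partial>lborel)
      = (\<integral>\<^sup>+z. ennreal (exp (- snd z)) * cone_weight_at z \<partial>lborel)"
      by (rule nn_integral_cong) (simp add: cone_W_eq ennreal_mult'[symmetric] mult_ac)
    also have "\<dots> = (\<integral>\<^sup>+s. power_weight (2 * \<alpha>) s * (\<integral>\<^sup>+x. ennreal (exp (- s)) * ennreal (ball_weight x) \<partial>lborel) \<partial>lborel)"
      by (subst nn_integral_cone_polar) auto
    also have "\<dots> = (\<integral>\<^sup>+s. ennreal (indicator {0..} s * (s powr (2 * \<alpha> + 1 - 1) * exp (- (1 * s)))) * ennreal ball_mass \<partial>lborel)"
      by (intro nn_integral_cong, subst nn_integral_cmult)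
         (auto simp: nn_integral_ball_weight ennreal_mult'[symmetric] mult.assoc[symmetric] split: split_indicator)
    also have "\<dots> = ennreal (Gamma (2 * \<alpha> + 1)) * ennreal ball_mass"
      using alpha_nonneg by (subst nn_integral_multc, measurable, subst nn_integral_Gamma_scaled) auto
    also have "\<dots> = ennreal (ball_mass * Gamma (2 * \<alpha> + 1))"
      using ball_mass_pos G by (simp add: ennreal_mult'[symmetric] mult.commute)
    finally show ?thesis .
  qed
  have nn: "0 \<le> indicator solid_cone z *\<^sub>R cone_W \<kappa> \<mu> z" for z
    by (simp add: cone_W_eq cone_u_nonneg)
  have I: "has_bochner_integral lborel (\<lambda>z. indicator solid_cone z *\<^sub>R cone_W \<kappa> \<mu> z) (ball_mass * Gamma (2 * \<alpha> + 1))"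
    by (rule has_bochner_integral_nn_integral[OF _ _ _ e]) (use nn ball_mass_pos G in auto)
  then show "cone_b \<kappa> \<mu> = 1 / (ball_mass * Gamma (2 * \<alpha> + 1))"
    by (simp add: cone_b_def set_lebesgue_integral_def integral_completion has_bochner_integral_integral_eq)
qed

lemma cone_b_pos: "0 < cone_b \<kappa> \<mu>"
  using ball_mass_pos alpha_nonneg Gamma_real_pos[of "2 * \<alpha> + 1"] by (simp add: cone_b_eq)

text \<open>\<open>ball_mass\<close> cancels against \<open>cone_b\<close>, and what remains is
  exactly the factor in \<open>halfline_norm1\<close>; hence Young's inequality will hold with
  constant 1.\<close>

lemma nn_integral_cone_kernel_normalized:
  assumes [measurable]: "G \<in> borel_measurable borel" and z: "z \<in> solid_cone"
  shows "ennreal (cone_b \<kappa> \<mu>) * (\<integral>\<^sup>+w. cone_kernel \<kappa> \<mu> G z w * cone_weight_at w \<partial>lborel)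
    = ennreal (1 / Gamma (2 * \<alpha> + 1)) * (\<integral>\<^sup>+r. power_weight (2 * \<alpha>) r * G r \<partial>lborel)"
proof -
  have G: "0 < Gamma (2 * \<alpha> + 1)" using alpha_nonneg by (intro Gamma_real_pos) simp
  have "ennreal (cone_b \<kappa> \<mu>) * ennreal ball_mass = ennreal (1 / Gamma (2 * \<alpha> + 1))"
    using G ball_mass_pos by (subst ennreal_mult'[symmetric]) (auto simp: cone_b_eq)
  then show ?thesis
    by (simp add: nn_integral_cone_kernel[OF assms] mult.assoc[symmetric])
qed

end

section \<open>Measurability of the integral over the angle\<close>

lemma borel_measurable_bessel_J [measurable]: "bessel_J \<nu> \<in> borel_measurable borel"
  unfolding bessel_J_def[abs_def] by measurable

lemma borel_measurable_bessel_j [measurable]: "bessel_j \<nu> \<in> borel_measurable borel"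
  unfolding bessel_j_def[abs_def] by measurable

text \<open>The real \<open>powr\<close> depends only on the modulus of its base. Negative arguments
  have to be covered because measurability is proved for \<rho> on the whole line.\<close>

lemma bessel_j_minus: "bessel_j \<nu> (- z) = bessel_j \<nu> z"
proof -
  have "(- x) powr b = x powr b" for x b :: real by (simp add: powr_def ln_minus)
  then show ?thesis by (simp add: bessel_j_def bessel_J_def)
qed

lemma bessel_j_abs: "bessel_j \<nu> \<bar>z\<bar> = bessel_j \<nu> z"
  by (cases "0 \<le> z") (auto simp: bessel_j_minus)

text \<open>Up to a nonvanishing power, the Bessel factor is an entire function of (z/2)^2. Composed
  with z = \<rho> sin \<theta> it is entire in \<theta> and equals 1/\<Gamma>(a), which is not 0, at
  \<theta> = 0; so its zeros are countable.\<close>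

lemma countable_bessel_j_sin_zeros:
  assumes a: "1/2 \<le> a"
  shows "countable {\<theta>. bessel_j (a - 1) (\<rho> * sin \<theta>) = 0}"
proof -
  define c where "c = (\<lambda>n. (- 1) ^ n / fact n * rGamma (real n + (a - 1) + 1) :: real)"
  have c_eq: "(- 1) ^ n / fact n * rGamma (real n + (a - 1) + 1) * (z / 2) powr (2 * real n + (a - 1))
     = (z / 2) powr (a - 1) * (c n * ((z / 2)\<^sup>2) ^ n)" if "0 < z" for n z
  proof -
    have "(z / 2) powr (2 * real n + (a - 1)) = (z / 2) powr (real (2 * n)) * (z / 2) powr (a - 1)"
      by (simp add: powr_add)
    also have "(z / 2) powr (real (2 * n)) = ((z / 2)\<^sup>2) ^ n"
      using that by (subst powr_realpow) (auto simp: power_mult)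
    finally show ?thesis by (simp add: c_def)
  qed
  have summable_real: "summable (\<lambda>n. c n * X ^ n)" if "0 < X" for X
  proof -
    have "summable (\<lambda>n. (sqrt X) powr (a - 1) * (c n * X ^ n))"
      using sums_summable[OF bessel_J_sums[OF a, of "2 * sqrt X"]] c_eq[of "2 * sqrt X"] that by simp
    then show ?thesis
      using that by (subst (asm) summable_cmult_iff) auto
  qed
  have summable_complex: "summable (\<lambda>n. complex_of_real (c n) * w ^ n)" for w
  proof (rule powser_inside)
    have "summable (\<lambda>n. complex_of_real (c n * (norm w + 1) ^ n))"
      unfolding summable_complex_of_real by (rule summable_real) (simp add: add_nonneg_pos)
    then show "summable (\<lambda>n. complex_of_real (c n) * complex_of_real (norm w + 1) ^ n)" by simp
    show "norm w < norm (complex_of_real (norm w + 1))"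
      by (simp only: norm_of_real)
  qed
  define f where "f = (\<lambda>w. \<Sum>n. complex_of_real (c n) * w ^ n)"
  have f_hol: "f holomorphic_on UNIV"
    unfolding f_def
  proof (rule holomorphic_onI)
    fix w :: complex
    have "((\<lambda>w. \<Sum>n. complex_of_real (c n) * w ^ n) has_field_derivative (\<Sum>n. diffs (\<lambda>n. complex_of_real (c n)) n * w ^ n)) (at w)"
      by (rule termdiffs_strong_converges_everywhere[OF summable_complex])
    then show "(\<lambda>w. \<Sum>n. complex_of_real (c n) * w ^ n) field_differentiable (at w within UNIV)"
      by (auto simp: field_differentiable_def)
  qed
  define G where "G = (\<lambda>w. f ((complex_of_real \<rho> * sin w / 2)\<^sup>2))"
  have G_hol: "G holomorphic_on UNIV"
    unfolding G_def by (rule holomorphic_on_compose_gen[OF _ f_hol, unfolded o_def]) (auto intro!: holomorphic_intros)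
  have G0: "G 0 \<noteq> 0"
  proof -
    have "f 0 = complex_of_real (c 0)" unfolding f_def by simp
    moreover have "c 0 \<noteq> 0" using a by (auto simp: c_def rGamma_eq_zero_iff elim!: nonpos_Ints_cases)
    ultimately show ?thesis by (simp add: G_def)
  qed
  have count: "countable {w. G w = 0}"
  proof (cases "G constant_on UNIV")
    case True
    then have "{w. G w = 0} = {}" using G0 by (auto simp: constant_on_def)
    then show ?thesis by simp
  next
    case False
    have "countable {w \<in> UNIV. G w = 0}"
      by (rule holomorphic_countable_zeros[OF G_hol]) (use False in auto)
    then show ?thesis by simp
  qed
  have "G (complex_of_real \<theta>) = 0" if "bessel_j (a - 1) (\<rho> * sin \<theta>) = 0" for \<theta>
  proof -
    let ?z = "\<bar>\<rho> * sin \<theta>\<bar>"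
    have j0: "bessel_j (a - 1) ?z = 0" using that by (simp only: bessel_j_abs)
    have z: "0 < ?z"
    proof (rule ccontr)
      assume "\<not> 0 < ?z"
      then have "?z = 0" by simp
      then have "rGamma a = 0" using j0 by (simp add: bessel_j_def)
      then show False using a by (auto simp: rGamma_eq_zero_iff elim!: nonpos_Ints_cases)
    qed
    have "bessel_J (a - 1) ?z = 0" using j0 z by (simp add: bessel_j_def)
    then have "(\<lambda>n. (?z / 2) powr (a - 1) * (c n * ((?z / 2)\<^sup>2) ^ n)) sums 0"
      using summable_sums[OF sums_summable[OF bessel_J_sums[OF a z]]] c_eq[OF z] by (simp only: bessel_J_def)
    then have "(\<lambda>n. c n * ((?z / 2)\<^sup>2) ^ n) sums 0"
      using z sums_mult_iff[of "(?z / 2) powr (a - 1)" "\<lambda>n. c n * ((?z / 2)\<^sup>2) ^ n" 0] by simp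
    then have "(\<lambda>n. complex_of_real (c n * ((?z / 2)\<^sup>2) ^ n)) sums complex_of_real 0"
      by (subst sums_of_real_iff)
    then have "f (complex_of_real ((?z / 2)\<^sup>2)) = 0"
      unfolding f_def by (simp add: sums_iff)
    moreover have "(complex_of_real \<rho> * sin (complex_of_real \<theta>) / 2)\<^sup>2 = complex_of_real ((?z / 2)\<^sup>2)"
      by (simp add: sin_of_real power_divide power_mult_distrib flip: of_real_power)
    ultimately show ?thesis by (simp only: G_def)
  qed
  then have "complex_of_real ` {\<theta>. bessel_j (a - 1) (\<rho> * sin \<theta>) = 0} \<subseteq> {w. G w = 0}" by auto
  then have "countable (complex_of_real ` {\<theta>. bessel_j (a - 1) (\<rho> * sin \<theta>) = 0})"
    using count by (rule countable_subset)
  then show ?thesis by (subst (asm) countable_image_inj_eq) (auto simp: inj_on_def)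
qed

lemma borel_measurable_lebesgue_AE_eq:
  fixes f g :: "'a::euclidean_space \<Rightarrow> real"
  assumes f: "f \<in> borel_measurable lebesgue" and ae: "AE x in lebesgue. f x = g x"
  shows "g \<in> borel_measurable lebesgue"
proof -
  obtain N where N: "N \<in> null_sets lebesgue" "{x \<in> space lebesgue. f x \<noteq> g x} \<subseteq> N"
    using ae unfolding eventually_ae_filter by blast
  have eq: "f x = g x" if "x \<notin> N" for x using N(2) that by auto
  show ?thesis
  proof (rule measurableI)
    fix B :: "real set" assume B: "B \<in> sets borel"
    have "g -` B \<inter> space lebesgue = (f -` B \<inter> space lebesgue - N) \<union> (g -` B \<inter> N)"
      using eq by auto
    moreover have "g -` B \<inter> N \<in> null_sets lebesgue"
      by (rule null_sets_completion_subset[OF _ N(1)]) auto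
    moreover have "f -` B \<inter> space lebesgue - N \<in> sets lebesgue"
      using measurable_sets[OF f B] N(1) by (intro sets.Diff) auto
    ultimately show "g -` B \<inter> space lebesgue \<in> sets lebesgue" by (simp only: sets.Un null_setsD2)
  qed simp
qed

lemma borel_measurable_translation_integrand [measurable (raw)]:
  assumes [measurable]: "g \<in> borel_measurable borel" "f1 \<in> borel_measurable M" "f2 \<in> borel_measurable M" "f3 \<in> borel_measurable M"
  shows "(\<lambda>x. translation_integrand a g (f1 x) (f2 x) (f3 x)) \<in> borel_measurable M"
  unfolding translation_integrand_def by measurable

lemma AE_lebesgue_notin:
  fixes N :: "'a::euclidean_space set"
  assumes "negligible N" shows "AE x in lebesgue. x \<notin> N"
  using assms by (auto simp: negligible_iff_null_sets intro!: AE_not_in)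

text \<open>Inside (0,pi) the exceptional angles form an image of \<open>N\<close> under an arccos
  branch, differentiable where its argument has modulus below 1 and therefore preserving null sets.
  The angles 0 and pi, where this differentiability fails, are just two points.\<close>

lemma AE_cos_notin_null:
  fixes N :: "real set"
  assumes N: "negligible N" and \<rho>: "\<rho> \<noteq> 0"
  shows "AE \<theta> in lebesgue. \<theta> \<in> {0..pi} \<longrightarrow> r + 2 * \<rho> * cos \<theta> \<notin> N"
proof -
  let ?I = "{y. \<bar>(y - r) / (2 * \<rho>)\<bar> < 1}"
  have "negligible ((\<lambda>y. arccos ((y - r) / (2 * \<rho>))) ` (N \<inter> ?I))"
  proof (rule negligible_differentiable_image_negligible)
    show "negligible (N \<inter> ?I)" using N by (rule negligible_subset) auto
    show "(\<lambda>y. arccos ((y - r) / (2 * \<rho>))) differentiable_on N \<inter> ?I"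
      unfolding differentiable_on_def
    proof
      fix y assume "y \<in> N \<inter> ?I"
      then have "\<bar>(y - r) / (2 * \<rho>)\<bar> < 1" by (simp only: Int_iff mem_Collect_eq)
      then have y: "- 1 < (y - r) / (2 * \<rho>)" "(y - r) / (2 * \<rho>) < 1" by linarith+
      have "((\<lambda>y. arccos ((y - r) / (2 * \<rho>))) has_real_derivative inverse (- sqrt (1 - ((y - r) / (2 * \<rho>))\<^sup>2)) * (1 / (2 * \<rho>))) (at y)"
        by (rule DERIV_chain2[where f=arccos and g="\<lambda>y. (y - r) / (2 * \<rho>)", OF DERIV_arccos[OF y]]) (use \<rho> in \<open>auto intro!: derivative_eq_intros\<close>)
      then show "(\<lambda>y. arccos ((y - r) / (2 * \<rho>))) differentiable (at y within N \<inter> ?I)"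
        by (metis differentiable_at_withinI real_differentiable_def)
    qed
  qed simp
  then have neg: "negligible ((\<lambda>y. arccos ((y - r) / (2 * \<rho>))) ` (N \<inter> ?I) \<union> {0, pi})"
    by (intro negligible_Un) auto
  have key: "r + 2 * \<rho> * cos \<theta> \<notin> N" if "\<theta> \<in> {0..pi}" "\<theta> \<notin> (\<lambda>y. arccos ((y - r) / (2 * \<rho>))) ` (N \<inter> ?I) \<union> {0, pi}" for \<theta>
  proof
    assume "r + 2 * \<rho> * cos \<theta> \<in> N"
    have t: "0 < \<theta>" "\<theta> < pi" using that by auto
    have "cos \<theta> < cos 0" "cos pi < cos \<theta>" using t by (intro cos_monotone_0_pi; simp)+
    then have "\<bar>cos \<theta>\<bar> < 1" by (simp add: abs_less_iff)
    moreover have e: "(r + 2 * \<rho> * cos \<theta> - r) / (2 * \<rho>) = cos \<theta>" using \<rho> by simp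
    ultimately have "r + 2 * \<rho> * cos \<theta> \<in> N \<inter> ?I"
      using \<open>r + 2 * \<rho> * cos \<theta> \<in> N\<close> by (simp only: Int_iff mem_Collect_eq)
    moreover have "\<theta> = arccos ((r + 2 * \<rho> * cos \<theta> - r) / (2 * \<rho>))" unfolding e using t by (simp add: arccos_cos)
    ultimately show False using that(2) by blast
  qed
  then show ?thesis
    by (intro eventually_mono[OF AE_lebesgue_notin[OF neg]] impI key)
qed

text \<open>Allows \<open>g\<close> to be replaced by a Borel version \<open>gb\<close>. The
  argument of \<open>g\<close> stays above r - 2|\<rho>|, hence in \<open>A\<close>, and meets
  \<open>N\<close> only for a null set of angles; for \<rho> = 0 it is the constant r, which must
  then avoid \<open>N\<close>.\<close>

lemma theta_integral_cong:
  assumes gb[measurable]: "gb \<in> borel_measurable borel" and N: "negligible N"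
    and eq: "\<And>y. y \<in> A \<Longrightarrow> y \<notin> N \<Longrightarrow> g y = gb y"
    and A: "\<And>y. r - 2 * \<bar>\<rho>\<bar> \<le> y \<Longrightarrow> y \<in> A" and \<rho>: "\<rho> \<noteq> 0 \<or> r \<notin> N"
  shows "(LINT \<theta>:{0..pi}|lebesgue. translation_integrand a g r \<rho> \<theta>) = (LINT \<theta>:{0..pi}|lebesgue. translation_integrand a gb r \<rho> \<theta>)"
    and "set_integrable lebesgue {0..pi} (translation_integrand a g r \<rho>) \<longleftrightarrow> set_integrable lebesgue {0..pi} (translation_integrand a gb r \<rho>)"
proof -
  have ae: "AE \<theta> in lebesgue. \<theta> \<in> {0..pi} \<longrightarrow> r + 2 * \<rho> * cos \<theta> \<notin> N"
  proof (cases "\<rho> = 0")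
    case True then show ?thesis using \<rho> by simp
  next
    case False then show ?thesis by (rule AE_cos_notin_null[OF N])
  qed
  let ?f = "\<lambda>g \<theta>. indicator {0..pi} \<theta> *\<^sub>R translation_integrand a g r \<rho> \<theta>"
  have AE_eq: "AE \<theta> in lebesgue. ?f gb \<theta> = ?f g \<theta>"
  proof (rule eventually_mono[OF ae])
    fix \<theta> assume N': "\<theta> \<in> {0..pi} \<longrightarrow> r + 2 * \<rho> * cos \<theta> \<notin> N"
    have "\<bar>2 * \<rho> * cos \<theta>\<bar> \<le> 2 * \<bar>\<rho>\<bar>" using abs_cos_le_one[of \<theta>] by (auto simp: abs_mult intro!: mult_left_le)
    then have "r - 2 * \<bar>\<rho>\<bar> \<le> r + 2 * \<rho> * cos \<theta>" by linarith
    then show "?f gb \<theta> = ?f g \<theta>"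
      using N' eq[OF A] by (auto simp: translation_integrand_def split: split_indicator)
  qed
  have m: "?f gb \<in> borel_measurable lebesgue"
    by (rule measurable_completion) measurable
  have m': "?f g \<in> borel_measurable lebesgue"
    by (rule borel_measurable_lebesgue_AE_eq[OF m AE_eq])
  have AE_eq': "AE \<theta> in lebesgue. ?f g \<theta> = ?f gb \<theta>"
    using AE_eq by (auto elim!: eventually_mono)
  show "(LINT \<theta>:{0..pi}|lebesgue. translation_integrand a g r \<rho> \<theta>) = (LINT \<theta>:{0..pi}|lebesgue. translation_integrand a gb r \<rho> \<theta>)"
    unfolding set_lebesgue_integral_def by (rule integral_cong_AE[OF m' m AE_eq'])
  show "set_integrable lebesgue {0..pi} (translation_integrand a g r \<rho>) \<longleftrightarrow> set_integrable lebesgue {0..pi} (translation_integrand a gb r \<rho>)"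
    unfolding set_integrable_def by (rule integrable_cong_AE[OF m' m AE_eq'])
qed

text \<open>A converse to the usual permanence of measurability: the factors other than
  \<open>g\<close> are nonzero for almost all \<theta> and can be divided out, and \<theta> -> r + 2
  \<rho> cos \<theta>, being differentiable, maps Lebesgue sets to Lebesgue sets. So measurability
  of the integrand passes back to \<open>g\<close> on the range.\<close>

lemma translation_integrand_measurable_imp:
  assumes a: "1/2 \<le> a" and \<rho>: "\<rho> \<noteq> 0"
    and m: "(\<lambda>\<theta>. indicator {0..pi} \<theta> *\<^sub>R translation_integrand a g r \<rho> \<theta>) \<in> borel_measurable lebesgue"
    and B: "B \<in> sets borel"
  shows "{y. r - 2 * \<bar>\<rho>\<bar> < y \<and> y < r + 2 * \<bar>\<rho>\<bar> \<and> g y \<in> B} \<in> sets lebesgue"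
proof -
  let ?\<phi> = "\<lambda>\<theta>. r + 2 * \<rho> * cos \<theta>"
  define h where "h = (\<lambda>\<theta>. exp (- \<rho> * cos \<theta>) * bessel_j (a - 1) (\<rho> * sin \<theta>) * sin \<theta> powr (2 * a - 1))"
  have [measurable]: "h \<in> borel_measurable borel" unfolding h_def by measurable
  let ?k = "\<lambda>\<theta>. indicator {0<..<pi} \<theta> * g (?\<phi> \<theta>)"
  have "AE \<theta> in lebesgue. \<theta> \<notin> {\<theta>. bessel_j (a - 1) (\<rho> * sin \<theta>) = 0} \<union> {0, pi}"
    using countable_imp_null_set_lborel[OF countable_bessel_j_sin_zeros[OF a, of \<rho>]]
    by (intro AE_lebesgue_notin negligible_Un) (auto simp: negligible_iff_null_sets null_sets_completionI)
  then have ae: "AE \<theta> in lebesgue. (indicator {0..pi} \<theta> *\<^sub>R translation_integrand a g r \<rho> \<theta>) / h \<theta> = ?k \<theta>"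
  proof (rule eventually_mono)
    fix \<theta> assume \<theta>: "\<theta> \<notin> {\<theta>. bessel_j (a - 1) (\<rho> * sin \<theta>) = 0} \<union> {0, pi}"
    show "(indicator {0..pi} \<theta> *\<^sub>R translation_integrand a g r \<rho> \<theta>) / h \<theta> = ?k \<theta>"
    proof (cases "\<theta> \<in> {0<..<pi}")
      case True
      then have "0 < sin \<theta>" by (intro sin_gt_zero) auto
      then have "h \<theta> \<noteq> 0" using \<theta> by (auto simp: h_def)
      then show ?thesis using True by (simp add: translation_integrand_def h_def)
    next
      case False then show ?thesis using \<theta> by (auto split: split_indicator)
    qed
  qed
  have "h \<in> borel_measurable lebesgue" by (rule measurable_completion) measurable
  then have "(\<lambda>\<theta>. (indicator {0..pi} \<theta> *\<^sub>R translation_integrand a g r \<rho> \<theta>) / h \<theta>) \<in> borel_measurable lebesgue"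
    using m by (rule borel_measurable_divide[rotated])
  from borel_measurable_lebesgue_AE_eq[OF this ae]
  have k: "?k \<in> borel_measurable lebesgue" .
  let ?S = "{\<theta> \<in> {0<..<pi}. g (?\<phi> \<theta>) \<in> B}"
  have "?S = (?k -` B \<inter> space lebesgue) \<inter> {0<..<pi}" by auto
  then have S: "?S \<in> sets lebesgue"
    using measurable_sets[OF k B] by (simp add: sets.Int)
  have "?\<phi> ` ?S \<in> sets lebesgue"
  proof (rule differentiable_image_in_sets_lebesgue[OF S])
    have "(?\<phi> has_real_derivative - (2 * \<rho> * sin \<theta>)) (at \<theta> within ?S)" for \<theta>
      by (auto intro!: derivative_eq_intros)
    then show "?\<phi> differentiable_on ?S"
      unfolding differentiable_on_def real_differentiable_def by blast
  qed simp
  moreover have "?\<phi> ` ?S = {y. r - 2 * \<bar>\<rho>\<bar> < y \<and> y < r + 2 * \<bar>\<rho>\<bar> \<and> g y \<in> B}"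
  proof (rule set_eqI, rule iffI)
    fix y assume "y \<in> ?\<phi> ` ?S"
    then obtain \<theta> where \<theta>: "0 < \<theta>" "\<theta> < pi" "g (?\<phi> \<theta>) \<in> B" and y: "y = ?\<phi> \<theta>" by auto
    have "cos \<theta> < cos 0" "cos pi < cos \<theta>" using \<theta> by (intro cos_monotone_0_pi; simp)+
    then have "\<bar>cos \<theta>\<bar> < 1" by (simp add: abs_less_iff)
    then have "\<bar>2 * \<rho> * cos \<theta>\<bar> < 2 * \<bar>\<rho>\<bar>" using \<rho> by (simp add: abs_mult)
    then show "y \<in> {y. r - 2 * \<bar>\<rho>\<bar> < y \<and> y < r + 2 * \<bar>\<rho>\<bar> \<and> g y \<in> B}"
      using \<theta>(3) unfolding y by (auto simp: abs_less_iff)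
  next
    fix y assume "y \<in> {y. r - 2 * \<bar>\<rho>\<bar> < y \<and> y < r + 2 * \<bar>\<rho>\<bar> \<and> g y \<in> B}"
    then have "\<bar>y - r\<bar> < 2 * \<bar>\<rho>\<bar>" and gy: "g y \<in> B" by (auto simp: abs_less_iff)
    then have "\<bar>(y - r) / (2 * \<rho>)\<bar> < 1" using \<rho> by (simp add: abs_mult field_simps)
    then have c: "- 1 < (y - r) / (2 * \<rho>)" "(y - r) / (2 * \<rho>) < 1" by linarith+
    then have "?\<phi> (arccos ((y - r) / (2 * \<rho>))) = y" using \<rho> by (simp add: cos_arccos)
    moreover have "0 < arccos ((y - r) / (2 * \<rho>))" "arccos ((y - r) / (2 * \<rho>)) < pi"
      using arccos_lt_bounded[OF c] by auto
    ultimately show "y \<in> ?\<phi> ` ?S" using gy by (intro image_eqI[of _ _ "arccos ((y - r) / (2 * \<rho>))"]) auto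
  qed
  ultimately show ?thesis by simp
qed

text \<open>The cube measure is an incomplete Borel measure on the whole space; off the cube the argument of \<open>g\<close> may be
  negative, where \<open>g\<close> is arbitrary.  If \<open>T\<close> is the set of \<open>c\<close> such that \<open>g\<close> is Lebesgue measurable on \<open>[c,\<infinity>)\<close>,
  then for \<open>r - 2 \<bar>\<rho>\<bar> \<notin> T\<close> the integrand is not measurable (the zeros of the Bessel factor are
  countable), and the integral has the junk value \<open>0\<close>.\<close>

lemma theta_integral_measurable:
  assumes a: "1/2 \<le> a" and r: "0 \<le> r" and g: "g \<in> borel_measurable (lebesgue_on {0..})"
  shows "(\<lambda>\<rho>. LINT \<theta>:{0..pi}|lebesgue. translation_integrand a g r \<rho> \<theta>) \<in> borel_measurable borel"
proof -
  \<comment> \<open>\<open>Q A\<close> expresses Lebesgue measurability of \<open>g\<close> on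
    \<open>A\<close> without requiring \<open>A\<close> itself to be measurable.\<close>
  define Q where "Q = (\<lambda>A. \<forall>B \<in> sets borel. {y \<in> A. g y \<in> B} \<in> sets lebesgue)"
  define T where "T = {c. Q {c..}}"
  have Q0: "Q {0..}"
    using g by (auto simp: Q_def dest!: measurable_sets simp: sets_restrict_space_iff vimage_def Int_def space_restrict_space conj_commute)
  have QInt: "Q (A \<inter> C)" if "Q A" "C \<in> sets lebesgue" for A C
  proof -
    have "{y \<in> A \<inter> C. g y \<in> B} = {y \<in> A. g y \<in> B} \<inter> C" for B by auto
    then show ?thesis using that by (auto simp: Q_def)
  qed
  have QUN: "Q (\<Union>c\<in>C. A c)" if "countable C" "\<And>c. c \<in> C \<Longrightarrow> Q (A c)" for A and C :: "real set"
  proof -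
    have "{y \<in> (\<Union>c\<in>C. A c). g y \<in> B} = (\<Union>c\<in>C. {y \<in> A c. g y \<in> B})" for B by auto
    then show ?thesis using that by (auto simp: Q_def intro!: sets.countable_UN')
  qed
  have QUn: "Q (A \<union> C)" if "Q A" "Q C" for A C
  proof -
    have "{y \<in> A \<union> C. g y \<in> B} = {y \<in> A. g y \<in> B} \<union> {y \<in> C. g y \<in> B}" for B by auto
    then show ?thesis using that by (auto simp: Q_def)
  qed
  have Q1: "Q {c}" for c
  proof -
    have "{y \<in> {c}. g y \<in> B} = (if g c \<in> B then {c} else {})" for B by auto
    then show ?thesis by (auto simp: Q_def)
  qed
  have T0: "0 \<in> T" using Q0 by (simp add: T_def)
  have T_up: "y \<in> T" if "x \<in> T" "x \<le> y" for x y
  proof -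
    have "{x..} \<inter> {y..} = {y..}" using that by auto
    then show ?thesis using that QInt[of "{x..}" "{y..}"] by (auto simp: T_def)
  qed
  \<comment> \<open>\<open>T\<close> is an up-set of the real line, hence a countable union of rays:
    those starting at rational members and, if it exists, at the least element. This gives that
    \<open>T\<close> is Borel and that \<open>Q T\<close> holds.\<close>
  define C where "C = (T \<inter> \<rat>) \<union> {x \<in> T. \<forall>y\<in>T. x \<le> y}"
  have "countable {x \<in> T. \<forall>y\<in>T. x \<le> y}"
  proof (cases "{x \<in> T. \<forall>y\<in>T. x \<le> y} = {}")
    case False
    then obtain x where "x \<in> T" "\<forall>y\<in>T. x \<le> y" by auto
    then have "{x \<in> T. \<forall>y\<in>T. x \<le> y} \<subseteq> {x}" by (auto intro: order_antisym)
    then show ?thesis by (rule countable_subset) simp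
  qed (simp only: countable_empty)
  then have C: "countable C" unfolding C_def by (intro countable_Un countable_Int2 countable_rat)
  have TC: "T = (\<Union>c\<in>C. {c..})"
  proof
    show "T \<subseteq> (\<Union>c\<in>C. {c..})"
    proof
      fix x assume x: "x \<in> T"
      show "x \<in> (\<Union>c\<in>C. {c..})"
      proof (cases "\<forall>y\<in>T. x \<le> y")
        case True then show ?thesis using x by (auto simp: C_def)
      next
        case False
        then obtain y where y: "y \<in> T" "y < x" by auto
        then obtain q where "q \<in> \<rat>" "y < q" "q < x" using Rats_dense_in_real by blast
        then show ?thesis using T_up[OF y(1), of q] by (auto simp: C_def intro!: bexI[of _ q])
      qed
    qed
    show "(\<Union>c\<in>C. {c..}) \<subseteq> T" using T_up by (auto simp: C_def)
  qed
  have T_meas[measurable]: "T \<in> sets borel"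
    unfolding TC by (rule sets.countable_UN'[OF C]) auto
  have QT: "Q T" unfolding TC by (rule QUN[OF C]) (auto simp: C_def T_def)
  \<comment> \<open>Cut off outside \<open>T\<close>, \<open>g\<close> has one Borel version that
    serves all \<rho> with r - 2|\<rho>| in \<open>T\<close> at once.\<close>
  have "(\<lambda>x. if x \<in> T then g x else 0) \<in> borel_measurable lebesgue"
  proof (rule measurableI)
    fix B :: "real set" assume B: "B \<in> sets borel"
    have "(\<lambda>x. if x \<in> T then g x else 0) -` B \<inter> space lebesgue = {y \<in> T. g y \<in> B} \<union> (if 0 \<in> B then - T else {})"
      by (auto split: if_splits)
    moreover have "{y \<in> T. g y \<in> B} \<in> sets lebesgue" using QT B by (auto simp: Q_def)
    moreover have "- T \<in> sets lebesgue" using T_meas by (auto intro: sets_completionI_sets)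
    ultimately show "(\<lambda>x. if x \<in> T then g x else 0) -` B \<inter> space lebesgue \<in> sets lebesgue"
      by (auto intro!: sets.Un)
  qed simp
  then obtain gb where gb[measurable]: "gb \<in> borel_measurable borel" and ae: "AE x in lborel. (if x \<in> T then g x else 0) = gb x"
    using completion_ex_borel_measurable_real[of _ lborel] by auto
  from ae obtain N where N0: "N \<in> null_sets lborel" "{x \<in> space lborel. (if x \<in> T then g x else 0) \<noteq> gb x} \<subseteq> N"
    unfolding eventually_ae_filter by blast
  have N: "negligible N" using N0(1) by (simp add: negligible_iff_null_sets null_sets_completionI)
  have eqT: "g x = gb x" if "x \<in> T" "x \<notin> N" for x
  proof (rule ccontr)
    assume "g x \<noteq> gb x"
    then have "x \<in> {x \<in> space lborel. (if x \<in> T then g x else 0) \<noteq> gb x}" using that by simp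
    then show False using N0(2) that(2) by blast
  qed
  let ?L = "\<lambda>g \<rho>. LINT \<theta>:{0..pi}|lebesgue. translation_integrand a g r \<rho> \<theta>"
  \<comment> \<open>The value at \<rho> = 0 is kept apart, since there the argument of
    \<open>g\<close> is the single point r, which may belong to \<open>N\<close>.\<close>
  have eq: "?L g \<rho> = (if \<rho> = 0 then ?L g 0 else if r - 2 * \<bar>\<rho>\<bar> \<in> T then ?L gb \<rho> else 0)" for \<rho>
  proof (cases "\<rho> = 0")
    case False
    show ?thesis
    proof (cases "r - 2 * \<bar>\<rho>\<bar> \<in> T")
      case True
      have "?L g \<rho> = ?L gb \<rho>"
        by (rule theta_integral_cong(1)[OF gb N eqT]) (use T_up[OF True] \<open>\<rho> \<noteq> 0\<close> in auto)
      then show ?thesis using True False by simp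
    next
      case nT: False
      have "(\<lambda>\<theta>. indicator {0..pi} \<theta> *\<^sub>R translation_integrand a g r \<rho> \<theta>) \<notin> borel_measurable lebesgue"
      proof
        assume m: "(\<lambda>\<theta>. indicator {0..pi} \<theta> *\<^sub>R translation_integrand a g r \<rho> \<theta>) \<in> borel_measurable lebesgue"
        \<comment> \<open>If the integrand were measurable, \<open>g\<close> would be measurable on
          the open interval around r; with the two endpoints and the ray from r + 2|\<rho>|, which
          starts in \<open>T\<close>, it would be so on the ray from r - 2|\<rho>|.\<close>
        have I: "Q {r - 2 * \<bar>\<rho>\<bar><..<r + 2 * \<bar>\<rho>\<bar>}"
          unfolding Q_def
        proof
          fix B :: "real set" assume B: "B \<in> sets borel"
          have "{y \<in> {r - 2 * \<bar>\<rho>\<bar><..<r + 2 * \<bar>\<rho>\<bar>}. g y \<in> B} = {y. r - 2 * \<bar>\<rho>\<bar> < y \<and> y < r + 2 * \<bar>\<rho>\<bar> \<and> g y \<in> B}"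
            by auto
          also have "\<dots> \<in> sets lebesgue"
            by (rule translation_integrand_measurable_imp[OF a \<open>\<rho> \<noteq> 0\<close> m B])
          finally show "{y \<in> {r - 2 * \<bar>\<rho>\<bar><..<r + 2 * \<bar>\<rho>\<bar>}. g y \<in> B} \<in> sets lebesgue" .
        qed
        have "r + 2 * \<bar>\<rho>\<bar> \<in> T" by (rule T_up[OF T0]) (use r in simp)
        then have "Q ({r - 2 * \<bar>\<rho>\<bar>} \<union> ({r - 2 * \<bar>\<rho>\<bar><..<r + 2 * \<bar>\<rho>\<bar>} \<union> {r + 2 * \<bar>\<rho>\<bar>..}))"
          by (intro QUn Q1 I) (simp add: T_def)
        also have "{r - 2 * \<bar>\<rho>\<bar>} \<union> ({r - 2 * \<bar>\<rho>\<bar><..<r + 2 * \<bar>\<rho>\<bar>} \<union> {r + 2 * \<bar>\<rho>\<bar>..}) = {r - 2 * \<bar>\<rho>\<bar>..}"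
          by auto
        finally show False using nT by (simp add: T_def)
      qed
      then have "\<not> integrable lebesgue (\<lambda>\<theta>. indicator {0..pi} \<theta> *\<^sub>R translation_integrand a g r \<rho> \<theta>)"
        using borel_measurable_integrable by blast
      then have "?L g \<rho> = 0" unfolding set_lebesgue_integral_def by (rule not_integrable_integral_eq)
      then show ?thesis using False nT by simp
    qed
  qed simp
  have m: "(\<lambda>\<rho>. if \<rho> = 0 then ?L g 0 else if r - 2 * \<bar>\<rho>\<bar> \<in> T then ?L gb \<rho> else 0) \<in> borel_measurable borel"
  proof -
    have "?L gb = (\<lambda>\<rho>. LINT \<theta>|lborel. indicator {0..pi} \<theta> *\<^sub>R translation_integrand a gb r \<rho> \<theta>)"
      unfolding set_lebesgue_integral_def by (rule ext, rule integral_completion) measurable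
    also have "\<dots> \<in> borel_measurable borel" by measurable
    finally have [measurable]: "?L gb \<in> borel_measurable borel" .
    show ?thesis by measurable
  qed
  show ?thesis by (rule iffD2[OF measurable_cong m]) (rule eq)
qed

section \<open>Schur's test\<close>

text \<open>The concave function t -> t^(1/p) lies below its tangent at c^p; this is read at t =
  x^p.\<close>

lemma young_powr:
  fixes x p c :: real
  assumes p: "1 \<le> p" and x: "0 \<le> x" and c: "0 < c"
  shows "x \<le> x powr p * (1 / (p * c powr (p - 1))) + (1 - 1 / p) * c"
proof (cases "x = 0")
  case True then show ?thesis using p c by (simp add: mult_nonneg_nonneg)
next
  case False
  define y where "y = x / c"
  have y: "0 < y" using False x c by (simp add: y_def)
  have "(y powr p) powr (1 / p) * 1 powr (1 - 1 / p) \<le> 1 / p * (y powr p) + (1 - 1 / p) * 1"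
    by (rule Youngs_inequality_0) (use p y in auto)
  then have "y \<le> 1 / p * (y powr p) + (1 - 1 / p)" using p y by (simp add: powr_powr)
  then have "c * y \<le> c * (1 / p * (y powr p) + (1 - 1 / p))" using c by (intro mult_left_mono) auto
  also have "\<dots> = x powr p * (1 / (p * c powr (p - 1))) + (1 - 1 / p) * c"
  proof -
    have "c powr p = c powr (p - 1) * c" using powr_add[of c "p - 1" 1] c by simp
    then have yp: "y powr p = x powr p / (c powr (p - 1) * c)" using x c by (simp add: y_def powr_divide)
    show ?thesis using c unfolding yp by (simp add: distrib_left)
  qed
  finally show ?thesis using c by (simp add: y_def)
qed

text \<open>Hoelder's inequality against the constant \<open>1\<close>, obtained from Young's inequality with the optimal scaling.\<close>

lemma nn_integral_power_le:
  fixes f :: "'a \<Rightarrow> real" and k :: "'a \<Rightarrow> ennreal"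
  assumes [measurable]: "f \<in> borel_measurable M" "k \<in> borel_measurable M"
    and f: "\<And>x. 0 \<le> f x" and p: "1 \<le> p" and a: "0 \<le> a"
    and k: "(\<integral>\<^sup>+x. k x \<partial>M) \<le> ennreal a"
    and fin: "(\<integral>\<^sup>+x. ennreal (f x powr p) * k x \<partial>M) < \<infinity>"
  shows "(\<integral>\<^sup>+x. ennreal (f x) * k x \<partial>M) < \<infinity>"
    and "ennreal (enn2real (\<integral>\<^sup>+x. ennreal (f x) * k x \<partial>M) powr p)
      \<le> ennreal (a powr (p - 1)) * (\<integral>\<^sup>+x. ennreal (f x powr p) * k x \<partial>M)"
proof -
  define I where "I = enn2real (\<integral>\<^sup>+x. ennreal (f x powr p) * k x \<partial>M)"
  have I: "(\<integral>\<^sup>+x. ennreal (f x powr p) * k x \<partial>M) = ennreal I" and I0: "0 \<le> I"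
    using fin by (auto simp: I_def less_top)
  let ?H = "\<integral>\<^sup>+x. ennreal (f x) * k x \<partial>M"
  have H: "?H \<le> ennreal (I * (1 / (p * c powr (p - 1))) + (1 - 1 / p) * c * a)" if c: "0 < c" for c
  proof -
    let ?A = "1 / (p * c powr (p - 1))" and ?B = "(1 - 1 / p) * c"
    have AB: "0 \<le> ?A" "0 \<le> ?B" using p c by auto
    have "?H \<le> (\<integral>\<^sup>+x. ennreal ?A * (ennreal (f x powr p) * k x) + ennreal ?B * k x \<partial>M)"
    proof (rule nn_integral_mono)
      fix x
      have "ennreal (f x) \<le> ennreal (f x powr p * ?A + ?B)"
        by (rule ennreal_leI) (rule young_powr[OF p f c])
      also have "\<dots> = ennreal (f x powr p * ?A) + ennreal ?B"
        using AB by (intro ennreal_plus) auto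
      also have "ennreal (f x powr p * ?A) = ennreal ?A * ennreal (f x powr p)"
        using AB by (simp add: ennreal_mult'[symmetric] mult.commute)
      finally have "ennreal (f x) * k x \<le> (ennreal ?A * ennreal (f x powr p) + ennreal ?B) * k x"
        by (rule mult_right_mono) simp
      then show "ennreal (f x) * k x \<le> ennreal ?A * (ennreal (f x powr p) * k x) + ennreal ?B * k x"
        by (simp add: distrib_right mult.assoc)
    qed
    also have "\<dots> = ennreal ?A * ennreal I + ennreal ?B * (\<integral>\<^sup>+x. k x \<partial>M)"
      by (subst nn_integral_add, measurable, subst nn_integral_cmult, measurable, subst nn_integral_cmult, measurable, simp only: I)
    also have "\<dots> \<le> ennreal ?A * ennreal I + ennreal ?B * ennreal a"
      by (intro add_mono mult_left_mono k) auto
    also have "\<dots> = ennreal (I * ?A + ?B * a)"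
      using AB I0 a by (simp only: ennreal_mult[symmetric] ennreal_plus[symmetric] mult_nonneg_nonneg mult.commute[of I])
    finally show ?thesis .
  qed
  \<comment> \<open>For finiteness any scaling will do.\<close>
  show fin': "?H < \<infinity>" using H[of 1] by (auto intro: le_less_trans)
  show "ennreal (enn2real ?H powr p) \<le> ennreal (a powr (p - 1)) * (\<integral>\<^sup>+x. ennreal (f x powr p) * k x \<partial>M)"
  proof (cases "0 < I \<and> 0 < a")
    case True
    \<comment> \<open>This value minimizes the bound in \<open>H\<close> over c: the two terms
      become ac/p and (1 - 1/p)ac.\<close>
    define c where "c = (I / a) powr (1 / p)"
    have c: "0 < c" using True by (simp add: c_def)
    have cp: "c powr p = I / a" using True p by (simp add: c_def powr_powr)
    have cp1: "c powr (p - 1) * c = I / a" using powr_add[of c "p - 1" 1] c cp by simp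
    have "I * (1 / (p * c powr (p - 1))) = a * c / p"
    proof -
      have "I = a * (c powr (p - 1) * c)" using True cp1 by simp
      then show ?thesis using c by simp
    qed
    then have "I * (1 / (p * c powr (p - 1))) + (1 - 1 / p) * c * a = a * c"
      using p by (simp add: field_simps)
    then have "?H \<le> ennreal (a * c)" using H[OF c] by simp
    then have "enn2real ?H \<le> a * c" using True c by (intro enn2real_leI) auto
    then have "enn2real ?H powr p \<le> (a * c) powr p" using p by (intro powr_mono2) auto
    also have "(a * c) powr p = a powr (p - 1) * I"
    proof -
      have "a powr p = a powr (p - 1) * a" using powr_add[of a "p - 1" 1] True by simp
      then show ?thesis using True c cp by (simp add: powr_mult)
    qed
    finally show ?thesis unfolding I by (simp add: ennreal_mult'[symmetric] ennreal_leI)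
  next
    \<comment> \<open>If \<open>I\<close> or \<open>a\<close> is 0 there is no optimal scaling, but
      then f or k vanishes almost everywhere where the other does not, and the integral is
      0.\<close>
    case False
    have "?H = 0"
    proof (cases "I = 0")
      case True
      then have "(\<integral>\<^sup>+x. ennreal (f x powr p) * k x \<partial>M) = 0" using I by simp
      then have "AE x in M. ennreal (f x powr p) * k x = 0"
        by (intro iffD1[OF nn_integral_0_iff_AE]) auto
      then have "AE x in M. ennreal (f x) * k x = 0"
        by (rule eventually_mono) (use f p in \<open>auto simp: ennreal_eq_0_iff\<close>)
      then show ?thesis by (subst nn_integral_0_iff_AE) auto
    next
      case nI: False
      then have "a = 0" using False I0 a by auto
      then have "(\<integral>\<^sup>+x. k x \<partial>M) = 0" using k by simp
      then have "AE x in M. k x = 0" by (intro iffD1[OF nn_integral_0_iff_AE]) auto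
      then have "AE x in M. ennreal (f x) * k x = 0" by (rule eventually_mono) simp
      then show ?thesis by (subst nn_integral_0_iff_AE) auto
    qed
    then show ?thesis by simp
  qed
qed

lemma ennreal_cmult_finiteD: "0 < c \<Longrightarrow> ennreal c * X < \<infinity> \<Longrightarrow> X < \<infinity>"
  by (cases "X = \<infinity>") (auto simp: ennreal_mult_eq_top_iff less_top)

lemma AE_vec_nth_neq: "AE x in (lborel :: (real ^ 'd) measure). x $ i \<noteq> c"
proof -
  have "AE x in lebesgue. x \<notin> {x :: real ^ 'd. x \<bullet> axis i 1 = c}"
    by (intro AE_lebesgue_notin negligible_standard_hyperplane) simp
  then show ?thesis by (simp add: AE_completion_iff cart_eq_inner_axis)
qed

text \<open>The weight can vanish only on the coordinate hyperplanes and on the boundary of the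
  cone. Consequently null sets for the weighted measure are Lebesgue null sets of the cone.\<close>

lemma AE_cone_u_pos:
  fixes \<kappa> :: "real ^ 'd"
  shows "AE z in lborel. z \<in> solid_cone \<longrightarrow> 0 < cone_u \<kappa> \<mu> z"
proof -
  have *: "0 < cone_u \<kappa> \<mu> (x, t)" if "(x, t) \<in> solid_cone" "\<forall>i. x $ i \<noteq> 0" "t \<noteq> norm x" for x t
  proof -
    have "norm x < t" using that by (simp add: solid_cone_iff)
    then have "(norm x)\<^sup>2 < t\<^sup>2" by (intro power_strict_mono) auto
    moreover have "dunkl_h \<kappa> x \<noteq> 0" using that by (simp add: dunkl_h_def)
    ultimately show ?thesis by (simp add: cone_u_def)
  qed
  show ?thesis
    unfolding lborel_prod[symmetric]
  proof (rule lborel_pair.AE_pair_measure)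
    have "{z :: (real ^ 'd) \<times> real. z \<in> solid_cone \<longrightarrow> 0 < cone_u \<kappa> \<mu> z} \<in> sets borel" by measurable
    then show "{z \<in> space (lborel \<Otimes>\<^sub>M lborel). z \<in> solid_cone \<longrightarrow> 0 < cone_u \<kappa> \<mu> z} \<in> sets ((lborel :: (real ^ 'd) measure) \<Otimes>\<^sub>M (lborel :: real measure))"
      unfolding lborel_prod by simp
    have "AE x in (lborel :: (real ^ 'd) measure). \<forall>i. x $ i \<noteq> 0"
      unfolding AE_all_countable by (intro allI AE_vec_nth_neq)
    then show "AE x in (lborel :: (real ^ 'd) measure). AE t in (lborel :: real measure). (x, t) \<in> solid_cone \<longrightarrow> 0 < cone_u \<kappa> \<mu> (x, t)"
    proof (rule eventually_mono)
      fix x :: "real ^ 'd" assume x: "\<forall>i. x $ i \<noteq> 0"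
      show "AE t in (lborel :: real measure). (x, t) \<in> solid_cone \<longrightarrow> 0 < cone_u \<kappa> \<mu> (x, t)"
        by (rule eventually_mono[OF AE_lborel_singleton[of "norm x"]]) (use * x in blast)
    qed
  qed
qed

text \<open>Secures, for almost every w, the condition on r = t + s that
  \<open>theta_integral_cong\<close> imposes when \<rho> = 0.\<close>

lemma AE_snd_notin_null:
  assumes "N \<in> null_sets (lborel :: real measure)"
  shows "AE w in (lborel :: ((real ^ 'd) \<times> real) measure). t + snd w \<notin> N"
  unfolding lborel_prod[symmetric]
proof (rule lborel_pair.AE_pair_measure)
  have [measurable]: "N \<in> sets borel" using assms by auto
  show "{w \<in> space (lborel \<Otimes>\<^sub>M lborel). t + snd w \<notin> N} \<in> sets ((lborel :: (real ^ 'd) measure) \<Otimes>\<^sub>M (lborel :: real measure))"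
    by measurable
  have "AE s in lborel. s \<notin> N" using assms by (rule AE_not_in)
  then have "AE s in lborel. t + 1 * s \<notin> N"
    by (intro AE_borel_affine) auto
  then show "AE x in (lborel :: (real ^ 'd) measure). AE s in (lborel :: real measure). t + snd (x, s) \<notin> N" by simp
qed

section \<open>Bounds for translation and convolution\<close>

context cone_weight
begin

text \<open>Cauchy-Schwarz gives \<rho>^2 <= ts, and 2 sqrt(ts) <= t + s. So on the cube all
  arguments of \<open>g\<close> lie in the half-line where \<open>g\<close> is controlled.\<close>

lemma cone_rho_bounds:
  assumes "z \<in> solid_cone" "w \<in> solid_cone" "\<And>i. \<bar>fst p i\<bar> \<le> 1" "\<bar>snd p\<bar> \<le> 1"
  shows "0 \<le> cone_rho z w p" and "0 \<le> snd z + snd w - 2 * cone_rho z w p"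
proof -
  have z: "0 \<le> snd z" "(norm (fst z))\<^sup>2 \<le> (snd z)\<^sup>2" and w: "0 \<le> snd w" "(norm (fst w))\<^sup>2 \<le> (snd w)\<^sup>2"
    using assms(1,2) norm_ge_zero[of "fst z"] norm_ge_zero[of "fst w"]
    by (auto simp: solid_cone_iff simp del: norm_ge_zero intro!: power_mono)
  let ?l = "(\<Sum>i\<in>UNIV. fst z $ i * fst w $ i * fst p i) + sqrt ((snd z)\<^sup>2 - (norm (fst z))\<^sup>2) * sqrt ((snd w)\<^sup>2 - (norm (fst w))\<^sup>2) * snd p"
  have "\<bar>?l\<bar> \<le> sqrt ((norm (fst z))\<^sup>2 + (sqrt ((snd z)\<^sup>2 - (norm (fst z))\<^sup>2))\<^sup>2) * sqrt ((norm (fst w))\<^sup>2 + (sqrt ((snd w)\<^sup>2 - (norm (fst w))\<^sup>2))\<^sup>2)"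
    by (rule abs_bilinear_le) (use assms in auto)
  also have "\<dots> = snd z * snd w" using z w by simp
  finally have l: "\<bar>?l\<bar> \<le> snd z * snd w" .
  have rho: "cone_rho z w p = sqrt ((snd z * snd w + ?l) / 2)" by (simp add: cone_rho_eq add.assoc)
  have "0 \<le> (snd z * snd w + ?l) / 2" "(snd z * snd w + ?l) / 2 \<le> snd z * snd w"
  proof -
    have "0 \<le> (q + m) / 2 \<and> (q + m) / 2 \<le> q" if "\<bar>m\<bar> \<le> q" for q m :: real
      using that by (auto simp: abs_le_iff)
    from this[OF l] show "0 \<le> (snd z * snd w + ?l) / 2" "(snd z * snd w + ?l) / 2 \<le> snd z * snd w" by blast+
  qed
  then have r: "0 \<le> cone_rho z w p" "cone_rho z w p \<le> sqrt (snd z * snd w)"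
    unfolding rho by (simp_all only: real_sqrt_ge_zero real_sqrt_le_mono)
  show "0 \<le> cone_rho z w p" by (rule r(1))
  have "2 * sqrt (snd z * snd w) \<le> snd z + snd w"
    using zero_le_power2[of "sqrt (snd z) - sqrt (snd w)"] z(1) w(1) by (simp add: power2_diff real_sqrt_mult)
  with r(2) show "0 \<le> snd z + snd w - 2 * cone_rho z w p" by linarith
qed

abbreviation "theta_int g z w p \<equiv>
  (LINT \<theta>:{0..pi}|lebesgue. translation_integrand \<alpha> g (snd z + snd w) (cone_rho z w p) \<theta>)"

lemma translation_eq:
  "translation \<kappa> \<mu> z g w = 2 powr (\<alpha> - 1) * Gamma (\<alpha> + 1/2) / sqrt pi * (LINT p|cubeM. theta_int g z w p)"
  by (simp add: translation_def Let_def)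

lemma theta_int_borel:
  assumes [measurable]: "g \<in> borel_measurable borel"
  shows "theta_int g z w p = (LINT \<theta>|lborel. indicator {0..pi} \<theta> *\<^sub>R translation_integrand \<alpha> g (snd z + snd w) (cone_rho z w p) \<theta>)"
  unfolding set_lebesgue_integral_def by (rule integral_completion) measurable

lemma borel_measurable_translation [measurable (raw)]:
  assumes [measurable]: "g \<in> borel_measurable borel" "f1 \<in> measurable M borel" "f2 \<in> measurable M borel"
  shows "(\<lambda>x. translation \<kappa> \<mu> (f1 x) g (f2 x)) \<in> borel_measurable M"
  unfolding translation_eq theta_int_borel[OF assms(1)] by measurable

lemma theta_int_measurable:
  assumes "1/2 \<le> \<alpha>" "g \<in> borel_measurable (lebesgue_on {0..})" "z \<in> solid_cone" "w \<in> solid_cone"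
  shows "(\<lambda>p. theta_int g z w p) \<in> borel_measurable (cubeM)"
proof -
  have "0 \<le> snd z + snd w"
    using assms(3,4) norm_ge_zero[of "fst z"] norm_ge_zero[of "fst w"] unfolding solid_cone_iff by linarith
  then show ?thesis
    by (intro measurable_compose[OF _ theta_integral_measurable[OF assms(1) _ assms(2)]]) measurable
qed

text \<open>The estimate is made for the Borel version \<open>gb\<close>; the passage to
  \<open>g\<close> works for every p in the cube, where the arguments are nonnegative. Finiteness of
  the kernel at (z,w) is what makes the iterated integral converge absolutely.\<close>

lemma translation_bound:
  assumes a: "1/2 \<le> \<alpha>" and g: "g \<in> borel_measurable (lebesgue_on {0..})"
    and gb[measurable]: "gb \<in> borel_measurable borel" and N: "N \<in> null_sets lborel"
    and eq: "\<And>y. 0 \<le> y \<Longrightarrow> y \<notin> N \<Longrightarrow> g y = gb y"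
    and z: "z \<in> solid_cone" and w: "w \<in> solid_cone" and tN: "snd z + snd w \<notin> N"
    and fin: "cone_kernel \<kappa> \<mu> (\<lambda>r. ennreal (\<bar>gb r\<bar> * exp (- r / 2))) z w < \<infinity>"
  shows "translation_exists \<kappa> \<mu> z g w"
    and "translation \<kappa> \<mu> z g w = translation \<kappa> \<mu> z gb w"
    and "ennreal \<bar>translation \<kappa> \<mu> z gb w\<bar> \<le> ennreal (exp ((snd z + snd w) / 2)) * cone_kernel \<kappa> \<mu> (\<lambda>r. ennreal (\<bar>gb r\<bar> * exp (- r / 2))) z w"
proof -
  let ?r = "snd z + snd w" and ?G = "\<lambda>r. ennreal (\<bar>gb r\<bar> * exp (- r / 2))"
  let ?T = "\<lambda>g p \<theta>. translation_integrand \<alpha> g ?r (cone_rho z w p) \<theta>"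
  interpret mu: prob_space "mu_measure \<alpha>" by (rule prob_space_mu_alpha)
  have nN: "negligible N" using N by (simp add: negligible_iff_null_sets null_sets_completionI)
  define c where "c = 2 powr (\<alpha> - 1) * Gamma (\<alpha> + 1/2) / sqrt pi"
  have c: "0 < c" using a unfolding c_def by (intro divide_pos_pos mult_pos_pos Gamma_real_pos) auto
  have gb': "gb \<in> borel_measurable (lebesgue_on {0..})"
    by (intro measurable_restrict_space1 measurable_completion) simp
  have m[measurable]: "(\<lambda>p. theta_int g z w p) \<in> borel_measurable (cubeM)"
    by (rule theta_int_measurable[OF a g z w])
  have mb[measurable]: "(\<lambda>p. theta_int gb z w p) \<in> borel_measurable (cubeM)"
    by (rule theta_int_measurable[OF a gb' z w])
  have cong: "theta_int g z w p = theta_int gb z w p \<and> (set_integrable lebesgue {0..pi} (?T g p) \<longleftrightarrow> set_integrable lebesgue {0..pi} (?T gb p))"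
    if p: "(\<forall>i. \<bar>fst p i\<bar> \<le> 1) \<and> \<bar>snd p\<bar> \<le> 1" for p
  proof -
    have A: "y \<in> {0..}" if "?r - 2 * \<bar>cone_rho z w p\<bar> \<le> y" for y
      using that cone_rho_bounds[OF z w, of p] p by auto
    have e: "g y = gb y" if "y \<in> {0..}" "y \<notin> N" for y using that eq by auto
    show ?thesis
      using theta_integral_cong[of gb N "{0..}" g ?r "cone_rho z w p" \<alpha>, OF gb nN e A] tN by blast
  qed
  have AE_eq: "AE p in cubeM. theta_int g z w p = theta_int gb z w p"
    by (rule eventually_mono[OF AE_cube_bounded]) (use cong in blast)
  show "translation \<kappa> \<mu> z g w = translation \<kappa> \<mu> z gb w"
    unfolding translation_eq by (subst integral_cong_AE[OF m mb AE_eq]) simp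
  let ?N = "\<lambda>p. \<integral>\<^sup>+\<theta>. ennreal (norm (indicator {0..pi} \<theta> *\<^sub>R ?T gb p \<theta>)) \<partial>lborel"
  have bound: "ennreal c * ?N p \<le> ennreal (exp (?r / 2)) * (\<integral>\<^sup>+v. ?G (?r + 2 * cone_rho z w p * v) \<partial>mu_measure \<alpha>)"
    if p: "(\<forall>i. \<bar>fst p i\<bar> \<le> 1) \<and> \<bar>snd p\<bar> \<le> 1" for p
  proof -
    let ?\<rho> = "cone_rho z w p"
    have rho: "0 \<le> ?\<rho>" using cone_rho_bounds(1)[OF z w] p by blast
    let ?K = "rGamma \<alpha> / 2 powr (\<alpha> - 1)"
    have K0: "0 \<le> ?K" using bessel_j_bound[OF a, of 0] by linarith
    then have eK0: "0 \<le> exp (?r / 2) * ?K" by (intro mult_nonneg_nonneg) auto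
    let ?f = "\<lambda>\<theta>. ?G (?r + 2 * ?\<rho> * cos \<theta>) * ennreal (indicator {0..pi} \<theta> * sin \<theta> powr (2 * \<alpha> - 1))"
    have "?N p \<le> (\<integral>\<^sup>+\<theta>. ennreal (exp (?r / 2) * ?K) * ?f \<theta> \<partial>lborel)"
    proof (rule nn_integral_mono)
      fix \<theta> :: real
      show "ennreal (norm (indicator {0..pi} \<theta> *\<^sub>R ?T gb p \<theta>)) \<le> ennreal (exp (?r / 2) * ?K) * ?f \<theta>"
      proof (cases "\<theta> \<in> {0..pi}")
        case True
        then have s: "0 \<le> sin \<theta>" by (intro sin_ge_zero) auto
        let ?y = "?r + 2 * ?\<rho> * cos \<theta>"
        have ex: "exp (- ?\<rho> * cos \<theta>) = exp (?r / 2) * exp (- ?y / 2)"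
          by (simp add: exp_add[symmetric] field_simps)
        have "norm (indicator {0..pi} \<theta> *\<^sub>R ?T gb p \<theta>) = \<bar>gb ?y\<bar> * exp (- ?\<rho> * cos \<theta>) * \<bar>bessel_j (\<alpha> - 1) (?\<rho> * sin \<theta>)\<bar> * sin \<theta> powr (2 * \<alpha> - 1)"
          using True by (simp add: translation_integrand_def abs_mult)
        also have "\<dots> \<le> \<bar>gb ?y\<bar> * exp (- ?\<rho> * cos \<theta>) * ?K * sin \<theta> powr (2 * \<alpha> - 1)"
          using rho s by (intro mult_right_mono mult_left_mono bessel_j_bound[OF a]) auto
        also have "\<dots> = (exp (?r / 2) * ?K) * ((\<bar>gb ?y\<bar> * exp (- ?y / 2)) * sin \<theta> powr (2 * \<alpha> - 1))"
          unfolding ex by (simp only: mult_ac)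
        finally have "ennreal (norm (indicator {0..pi} \<theta> *\<^sub>R ?T gb p \<theta>)) \<le> ennreal \<dots>" by (rule ennreal_leI)
        also have "\<dots> = ennreal (exp (?r / 2) * ?K) * (ennreal (\<bar>gb ?y\<bar> * exp (- ?y / 2)) * ennreal (sin \<theta> powr (2 * \<alpha> - 1)))"
          by (rule trans[OF ennreal_mult'[OF eK0]], rule arg_cong[where f="(*) _"], rule ennreal_mult') simp
        finally show ?thesis using True by simp
      qed simp
    qed
    also have "\<dots> = ennreal (exp (?r / 2) * ?K) * (\<integral>\<^sup>+\<theta>. ?f \<theta> \<partial>lborel)"
      by (rule nn_integral_cmult) measurable
    finally have "ennreal c * ?N p \<le> ennreal c * (ennreal (exp (?r / 2) * ?K) * (\<integral>\<^sup>+\<theta>. ?f \<theta> \<partial>lborel))"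
      by (rule mult_left_mono) simp
    also have "\<dots> = ennreal (exp (?r / 2)) * (ennreal (c * ?K) * (\<integral>\<^sup>+\<theta>. ?f \<theta> \<partial>lborel))"
      using c K0 by (simp only: ennreal_mult' less_imp_le exp_ge_zero mult_ac)
    \<comment> \<open>The remaining factor of C times the maximum of the Bessel factor is the
      normalization of \<open>mu_measure \<alpha>\<close>, so no constant is lost.\<close>
    also have "c * ?K = c_const (\<alpha> - 1/2)"
    proof -
      have "0 < Gamma \<alpha>" using a by (intro Gamma_real_pos) simp
      then show ?thesis by (simp add: c_def c_const_def rGamma_inverse_Gamma Gamma_one_half_real field_simps)
    qed
    also have "ennreal (c_const (\<alpha> - 1/2)) * (\<integral>\<^sup>+\<theta>. ?f \<theta> \<partial>lborel) = (\<integral>\<^sup>+v. ?G (?r + 2 * ?\<rho> * v) \<partial>mu_measure \<alpha>)"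
      using a by (intro nn_integral_cos_subst) auto
    finally show ?thesis .
  qed
  have [measurable]: "?N \<in> borel_measurable (cubeM)" by measurable
  have "ennreal c * (\<integral>\<^sup>+p. ?N p \<partial>cubeM) = (\<integral>\<^sup>+p. ennreal c * ?N p \<partial>cubeM)"
    by (rule nn_integral_cmult[symmetric]) measurable
  also have "\<dots> \<le> (\<integral>\<^sup>+p. ennreal (exp (?r / 2)) * (\<integral>\<^sup>+v. ?G (?r + 2 * cone_rho z w p * v) \<partial>mu_measure \<alpha>) \<partial>cubeM)"
    by (rule nn_integral_mono_AE) (rule eventually_mono[OF AE_cube_bounded bound])
  also have "\<dots> = ennreal (exp (?r / 2)) * cone_kernel \<kappa> \<mu> ?G z w"
    unfolding cone_kernel_def by (rule nn_integral_cmult) measurable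
  finally have total: "ennreal c * (\<integral>\<^sup>+p. ?N p \<partial>cubeM) \<le> \<dots>" .
  have "ennreal c * (\<integral>\<^sup>+p. ?N p \<partial>cubeM) < \<infinity>"
    by (rule le_less_trans[OF total]) (use fin in \<open>simp add: ennreal_mult_less_top\<close>)
  then have finN: "(\<integral>\<^sup>+p. ?N p \<partial>cubeM) < \<infinity>"
    by (rule ennreal_cmult_finiteD[OF c])
  have le: "ennreal (norm (theta_int gb z w p)) \<le> ?N p" for p
  proof (cases "integrable lborel (\<lambda>\<theta>. indicator {0..pi} \<theta> *\<^sub>R ?T gb p \<theta>)")
    case True then show ?thesis unfolding theta_int_borel[OF gb] by (rule integral_norm_bound_ennreal)
  next
    case False then show ?thesis unfolding theta_int_borel[OF gb] by (simp add: not_integrable_integral_eq)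
  qed
  have int_gb: "integrable (cubeM) (\<lambda>p. theta_int gb z w p)"
    by (rule integrableI_bounded[OF mb]) (rule le_less_trans[OF nn_integral_mono[OF le] finN])
  have "ennreal \<bar>translation \<kappa> \<mu> z gb w\<bar> = ennreal c * ennreal (norm (LINT p|cubeM. theta_int gb z w p))"
    using c unfolding translation_eq c_def[symmetric] by (simp add: abs_mult ennreal_mult')
  also have "\<dots> \<le> ennreal c * (\<integral>\<^sup>+p. ennreal (norm (theta_int gb z w p)) \<partial>cubeM)"
    by (intro mult_left_mono integral_norm_bound_ennreal int_gb) simp
  also have "\<dots> \<le> ennreal c * (\<integral>\<^sup>+p. ?N p \<partial>cubeM)"
    by (intro mult_left_mono nn_integral_mono le) simp
  also note total
  finally show "ennreal \<bar>translation \<kappa> \<mu> z gb w\<bar> \<le> ennreal (exp (?r / 2)) * cone_kernel \<kappa> \<mu> ?G z w" .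
  \<comment> \<open>Finiteness of the total integral yields finiteness of the inner one for almost
    every p, which is the first half of \<open>translation_exists\<close>.\<close>
  have AE_N: "AE p in cubeM. ?N p \<noteq> \<infinity>"
    by (rule nn_integral_noteq_infinite) (use finN in auto)
  have "AE p in cubeM. set_integrable lebesgue {0..pi} (?T g p)"
    using AE_N AE_cube_bounded
  proof eventually_elim
    case (elim p)
    have "integrable lborel (\<lambda>\<theta>. indicator {0..pi} \<theta> *\<^sub>R ?T gb p \<theta>)"
      by (rule integrableI_bounded) (use elim(1) in \<open>auto simp: less_top\<close>)
    then have "set_integrable lebesgue {0..pi} (?T gb p)"
      unfolding set_integrable_def by (subst integrable_completion) auto
    then show ?case using cong[OF elim(2)] by blast
  qed
  moreover have "integrable (cubeM) (\<lambda>p. theta_int g z w p)"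
    using int_gb by (subst integrable_cong_AE[OF m mb AE_eq])
  ultimately show "translation_exists \<kappa> \<mu> z g w"
    unfolding translation_exists_def Let_def by simp
qed

end

section \<open>Borel versions and powers of extended reals\<close>

lemma AE_lebesgue_on_iff:
  "S \<in> sets borel \<Longrightarrow> (AE z in lebesgue_on S. P z) \<longleftrightarrow> (AE z in lborel. z \<in> S \<longrightarrow> P z)"
  by (simp add: AE_restrict_space_iff AE_completion_iff)

lemma lebesgue_on_ex_borel:
  fixes f :: "'a::euclidean_space \<Rightarrow> real"
  assumes f: "f \<in> borel_measurable (lebesgue_on S)" and S: "S \<in> sets borel"
  obtains fb N where "fb \<in> borel_measurable borel" "N \<in> null_sets lborel" "\<And>x. x \<in> S \<Longrightarrow> x \<notin> N \<Longrightarrow> f x = fb x"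
proof -
  have "(\<lambda>x. indicator S x *\<^sub>R f x) \<in> borel_measurable lebesgue"
    using f S by (subst (asm) borel_measurable_restrict_space_iff) auto
  then obtain fb where fb: "fb \<in> borel_measurable borel" and ae: "AE x in lborel. indicator S x *\<^sub>R f x = fb x"
    using completion_ex_borel_measurable_real[of _ lborel] by auto
  from ae obtain N where N: "N \<in> null_sets lborel" "{x \<in> space lborel. indicator S x *\<^sub>R f x \<noteq> fb x} \<subseteq> N"
    unfolding eventually_ae_filter by blast
  have "f x = fb x" if "x \<in> S" "x \<notin> N" for x
  proof (rule ccontr)
    assume "f x \<noteq> fb x"
    then have "x \<in> {x \<in> space lborel. indicator S x *\<^sub>R f x \<noteq> fb x}" using that by simp
    then show False using N(2) that(2) by blast
  qed
  with fb N(1) that show thesis by blast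
qed

lemma ennpow_mono:
  assumes "a \<le> b" "0 \<le> r" shows "ennpow a r \<le> ennpow b r"
proof (cases "b = \<infinity>")
  case False
  then have b: "b < \<infinity>" by (simp add: less_top)
  then have "a < \<infinity>" using assms(1) by (rule le_less_trans[rotated])
  then show ?thesis using b assms
    by (auto simp: ennpow_def intro!: ennreal_leI powr_mono2 enn2real_mono)
qed (simp add: ennpow_def)

lemma ennpow_mult_powr:
  assumes "0 \<le> a" "0 < p" "J < \<infinity>"
  shows "ennpow (ennreal (a powr p) * J) (1 / p) = ennpow J (1 / p) * ennreal a"
proof -
  have "ennreal (a powr p) * J < \<infinity>" using assms(3) by (simp add: ennreal_mult_less_top)
  then have "ennpow (ennreal (a powr p) * J) (1 / p) = ennreal ((a powr p * enn2real J) powr (1 / p))"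
    by (simp add: ennpow_def enn2real_mult)
  also have "(a powr p * enn2real J) powr (1 / p) = enn2real J powr (1 / p) * a"
    using assms by (simp add: powr_mult powr_powr)
  also have "ennreal \<dots> = ennpow J (1 / p) * ennreal a"
    using assms by (simp add: ennpow_def ennreal_mult')
  finally show ?thesis .
qed

section \<open>Young's inequality on the cone\<close>

context cone_weight
begin

text \<open>The factor exp(-t) of \<open>cone_W\<close> is left out: half of it goes with
  \<open>f\<close>, half with the translation, so that all norms refer to this one measure.\<close>

definition cone_measure :: "((real ^ 'd) \<times> real) measure" where
  "cone_measure = density lborel (\<lambda>z. ennreal (cone_b \<kappa> \<mu> * (indicator solid_cone z * cone_u \<kappa> \<mu> z)))"

lemma sets_cone_measure [measurable_cong, simp]: "sets cone_measure = sets borel"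
  by (simp add: cone_measure_def)

lemma nn_integral_cone_measure:
  assumes [measurable]: "\<phi> \<in> borel_measurable borel"
  shows "(\<integral>\<^sup>+z. \<phi> z \<partial>cone_measure) = ennreal (cone_b \<kappa> \<mu>) * (\<integral>\<^sup>+z. \<phi> z * cone_weight_at z \<partial>lborel)"
proof -
  have "(\<integral>\<^sup>+z. \<phi> z \<partial>cone_measure) = (\<integral>\<^sup>+z. ennreal (cone_b \<kappa> \<mu>) * (\<phi> z * cone_weight_at z) \<partial>lborel)"
    unfolding cone_measure_def
    by (subst nn_integral_density, measurable)
       (simp only: ennreal_mult'[OF less_imp_le[OF cone_b_pos]] mult_ac)
  also have "\<dots> = ennreal (cone_b \<kappa> \<mu>) * (\<integral>\<^sup>+z. \<phi> z * cone_weight_at z \<partial>lborel)"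
    by (rule nn_integral_cmult) measurable
  finally show ?thesis .
qed

text \<open>The density is positive almost everywhere on the cone, so both measures have the same
  null sets there.\<close>

lemma AE_cone_measure_iff: "(AE z in cone_measure. P z) \<longleftrightarrow> (AE z in lborel. z \<in> solid_cone \<longrightarrow> P z)"
proof -
  have "(AE z in cone_measure. P z) \<longleftrightarrow> (AE z in lborel. 0 < ennreal (cone_b \<kappa> \<mu> * (indicator solid_cone z * cone_u \<kappa> \<mu> z)) \<longrightarrow> P z)"
    unfolding cone_measure_def by (rule AE_density) measurable
  also have "\<dots> \<longleftrightarrow> (AE z in lborel. z \<in> solid_cone \<longrightarrow> P z)"
  proof
    assume "AE z in lborel. 0 < ennreal (cone_b \<kappa> \<mu> * (indicator solid_cone z * cone_u \<kappa> \<mu> z)) \<longrightarrow> P z"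
    with AE_cone_u_pos[of \<kappa> \<mu>] show "AE z in lborel. z \<in> solid_cone \<longrightarrow> P z"
      by eventually_elim (auto simp: cone_b_pos)
  next
    assume "AE z in lborel. z \<in> solid_cone \<longrightarrow> P z"
    then show "AE z in lborel. 0 < ennreal (cone_b \<kappa> \<mu> * (indicator solid_cone z * cone_u \<kappa> \<mu> z)) \<longrightarrow> P z"
      by (rule eventually_mono) (auto split: split_indicator_asm)
  qed
  finally show ?thesis .
qed

lemma sigma_finite_cone_measure: "sigma_finite_measure cone_measure"
  unfolding cone_measure_def by (subst sigma_finite_measure.sigma_finite_iff_density_finite[OF sigma_finite_lborel]) auto

lemma cone_norm_finite_eq:
  assumes p: "p \<noteq> \<infinity>"
  shows "cone_norm \<kappa> \<mu> p f = ennpow (ennreal (cone_b \<kappa> \<mu>) *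
     (\<integral>\<^sup>+z. ennreal ((\<bar>f z\<bar> * exp (- snd z / 2)) powr enn2real p) * cone_weight_at z \<partial>lborel)) (1 / enn2real p)"
proof -
  have "(\<integral>\<^sup>+z\<in>solid_cone. ennreal (\<bar>f z * exp (- snd z / 2)\<bar> powr enn2real p * cone_u \<kappa> \<mu> z) \<partial>lebesgue)
     = (\<integral>\<^sup>+z. ennreal ((\<bar>f z\<bar> * exp (- snd z / 2)) powr enn2real p) * cone_weight_at z \<partial>lborel)"
    unfolding nn_integral_completion
    by (rule nn_integral_cong) (auto simp: abs_mult ennreal_mult' split: split_indicator)
  then show ?thesis using p by (simp add: cone_norm_def)
qed

lemma halfline_norm1_eq:
  "halfline_norm1 a g = ennreal (1 / Gamma (a + 1)) *
     (\<integral>\<^sup>+r. power_weight a r * ennreal (\<bar>g r\<bar> * exp (- r / 2)) \<partial>lborel)"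
proof -
  have "(\<integral>\<^sup>+t\<in>{0..}. ennreal (\<bar>g t\<bar> * exp (- t / 2) * t powr a) \<partial>lebesgue)
     = (\<integral>\<^sup>+r. power_weight a r * ennreal (\<bar>g r\<bar> * exp (- r / 2)) \<partial>lborel)"
    unfolding nn_integral_completion
    by (rule nn_integral_cong) (auto simp: ennreal_mult'[symmetric] mult_ac split: split_indicator)
  then show ?thesis by (simp add: halfline_norm1_def)
qed

text \<open>All four claims hold at every point z of the cone: the exceptional w form a null set for
  each fixed z. The kernel integral is finite, so K(z,w) is finite for almost every w and
  \<open>translation_bound\<close> applies.\<close>

lemma pseudo_conv_bound:
  fixes f :: "(real ^ 'd) \<times> real \<Rightarrow> real"
  assumes a: "1/2 \<le> \<alpha>" and g: "g \<in> borel_measurable (lebesgue_on {0..})"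
    and f: "f \<in> borel_measurable (lebesgue_on solid_cone)"
    and gb[measurable]: "gb \<in> borel_measurable borel" and N: "N \<in> null_sets lborel"
    and eq: "\<And>y. 0 \<le> y \<Longrightarrow> y \<notin> N \<Longrightarrow> g y = gb y"
    and fb[measurable]: "fb \<in> borel_measurable borel" and feq: "AE w in lborel. w \<in> solid_cone \<longrightarrow> f w = fb w"
    and z: "z \<in> solid_cone"
    and fin: "halfline_norm1 (2 * \<alpha>) g < \<infinity>"
  defines "K \<equiv> cone_kernel \<kappa> \<mu> (\<lambda>r. ennreal (\<bar>gb r\<bar> * exp (- r / 2)))"
  shows "(\<integral>\<^sup>+w. K z w \<partial>cone_measure) = halfline_norm1 (2 * \<alpha>) g"
    and "pseudo_conv \<kappa> \<mu> f g z = pseudo_conv \<kappa> \<mu> fb gb z"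
    and "ennreal (\<bar>pseudo_conv \<kappa> \<mu> f g z\<bar> * exp (- snd z / 2)) \<le> (\<integral>\<^sup>+w. ennreal (\<bar>fb w\<bar> * exp (- snd w / 2)) * K z w \<partial>cone_measure)"
    and "(\<integral>\<^sup>+w. ennreal (\<bar>fb w\<bar> * exp (- snd w / 2)) * K z w \<partial>cone_measure) < \<infinity> \<Longrightarrow> pseudo_conv_exists \<kappa> \<mu> f g z"
proof -
  let ?G = "\<lambda>r. ennreal (\<bar>gb r\<bar> * exp (- r / 2))"
  have K_meas[measurable]: "(\<lambda>w. K z w) \<in> borel_measurable borel" unfolding K_def by measurable
  have [measurable]: "(\<lambda>w. snd w) \<in> borel_measurable (borel :: ((real ^ 'd) \<times> real) measure)" by measurable
  have "(\<integral>\<^sup>+w. K z w \<partial>cone_measure) = ennreal (1 / Gamma (2 * \<alpha> + 1)) * (\<integral>\<^sup>+r. power_weight (2 * \<alpha>) r * ?G r \<partial>lborel)"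
    unfolding K_def
    by (subst nn_integral_cone_measure, measurable) (rule nn_integral_cone_kernel_normalized[OF _ z], measurable)
  also have "(\<integral>\<^sup>+r. power_weight (2 * \<alpha>) r * ?G r \<partial>lborel)
     = (\<integral>\<^sup>+r. power_weight (2 * \<alpha>) r * ennreal (\<bar>g r\<bar> * exp (- r / 2)) \<partial>lborel)"
    by (rule nn_integral_cong_AE, rule eventually_mono[OF AE_not_in[OF N]]) (auto simp: eq split: split_indicator)
  finally show KA: "(\<integral>\<^sup>+w. K z w \<partial>cone_measure) = halfline_norm1 (2 * \<alpha>) g"
    by (simp add: halfline_norm1_eq)
  have "AE w in cone_measure. K z w \<noteq> \<infinity>"
    by (rule nn_integral_noteq_infinite) (use KA fin in auto)
  then have "AE w in lborel. w \<in> solid_cone \<longrightarrow> K z w \<noteq> \<infinity>" by (simp only: AE_cone_measure_iff)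
  with AE_snd_notin_null[OF N, of "snd z"]
  have tr: "AE w in lborel. w \<in> solid_cone \<longrightarrow> translation_exists \<kappa> \<mu> z g w \<and> translation \<kappa> \<mu> z g w = translation \<kappa> \<mu> z gb w
      \<and> ennreal \<bar>translation \<kappa> \<mu> z gb w\<bar> \<le> ennreal (exp ((snd z + snd w) / 2)) * K z w"
  proof eventually_elim
    case (elim w)
    show ?case
    proof
      assume w: "w \<in> solid_cone"
      have "K z w < \<infinity>" using elim(2) w by (simp add: less_top)
      then show "translation_exists \<kappa> \<mu> z g w \<and> translation \<kappa> \<mu> z g w = translation \<kappa> \<mu> z gb w
        \<and> ennreal \<bar>translation \<kappa> \<mu> z gb w\<bar> \<le> ennreal (exp ((snd z + snd w) / 2)) * K z w"
        using translation_bound[OF a g gb N eq z w elim(1)] unfolding K_def by blast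
    qed
  qed
  let ?I = "\<lambda>f g w. indicator solid_cone w *\<^sub>R (f w * translation \<kappa> \<mu> z g w * cone_W \<kappa> \<mu> w)"
  have mb: "?I fb gb \<in> borel_measurable borel" by measurable
  then have mb': "?I fb gb \<in> borel_measurable lebesgue" by (intro measurable_completion) simp
  have "AE w in lborel. ?I fb gb w = ?I f g w"
    using tr feq by eventually_elim (auto split: split_indicator)
  then have I_eq: "AE w in lebesgue. ?I fb gb w = ?I f g w" by (rule AE_completion)
  \<comment> \<open>Measurability of the integrand with the original \<open>f\<close> and
    \<open>g\<close> is inherited from its Borel version through completeness of
    \<open>lebesgue\<close>.\<close>
  have m': "?I f g \<in> borel_measurable lebesgue"
    by (rule borel_measurable_lebesgue_AE_eq[OF mb' I_eq])
  have I_eq': "AE w in lebesgue. ?I f g w = ?I fb gb w"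
    using I_eq by (rule eventually_mono) (rule sym)
  have L: "(LINT w:solid_cone|lebesgue. f w * translation \<kappa> \<mu> z g w * cone_W \<kappa> \<mu> w) = (LINT w|lborel. ?I fb gb w)"
    unfolding set_lebesgue_integral_def
    using integral_cong_AE[OF m' mb' I_eq'] integral_completion[of "?I fb gb" lborel] mb by simp
  have Lb: "(LINT w:solid_cone|lebesgue. fb w * translation \<kappa> \<mu> z gb w * cone_W \<kappa> \<mu> w) = (LINT w|lborel. ?I fb gb w)"
    unfolding set_lebesgue_integral_def
    using integral_completion[of "?I fb gb" lborel] mb by simp
  show "pseudo_conv \<kappa> \<mu> f g z = pseudo_conv \<kappa> \<mu> fb gb z"
    unfolding pseudo_conv_def L Lb ..
  let ?h = "\<integral>\<^sup>+w. ennreal (\<bar>fb w\<bar> * exp (- snd w / 2)) * K z w \<partial>cone_measure"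
  let ?H = "\<integral>\<^sup>+w. (ennreal (\<bar>fb w\<bar> * exp (- snd w / 2)) * K z w) * cone_weight_at w \<partial>lborel"
  have h: "?h = ennreal (cone_b \<kappa> \<mu>) * ?H"
    by (rule nn_integral_cone_measure) measurable
  have I_le: "(\<integral>\<^sup>+w. ennreal (norm (?I fb gb w)) \<partial>lborel) \<le> ennreal (exp (snd z / 2)) * ?H"
  proof -
    have "(\<integral>\<^sup>+w. ennreal (norm (?I fb gb w)) \<partial>lborel) \<le> (\<integral>\<^sup>+w. ennreal (exp (snd z / 2)) *
       ((ennreal (\<bar>fb w\<bar> * exp (- snd w / 2)) * K z w) * cone_weight_at w) \<partial>lborel)"
    proof (rule nn_integral_mono_AE, rule eventually_mono[OF tr])
      fix w assume w: "w \<in> solid_cone \<longrightarrow> translation_exists \<kappa> \<mu> z g w \<and> translation \<kappa> \<mu> z g w = translation \<kappa> \<mu> z gb w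
        \<and> ennreal \<bar>translation \<kappa> \<mu> z gb w\<bar> \<le> ennreal (exp ((snd z + snd w) / 2)) * K z w"
      show "ennreal (norm (?I fb gb w)) \<le> ennreal (exp (snd z / 2)) *
         ((ennreal (\<bar>fb w\<bar> * exp (- snd w / 2)) * K z w) * cone_weight_at w)"
      proof (cases "w \<in> solid_cone")
        case True
        have u: "0 \<le> \<bar>fb w\<bar> * cone_W \<kappa> \<mu> w" by (simp add: cone_W_eq cone_u_nonneg)
        have "ennreal (norm (?I fb gb w)) = ennreal ((\<bar>fb w\<bar> * cone_W \<kappa> \<mu> w) * \<bar>translation \<kappa> \<mu> z gb w\<bar>)"
          using True by (simp add: abs_mult cone_W_eq cone_u_nonneg mult_ac)
        also have "\<dots> = ennreal (\<bar>fb w\<bar> * cone_W \<kappa> \<mu> w) * ennreal \<bar>translation \<kappa> \<mu> z gb w\<bar>"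
          by (rule ennreal_mult'[OF u])
        also have "\<dots> \<le> ennreal (\<bar>fb w\<bar> * cone_W \<kappa> \<mu> w) * (ennreal (exp ((snd z + snd w) / 2)) * K z w)"
          using w True by (intro mult_left_mono) auto
        also have "\<dots> = ennreal (\<bar>fb w\<bar> * cone_W \<kappa> \<mu> w * exp ((snd z + snd w) / 2)) * K z w"
          using ennreal_mult'[OF u] by (simp add: mult.assoc)
        \<comment> \<open>The exponentials balance as exp(-s) exp((t+s)/2) = exp(t/2) exp(-s/2): the
          first factor is undone by the weight of the norm at z, the second is the one belonging to
          \<open>f\<close>.\<close>
        also have "\<bar>fb w\<bar> * cone_W \<kappa> \<mu> w * exp ((snd z + snd w) / 2) = exp (snd z / 2) * ((\<bar>fb w\<bar> * exp (- snd w / 2)) * cone_u \<kappa> \<mu> w)"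
        proof -
          have "exp (- snd w) * exp ((snd z + snd w) / 2) = exp (snd z / 2) * exp (- snd w / 2)"
            by (simp add: exp_add[symmetric] field_simps)
          then show ?thesis by (simp add: cone_W_eq mult_ac)
        qed
        also have "ennreal \<dots> = ennreal (exp (snd z / 2)) * (ennreal (\<bar>fb w\<bar> * exp (- snd w / 2)) * ennreal (cone_u \<kappa> \<mu> w))"
          by (rule trans[OF ennreal_mult'], simp, rule arg_cong[where f="(*) _"], rule ennreal_mult') simp
        also have "\<dots> * K z w = ennreal (exp (snd z / 2)) * ((ennreal (\<bar>fb w\<bar> * exp (- snd w / 2)) * K z w) * ennreal (cone_u \<kappa> \<mu> w))"
          by (simp only: mult_ac)
        finally show ?thesis using True by simp
      qed simp
    qed
    also have "\<dots> = ennreal (exp (snd z / 2)) * ?H"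
      by (rule nn_integral_cmult) measurable
    finally show ?thesis .
  qed
  show "ennreal (\<bar>pseudo_conv \<kappa> \<mu> f g z\<bar> * exp (- snd z / 2)) \<le> ?h"
  proof -
    have "ennreal \<bar>LINT w|lborel. ?I fb gb w\<bar> \<le> (\<integral>\<^sup>+w. ennreal (norm (?I fb gb w)) \<partial>lborel)"
    proof (cases "integrable lborel (?I fb gb)")
      case True
      then show ?thesis using integral_norm_bound_ennreal[OF True] by (simp only: real_norm_def)
    next
      case False
      show ?thesis unfolding not_integrable_integral_eq[OF False] by simp
    qed
    also note I_le
    finally have le: "ennreal \<bar>LINT w|lborel. ?I fb gb w\<bar> \<le> ennreal (exp (snd z / 2)) * ?H" .
    have b: "0 \<le> exp (- snd z / 2) * cone_b \<kappa> \<mu>" using cone_b_pos by simp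
    have "ennreal (\<bar>pseudo_conv \<kappa> \<mu> f g z\<bar> * exp (- snd z / 2)) = ennreal ((exp (- snd z / 2) * cone_b \<kappa> \<mu>) * \<bar>LINT w|lborel. ?I fb gb w\<bar>)"
      unfolding pseudo_conv_def L using cone_b_pos by (simp only: abs_mult abs_of_pos mult_ac)
    also have "\<dots> = ennreal (exp (- snd z / 2) * cone_b \<kappa> \<mu>) * ennreal \<bar>LINT w|lborel. ?I fb gb w\<bar>"
      by (rule ennreal_mult'[OF b])
    also have "\<dots> \<le> ennreal (exp (- snd z / 2) * cone_b \<kappa> \<mu>) * (ennreal (exp (snd z / 2)) * ?H)"
      by (intro mult_left_mono le) simp
    also have "\<dots> = ennreal ((exp (- snd z / 2) * cone_b \<kappa> \<mu>) * exp (snd z / 2)) * ?H"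
      using ennreal_mult'[OF b] by (simp add: mult.assoc)
    also have "(exp (- snd z / 2) * cone_b \<kappa> \<mu>) * exp (snd z / 2) = cone_b \<kappa> \<mu>"
      by (simp add: exp_minus field_simps)
    finally show ?thesis unfolding h .
  qed
  show "pseudo_conv_exists \<kappa> \<mu> f g z" if hfin: "?h < \<infinity>"
  proof -
    have "?H < \<infinity>"
      using hfin unfolding h by (rule ennreal_cmult_finiteD[OF cone_b_pos])
    then have "(\<integral>\<^sup>+w. ennreal (norm (?I fb gb w)) \<partial>lborel) < \<infinity>"
      by (intro le_less_trans[OF I_le]) (simp add: ennreal_mult_less_top)
    then have "integrable lborel (?I fb gb)"
      using mb by (intro integrableI_bounded) auto
    then have "integrable lebesgue (?I fb gb)"
      using mb by (subst integrable_completion) auto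
    then have "integrable lebesgue (?I f g)"
      by (subst integrable_cong_AE[OF m' mb' I_eq'])
    then have "set_integrable lebesgue solid_cone (\<lambda>w. f w * translation \<kappa> \<mu> z g w * cone_W \<kappa> \<mu> w)"
      by (simp only: set_integrable_def)
    moreover have "AE w in lebesgue_on solid_cone. translation_exists \<kappa> \<mu> z g w"
      unfolding AE_lebesgue_on_iff[OF sets_solid_cone] using tr by (rule eventually_mono) blast
    ultimately show ?thesis by (simp add: pseudo_conv_exists_def)
  qed
qed

text \<open>The function \<open>h\<close> dominates the weighted convolution pointwise. Its
  finiteness gives existence of the convolution integral, and its norm gives the inequality.\<close>

theorem pseudo_conv_young:
  fixes f :: "(real ^ 'd) \<times> real \<Rightarrow> real"
  assumes a: "1/2 \<le> \<alpha>" and p: "1 \<le> p"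
    and f: "f \<in> cone_Lp \<kappa> \<mu> p" and g: "g \<in> halfline_L1 (2 * \<alpha>)"
  shows "(AE z in lebesgue_on solid_cone. pseudo_conv_exists \<kappa> \<mu> f g z)
    \<and> pseudo_conv \<kappa> \<mu> f g \<in> cone_Lp \<kappa> \<mu> p
    \<and> cone_norm \<kappa> \<mu> p (pseudo_conv \<kappa> \<mu> f g) \<le> cone_norm \<kappa> \<mu> p f * halfline_norm1 (2 * \<alpha>) g"
proof -
  have gm: "g \<in> borel_measurable (lebesgue_on {0..})" and gfin: "halfline_norm1 (2 * \<alpha>) g < \<infinity>"
    using g by (auto simp: halfline_L1_def)
  have fm: "f \<in> borel_measurable (lebesgue_on solid_cone)" and ffin: "cone_norm \<kappa> \<mu> p f < \<infinity>"
    using f by (auto simp: cone_Lp_def)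
  obtain gb N where gb[measurable]: "gb \<in> borel_measurable borel" and N: "N \<in> null_sets lborel"
    and geq: "\<And>y. y \<in> {0..} \<Longrightarrow> y \<notin> N \<Longrightarrow> g y = gb y"
    using lebesgue_on_ex_borel[OF gm] by auto
  have geq': "g y = gb y" if "0 \<le> y" "y \<notin> N" for y using geq that by auto
  obtain fb Nf where fb[measurable]: "fb \<in> borel_measurable borel" and Nf: "Nf \<in> null_sets lborel"
    and feq: "\<And>w. w \<in> solid_cone \<Longrightarrow> w \<notin> Nf \<Longrightarrow> f w = fb w"
    using lebesgue_on_ex_borel[OF fm sets_solid_cone] by blast
  have fae: "AE w in lborel. w \<in> solid_cone \<longrightarrow> f w = fb w"
    using AE_not_in[OF Nf] by (rule eventually_mono) (use feq in blast)
  define A where "A = enn2real (halfline_norm1 (2 * \<alpha>) g)"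
  have A: "halfline_norm1 (2 * \<alpha>) g = ennreal A" and A0: "0 \<le> A"
    using gfin by (auto simp: A_def less_top)
  define K where "K = cone_kernel \<kappa> \<mu> (\<lambda>r. ennreal (\<bar>gb r\<bar> * exp (- r / 2)))"
  have K_meas[measurable (raw)]: "f1 \<in> measurable M borel \<Longrightarrow> f2 \<in> measurable M borel \<Longrightarrow> (\<lambda>x. K (f1 x) (f2 x)) \<in> borel_measurable M"
    for M :: "'c measure" and f1 f2 :: "'c \<Rightarrow> (real ^ 'd) \<times> real" unfolding K_def by measurable
  define F where "F = (\<lambda>w. \<bar>fb w\<bar> * exp (- snd w / 2))"
  have F_meas[measurable]: "F \<in> borel_measurable borel" unfolding F_def by measurable
  have F0: "0 \<le> F w" for w by (simp add: F_def)
  define h where "h = (\<lambda>z. \<integral>\<^sup>+w. ennreal (F w) * K z w \<partial>cone_measure)"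
  have KA: "(\<integral>\<^sup>+w. K z w \<partial>cone_measure) = ennreal A" if "z \<in> solid_cone" for z
    unfolding K_def A[symmetric]
    by (rule pseudo_conv_bound(1)[OF a gm fm gb N _ fb fae that gfin]) (rule geq')
  have conv_eq: "pseudo_conv \<kappa> \<mu> f g z = pseudo_conv \<kappa> \<mu> fb gb z" if "z \<in> solid_cone" for z
    by (rule pseudo_conv_bound(2)[OF a gm fm gb N _ fb fae that gfin]) (rule geq')
  have conv_le: "ennreal (\<bar>pseudo_conv \<kappa> \<mu> f g z\<bar> * exp (- snd z / 2)) \<le> h z" if "z \<in> solid_cone" for z
    unfolding h_def K_def F_def
    by (rule pseudo_conv_bound(3)[OF a gm fm gb N _ fb fae that gfin]) (rule geq')
  have conv_ex: "pseudo_conv_exists \<kappa> \<mu> f g z" if "z \<in> solid_cone" "h z < \<infinity>" for z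
    by (rule pseudo_conv_bound(4)[OF a gm fm gb N _ fb fae that(1) gfin])
       (rule geq', assumption+, use that(2) in \<open>simp only: h_def K_def F_def\<close>)
  have conv_b_meas[measurable]: "(\<lambda>z. pseudo_conv \<kappa> \<mu> fb gb z) \<in> borel_measurable borel"
  proof -
    have "pseudo_conv \<kappa> \<mu> fb gb z = cone_b \<kappa> \<mu> * (LINT w|lborel. indicator solid_cone w *\<^sub>R (fb w * translation \<kappa> \<mu> z gb w * cone_W \<kappa> \<mu> w))" for z
      unfolding pseudo_conv_def set_lebesgue_integral_def by (subst integral_completion) measurable
    then show ?thesis by (simp only:) measurable
  qed
  \<comment> \<open>\<open>conv_eq\<close> holds at every point of the cone, so measurability
    carries over directly from the convolution of the Borel versions.\<close>
  have conv_meas: "pseudo_conv \<kappa> \<mu> f g \<in> borel_measurable (lebesgue_on solid_cone)"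
  proof -
    have "pseudo_conv \<kappa> \<mu> fb gb \<in> borel_measurable (lebesgue_on solid_cone)"
      by (intro measurable_restrict_space1 measurable_completion) simp
    then show ?thesis
      by (rule iffD2[OF measurable_cong, rotated]) (simp add: space_restrict_space conv_eq)
  qed
  interpret m: sigma_finite_measure cone_measure by (rule sigma_finite_cone_measure)
  interpret mm: pair_sigma_finite cone_measure cone_measure ..
  have ae_cone: "AE z in cone_measure. z \<in> solid_cone"
    by (simp add: AE_cone_measure_iff)
  have "(AE z in lebesgue_on solid_cone. pseudo_conv_exists \<kappa> \<mu> f g z)
    \<and> cone_norm \<kappa> \<mu> p (pseudo_conv \<kappa> \<mu> f g) \<le> cone_norm \<kappa> \<mu> p f * ennreal A"
  proof (cases "p = \<infinity>")
    case True
    define S where "S = cone_norm \<kappa> \<mu> p f"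
    have S: "S = esssup (lebesgue_on solid_cone) (\<lambda>(x, t). ennreal (\<bar>f (x, t)\<bar> * exp (- t / 2)))"
      using True by (simp add: S_def cone_norm_def)
    have "AE z in lebesgue_on solid_cone. (\<lambda>(x, t). ennreal (\<bar>f (x, t)\<bar> * exp (- t / 2))) z \<le> S"
      unfolding S by (rule esssup_AE)
    then have "AE z in lborel. z \<in> solid_cone \<longrightarrow> ennreal (\<bar>f z\<bar> * exp (- snd z / 2)) \<le> S"
      unfolding AE_lebesgue_on_iff[OF sets_solid_cone] by (rule eventually_mono) (auto simp: split_beta)
    with fae have FS: "AE z in cone_measure. ennreal (F z) \<le> S"
      unfolding AE_cone_measure_iff by eventually_elim (auto simp: F_def)
    \<comment> \<open>For p = \<infinity> the essential bound of \<open>f\<close> is pulled out of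
      the integral, and the bound on \<open>h\<close> holds at every z.\<close>
    have hS: "h z \<le> S * ennreal A" if "z \<in> solid_cone" for z
    proof -
      have "h z \<le> (\<integral>\<^sup>+w. S * K z w \<partial>cone_measure)"
        unfolding h_def by (rule nn_integral_mono_AE, rule eventually_mono[OF FS]) (auto intro: mult_right_mono)
      also have "\<dots> = S * ennreal A"
        by (subst nn_integral_cmult, measurable) (simp add: KA[OF that])
      finally show ?thesis .
    qed
    have fin: "S * ennreal A < \<infinity>" using ffin by (simp add: S_def[symmetric] ennreal_mult_less_top)
    have "AE z in lebesgue_on solid_cone. pseudo_conv_exists \<kappa> \<mu> f g z"
      unfolding AE_lebesgue_on_iff[OF sets_solid_cone]
      by (rule AE_I2) (auto intro!: conv_ex le_less_trans[OF hS fin])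
    moreover have "esssup (lebesgue_on solid_cone) (\<lambda>(x, t). ennreal (\<bar>pseudo_conv \<kappa> \<mu> f g (x, t)\<bar> * exp (- t / 2))) \<le> S * ennreal A"
    proof (rule esssup_I)
      have "(\<lambda>z. snd z) \<in> borel_measurable (lebesgue_on (solid_cone :: ((real ^ 'd) \<times> real) set))"
        by (intro measurable_restrict_space1 measurable_completion) simp
      then show "(\<lambda>(x, t). ennreal (\<bar>pseudo_conv \<kappa> \<mu> f g (x, t)\<bar> * exp (- t / 2))) \<in> borel_measurable (lebesgue_on solid_cone)"
        using conv_meas unfolding split_beta prod.collapse by measurable
      show "AE z in lebesgue_on solid_cone. (case z of (x, t) \<Rightarrow> ennreal (\<bar>pseudo_conv \<kappa> \<mu> f g (x, t)\<bar> * exp (- t / 2))) \<le> S * ennreal A"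
        unfolding AE_lebesgue_on_iff[OF sets_solid_cone]
      proof (rule AE_I2, rule impI)
        fix z :: "(real ^ 'd) \<times> real" assume z: "z \<in> solid_cone"
        show "(case z of (x, t) \<Rightarrow> ennreal (\<bar>pseudo_conv \<kappa> \<mu> f g (x, t)\<bar> * exp (- t / 2))) \<le> S * ennreal A"
          using order_trans[OF conv_le[OF z] hS[OF z]] by (simp add: split_beta)
      qed
    qed
    ultimately show ?thesis unfolding S_def[symmetric] using True by (simp add: cone_norm_def)
  next
    case False
    define P where "P = enn2real p"
    have pP: "p = ennreal P" using False by (simp add: P_def less_top)
    have P: "1 \<le> P" using p unfolding pP by (metis ennreal_1 ennreal_le_iff2 not_one_le_zero)
    define J where "J = (\<integral>\<^sup>+w. ennreal (F w powr P) \<partial>cone_measure)"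
    define I where "I = (\<lambda>z. \<integral>\<^sup>+w. ennreal (F w powr P) * K z w \<partial>cone_measure)"
    have norm_f: "cone_norm \<kappa> \<mu> p f = ennpow J (1 / P)"
    proof -
      have "(\<integral>\<^sup>+z. ennreal ((\<bar>f z\<bar> * exp (- snd z / 2)) powr P) * cone_weight_at z \<partial>lborel)
         = (\<integral>\<^sup>+z. ennreal (F z powr P) * cone_weight_at z \<partial>lborel)"
        by (rule nn_integral_cong_AE, rule eventually_mono[OF fae]) (auto simp: F_def split: split_indicator)
      then show ?thesis
        unfolding cone_norm_finite_eq[OF False] J_def P_def[symmetric]
        by (subst nn_integral_cone_measure) auto
    qed
    have J: "J < \<infinity>" using ffin unfolding norm_f by (auto simp: ennpow_def less_top split: if_splits)
    \<comment> \<open>After Tonelli the kernel is integrated in its first argument; symmetry of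
      \<open>cone_kernel\<close> reduces this to the known integral in the second.\<close>
    have I_total: "(\<integral>\<^sup>+z. I z \<partial>cone_measure) = ennreal A * J"
    proof -
      have "(\<integral>\<^sup>+z. I z \<partial>cone_measure) = (\<integral>\<^sup>+w. \<integral>\<^sup>+z. ennreal (F w powr P) * K z w \<partial>cone_measure \<partial>cone_measure)"
        unfolding I_def by (rule mm.Fubini') measurable
      also have "\<dots> = (\<integral>\<^sup>+w. ennreal A * ennreal (F w powr P) \<partial>cone_measure)"
      proof (rule nn_integral_cong_AE, rule eventually_mono[OF ae_cone])
        fix w :: "(real ^ 'd) \<times> real" assume w: "w \<in> solid_cone"
        have "(\<integral>\<^sup>+z. ennreal (F w powr P) * K z w \<partial>cone_measure) = ennreal (F w powr P) * (\<integral>\<^sup>+z. K z w \<partial>cone_measure)"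
          by (rule nn_integral_cmult) measurable
        also have "(\<integral>\<^sup>+z. K z w \<partial>cone_measure) = ennreal A"
          unfolding KA[OF w, symmetric] K_def by (subst cone_kernel_commute) (rule refl)
        finally show "(\<integral>\<^sup>+z. ennreal (F w powr P) * K z w \<partial>cone_measure) = ennreal A * ennreal (F w powr P)"
          by (simp only: mult.commute)
      qed
      also have "\<dots> = ennreal A * J" unfolding J_def by (rule nn_integral_cmult) measurable
      finally show ?thesis .
    qed
    have I_meas[measurable]: "I \<in> borel_measurable borel" unfolding I_def by measurable
    have h_meas[measurable]: "h \<in> borel_measurable borel" unfolding h_def by measurable
    \<comment> \<open>Since \<open>I\<close> has finite integral it is finite almost everywhere; the
      power inequality then makes \<open>h\<close> finite there too, which is how existence is
      obtained for p < \<infinity>.\<close>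
    have "AE z in cone_measure. I z \<noteq> \<infinity>"
      by (rule nn_integral_noteq_infinite) (use I_total J in \<open>auto simp: ennreal_mult_eq_top_iff\<close>)
    with ae_cone have hP: "AE z in cone_measure. z \<in> solid_cone \<and> h z < \<infinity> \<and> ennreal (enn2real (h z) powr P) \<le> ennreal (A powr (P - 1)) * I z"
    proof eventually_elim
      case (elim z)
      have k: "(\<integral>\<^sup>+w. K z w \<partial>cone_measure) \<le> ennreal A" using KA[OF elim(1)] by simp
      have i: "(\<integral>\<^sup>+w. ennreal (F w powr P) * K z w \<partial>cone_measure) < \<infinity>"
        using elim(2) by (simp add: I_def less_top)
      show ?case
        using nn_integral_power_le[OF _ _ F0 P A0 k i] elim(1) unfolding h_def I_def by auto
    qed
    then have "AE z in cone_measure. pseudo_conv_exists \<kappa> \<mu> f g z"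
      by (rule eventually_mono) (use conv_ex in blast)
    then have ex: "AE z in lebesgue_on solid_cone. pseudo_conv_exists \<kappa> \<mu> f g z"
      by (simp only: AE_cone_measure_iff AE_lebesgue_on_iff[OF sets_solid_cone])
    let ?c = "\<lambda>z. \<bar>pseudo_conv \<kappa> \<mu> fb gb z\<bar> * exp (- snd z / 2)"
    have "(\<integral>\<^sup>+z. ennreal (?c z powr P) \<partial>cone_measure) \<le> (\<integral>\<^sup>+z. ennreal (A powr (P - 1)) * I z \<partial>cone_measure)"
    proof (rule nn_integral_mono_AE, rule eventually_mono[OF hP])
      fix z assume z: "z \<in> solid_cone \<and> h z < \<infinity> \<and> ennreal (enn2real (h z) powr P) \<le> ennreal (A powr (P - 1)) * I z"
      have "ennreal (?c z) \<le> h z" using conv_le[of z] conv_eq[of z] z by simp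
      then have "?c z \<le> enn2real (h z)" using enn2real_mono[of "ennreal (?c z)" "h z"] z by simp
      then have "?c z powr P \<le> enn2real (h z) powr P" using P by (intro powr_mono2) auto
      then have "ennreal (?c z powr P) \<le> ennreal (enn2real (h z) powr P)" by (rule ennreal_leI)
      also have "\<dots> \<le> ennreal (A powr (P - 1)) * I z" using z by blast
      finally show "ennreal (?c z powr P) \<le> ennreal (A powr (P - 1)) * I z" .
    qed
    also have "\<dots> = ennreal (A powr (P - 1)) * (ennreal A * J)"
      by (subst nn_integral_cmult, measurable) (simp only: I_total)
    also have "\<dots> = ennreal (A powr P) * J"
    proof -
      have "A powr (P - 1) * A = A powr P"
        using A0 P powr_add[of A "P - 1" 1] by (cases "A = 0") auto
      then show ?thesis by (simp only: mult.assoc[symmetric] ennreal_mult'[OF powr_ge_zero, symmetric])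
    qed
    finally have total: "(\<integral>\<^sup>+z. ennreal (?c z powr P) \<partial>cone_measure) \<le> ennreal (A powr P) * J" .
    have "cone_norm \<kappa> \<mu> p (pseudo_conv \<kappa> \<mu> f g) = ennpow (\<integral>\<^sup>+z. ennreal (?c z powr P) \<partial>cone_measure) (1 / P)"
    proof -
      have "(\<integral>\<^sup>+z. ennreal ((\<bar>pseudo_conv \<kappa> \<mu> f g z\<bar> * exp (- snd z / 2)) powr P) * cone_weight_at z \<partial>lborel)
         = (\<integral>\<^sup>+z. ennreal (?c z powr P) * cone_weight_at z \<partial>lborel)"
        by (rule nn_integral_cong) (auto simp: conv_eq split: split_indicator)
      then show ?thesis
        unfolding cone_norm_finite_eq[OF False] P_def[symmetric]
        by (subst nn_integral_cone_measure) auto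
    qed
    also have "\<dots> \<le> ennpow (ennreal (A powr P) * J) (1 / P)"
      using total P by (intro ennpow_mono) auto
    also have "\<dots> = ennpow J (1 / P) * ennreal A"
      using A0 P J by (intro ennpow_mult_powr) auto
    finally show ?thesis using ex norm_f by simp
  qed
  moreover have "cone_norm \<kappa> \<mu> p f * ennreal A < \<infinity>"
    using ffin by (simp add: ennreal_mult_less_top)
  ultimately show ?thesis
    using conv_meas by (auto simp: cone_Lp_def A intro: le_less_trans)
qed

end

text \<open>A divergent integral has the value 0, so the inequality is accompanied by absolute
  convergence of the convolution almost everywhere and by membership of the result in the space,
  which includes its measurability.\<close>

theorem theorem5p8:
  fixes \<kappa> :: "real ^ 'd" and \<mu> :: real and p :: ennreal
    and f :: "(real ^ 'd) \<times> real \<Rightarrow> real" and g :: "real \<Rightarrow> real"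
  assumes "\<And>i. 0 \<le> \<kappa> $ i" and "0 \<le> \<mu>" and "1/2 \<le> cone_alpha \<kappa> \<mu>"
    and "1 \<le> p"
    and "f \<in> cone_Lp \<kappa> \<mu> p" and "g \<in> halfline_L1 (2 * cone_alpha \<kappa> \<mu>)"
  shows "(AE z in lebesgue_on solid_cone. pseudo_conv_exists \<kappa> \<mu> f g z)
    \<and> pseudo_conv \<kappa> \<mu> f g \<in> cone_Lp \<kappa> \<mu> p
    \<and> cone_norm \<kappa> \<mu> p (pseudo_conv \<kappa> \<mu> f g)
        \<le> cone_norm \<kappa> \<mu> p f * halfline_norm1 (2 * cone_alpha \<kappa> \<mu>) g"
proof -
  interpret cone_weight \<kappa> \<mu> by unfold_locales (rule assms)+
  show ?thesis by (rule pseudo_conv_young) (rule assms)+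
qed

end
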